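(* Let $s\in(0,1)$, $p\in(1,\infty)$ and $w\in A_p$. Let $\Omega\subset\mathbb{R}^n$ be open and bounded with fat complement, i.e. there exists $\beta\in(0,1)$ such that for every $x\in\partial\Omega$ and every $r>0$ one has $|B_r(x)\setminus\Omega|\ge\beta|B_r(x)|$. Then $C_c^\infty(\Omega)$ is dense in $W^{s,p}_{w,0}(\Omega)$.
   Context: Throughout $n\ge2$; $B_r(x)$ is the ball with center $x$ and radius $r$, and $|U|$ is Lebesgue measure. A weight is a function $w\in L^1_{\mathrm{loc}}(\mathbb{R}^n)$ with $w>0$ a.e.; $w(U)=\int_U w\,dx$. For $1<p<\infty$, $w\in A_p$ means $$[w]_{A_p}:=\sup_{B}\Big(\frac1{|B|}\int_B w\,dx\Big)\Big(\frac1{|B|}\int_B w^{\frac1{1-p}}dx\Big)^{p-1}<\infty,$$ the supremum being over all balls in $\mathbb{R}^n$. For $x,y\in\mathbb{R}^n$ let $B_{x,y}$ be the ball with center $\frac{x+y}2$ and radius $\frac12|x-y|$. Let $0<\lambda\le\Lambda<\infty$ and let $k:\mathbb{R}^n\times\mathbb{R}^n\to[0,\infty)$ be a measurable kernel with $\lambda\frac{w(x)w(y)}{w(B_{x,y})}\le k(x,y)\le\Lambda\frac{w(x)w(y)}{w(B_{x,y})}$. Set $$\mathcal{J}^s_{p,w}(v)=s(1-s)\int_{\mathbb{R}^n}\int_{\mathbb{R}^n}\Big(\frac{|v(x)-v(y)|}{|x-y|^s}\Big)^p k(x,y)\,dx\,dy,$$ $W^{s,p}_w(\mathbb{R}^n)=\{v\in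 L^1_{\mathrm{loc}}(\mathbb{R}^n):\mathcal{J}^s_{p,w}(v)<\infty\}$, $|v|_{W^{s,p}_w(\mathbb{R}^n)}=(\mathcal{J}^s_{p,w}(v))^{1/p}$, and $W^{s,p}_{w,0}(\Omega)=\{v\in W^{s,p}_w(\mathbb{R}^n): v=0 \text{ a.e. on }\Omega^c\}$, normed by $|\cdot|_{W^{s,p}_w(\mathbb{R}^n)}$. Functions in $C_c^\infty(\Omega)$ are extended by zero. *)

theory Defs
  imports "HOL-Analysis.Analysis"
begin

(* The convention \<infinity>^q = \<infinity> is the intended one only for q > 0, the only case used below. *)
definition ennreal_rpow :: "ennreal \<Rightarrow> real \<Rightarrow> ennreal" where
  "ennreal_rpow a q = (if a = \<infinity> then \<infinity> else ennreal (enn2real a powr q))"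

definition L1_loc :: "('a::euclidean_space \<Rightarrow> real) set" where
  "L1_loc = {f. \<forall>K. compact K \<longrightarrow> f absolutely_integrable_on K}"

definition weight :: "('a::euclidean_space \<Rightarrow> real) \<Rightarrow> bool" where
  "weight w \<longleftrightarrow> w \<in> L1_loc \<and> (AE x in lebesgue. w x > 0)"

definition weight_meas :: "('a::euclidean_space \<Rightarrow> real) \<Rightarrow> 'a set \<Rightarrow> real" where
  "weight_meas w U = set_lebesgue_integral lebesgue U w"

definition average :: "('a::euclidean_space \<Rightarrow> real) \<Rightarrow> 'a set \<Rightarrow> ennreal" where
  "average f B = set_nn_integral lebesgue B (\<lambda>x. ennreal (f x)) / emeasure lebesgue B"

(* Valued in ennreal, because w powr (1 / (1 - p)) need not be locally integrable. *)
definition Ap_const :: "real \<Rightarrow> ('a::euclidean_space \<Rightarrow> real) \<Rightarrow> ennreal" where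
  "Ap_const p w = (SUP (z, r) \<in> UNIV \<times> {0<..}.
     average w (ball z r) *
     ennreal_rpow (average (\<lambda>x. w x powr (1 / (1 - p))) (ball z r)) (p - 1))"

definition Ap_class :: "real \<Rightarrow> ('a::euclidean_space \<Rightarrow> real) set" where
  "Ap_class p = {w. weight w \<and> Ap_const p w < \<infinity>}"

definition mid_ball :: "'a::euclidean_space \<Rightarrow> 'a \<Rightarrow> 'a set" where
  "mid_ball x y = ball ((1/2) *\<^sub>R (x + y)) (norm (x - y) / 2)"

(* The two-sided bound is required almost everywhere: w is only determined up to null sets,
   and the quotient is meaningless on the diagonal, where mid_ball x x is empty. *)
definition admissible_kernel ::
  "('a::euclidean_space \<Rightarrow> real) \<Rightarrow> real \<Rightarrow> real \<Rightarrow> ('a \<Rightarrow> 'a \<Rightarrow> real) \<Rightarrow> bool" where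
  "admissible_kernel w lam Lam k \<longleftrightarrow>
     (\<lambda>(x, y). k x y) \<in> borel_measurable lebesgue \<and>
     (\<forall>x y. 0 \<le> k x y) \<and>
     (AE (x, y) in lebesgue.
        lam * (w x * w y / weight_meas w (mid_ball x y)) \<le> k x y \<and>
        k x y \<le> Lam * (w x * w y / weight_meas w (mid_ball x y)))"

definition energy ::
  "real \<Rightarrow> real \<Rightarrow> ('a::euclidean_space \<Rightarrow> 'a \<Rightarrow> real) \<Rightarrow> ('a \<Rightarrow> real) \<Rightarrow> ennreal" where
  "energy s p k v = ennreal (s * (1 - s)) *
     (\<integral>\<^sup>+ y. (\<integral>\<^sup>+ x. ennreal ((\<bar>v x - v y\<bar> / norm (x - y) powr s) powr p * k x y)
        \<partial>lebesgue) \<partial>lebesgue)"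

definition sobolev ::
  "real \<Rightarrow> real \<Rightarrow> ('a::euclidean_space \<Rightarrow> 'a \<Rightarrow> real) \<Rightarrow> ('a \<Rightarrow> real) set" where
  "sobolev s p k = {v \<in> L1_loc. energy s p k v < \<infinity>}"

definition sobolev_norm ::
  "real \<Rightarrow> real \<Rightarrow> ('a::euclidean_space \<Rightarrow> 'a \<Rightarrow> real) \<Rightarrow> ('a \<Rightarrow> real) \<Rightarrow> ennreal" where
  "sobolev_norm s p k v = ennreal_rpow (energy s p k v) (1 / p)"

(* Elements are functions, not classes modulo almost everywhere equality. *)
definition sobolev0 ::
  "real \<Rightarrow> real \<Rightarrow> ('a::euclidean_space \<Rightarrow> 'a \<Rightarrow> real) \<Rightarrow> 'a set \<Rightarrow> ('a \<Rightarrow> real) set" where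
  "sobolev0 s p k \<Omega> = {v \<in> sobolev s p k. AE x in lebesgue. x \<notin> \<Omega> \<longrightarrow> v x = 0}"

primrec Ck :: "nat \<Rightarrow> ('a::euclidean_space \<Rightarrow> real) \<Rightarrow> bool" where
  "Ck 0 f \<longleftrightarrow> continuous_on UNIV f"
| "Ck (Suc m) f \<longleftrightarrow> (\<forall>x. f differentiable at x) \<and>
     (\<forall>h. Ck m (\<lambda>x. frechet_derivative f (at x) h))"

(* Functions already extended by zero to the whole space. *)
definition Cc_infty :: "'a::euclidean_space set \<Rightarrow> ('a \<Rightarrow> real) set" where
  "Cc_infty \<Omega> = {f. (\<forall>m. Ck m f) \<and> compact (closure {x. f x \<noteq> 0}) \<and> closure {x. f x \<noteq> 0} \<subseteq> \<Omega>}"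

definition fat_complement :: "'a::euclidean_space set \<Rightarrow> bool" where
  "fat_complement \<Omega> \<longleftrightarrow> (\<exists>\<beta>. 0 < \<beta> \<and> \<beta> < 1 \<and>
     (\<forall>x \<in> frontier \<Omega>. \<forall>r > 0.
        measure lebesgue (ball x r - \<Omega>) \<ge> \<beta> * measure lebesgue (ball x r)))"

definition dense_wrt :: "(('a \<Rightarrow> real) \<Rightarrow> ennreal) \<Rightarrow> ('a \<Rightarrow> real) set \<Rightarrow> ('a \<Rightarrow> real) set \<Rightarrow> bool" where
  "dense_wrt N C W \<longleftrightarrow> C \<subseteq> W \<and>
     (\<forall>v \<in> W. \<forall>\<epsilon>::real. \<epsilon> > 0 \<longrightarrow> (\<exists>\<phi> \<in> C. N (\<lambda>x. v x - \<phi> x) < ennreal \<epsilon>))"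

end

theory Submission
  imports Defs
begin

text \<open>
  By the two-sided bound on the kernel, the energy is comparable, for every measurable \<open>v\<close>, to
  \<open>E(v) = \<integral>\<integral> |v(x) - v(y)|^p k0(x,y) d\<mu>(x) d\<mu>(y)\<close> with \<open>d\<mu> = w dx\<close> and
  \<open>k0(x,y) = |x - y|^(-sp) / \<mu>(B_{x,y})\<close> (\<open>energy_comparable\<close>). The \<open>A_p\<close> condition enters only
  through the averaging inequality \<open>\<mu>(B) (avg_B f)^p \<le> K \<integral>_B f^p d\<mu>\<close>, which Hoelder's
  inequality extracts from it (\<open>Ap_class_imp_Ap_density\<close>). For indicator functions it says that
  \<open>\<mu>\<close> is doubling and that a set filling a fixed fraction of a ball carries a fixed fraction of
  its mass. Summing over dyadic annuli gives the bound used throughout,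
  \<open>\<integral> min(1, |x - y|/t)^p k0(x,y) d\<mu>(y) \<le> C t^(-sp)\<close> (\<open>min_kern_integral\<close>); in particular
  compactly supported Lipschitz functions have finite energy.

  Let \<open>v\<close> have finite energy and vanish outside \<open>\<Omega>\<close>. The first step makes \<open>v\<close> bounded with
  compact support in \<open>\<Omega>\<close>. If \<open>y\<close> has distance \<open>d(y)\<close> to the complement, then by fatness the
  complement fills a fixed fraction of the ball \<open>B_{2d(y)}(y)\<close>, hence
  \<open>\<integral>_{\<Omega>^c} k0(x,y) d\<mu>(x) \<ge> c d(y)^(-sp)\<close>. As \<open>v(x) - v(y) = - v(y)\<close> for \<open>x\<close> outside
  \<open>\<Omega>\<close>, the pairs in \<open>\<Omega>^c \<times> \<Omega>\<close> alone yield the Hardy inequality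
  \<open>c \<integral>_\<Omega> |v|^p d^(-sp) d\<mu> \<le> E(v)\<close> (\<open>hardy\<close>). It makes
  \<open>|v(y)|^p min(1, |x - y|/d(y))^p k0(x,y)\<close> integrable, and this function together with
  \<open>|v(x) - v(y)|^p k0(x,y)\<close> dominates, up to constants, the energy density of the difference
  between \<open>v\<close> and its truncation at height \<open>j\<close>, cut off at distance \<open>1/j\<close> from the complement.
  One application of dominated convergence finishes the step (\<open>cutoff_approx\<close>).

  The second step mollifies a bounded compactly supported \<open>u\<close>. The measure
  \<open>k0(x,y) d\<mu>(x) d\<mu>(y)\<close> is not controlled under the translations \<open>(x,y) \<mapsto> (x+z,y+z)\<close>: the
  product \<open>w(x+z) w(y+z)\<close> of two \<open>A_p\<close> weights in \<open>z\<close> need not even be locally integrable. So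
  the two points are averaged independently of each other,
  \<open>|u_r(x) - u_r(y)| \<le> C min(1, |x - y|/r) avg_{x' in B_r(x)} avg_{y' in B_r(y)} |u(x') - u(y')|\<close>
  (\<open>convol_diff_le\<close>), and the averaging inequality is used once in each variable. Exchanging the
  order of the four integrations, the estimate \<open>E_\<delta>(u_r) \<le> C E_{\<delta>+2r}(u)\<close> for the energies
  restricted to \<open>|x - y| < \<delta>\<close> (\<open>convol_Enl\<close>) reduces to a bound for the kernel
  alone (\<open>S_bound\<close>). Hence the energy of \<open>u_r - u\<close> near the diagonal is small uniformly in
  small \<open>r\<close>, while away from the diagonal it is at most a constant times
  \<open>\<integral> |u_r - u|^p d\<mu>\<close> (\<open>En_split\<close>), which tends to \<open>0\<close> (\<open>convol_Lp\<close>).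
\<close>

section \<open>Smooth mollifiers\<close>

text \<open>
  For \<open>m = 0\<close> this is the standard smooth function vanishing to infinite order at \<open>0\<close>. The powers of
  \<open>t\<close> in the denominator make the family closed under differentiation.
\<close>

definition expinv :: "nat \<Rightarrow> real \<Rightarrow> real" where
  "expinv m t = (if t > 0 then exp (- (1 / t)) / t ^ m else 0)"

lemma pow_div_fact_le_exp: "(x::real) ^ k / fact k \<le> exp x" if "0 \<le> x"
proof -
  (* one term of the exponential series *)
  have "(\<Sum>n\<in>{k}. x ^ n /\<^sub>R fact n) \<le> (\<Sum>n. x ^ n /\<^sub>R fact n)"
    by (rule sum_le_suminf[OF summable_exp_generic])
      (use that in \<open>auto intro!: mult_nonneg_nonneg\<close>)
  then show ?thesis by (simp add: exp_def divide_inverse mult.commute)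
qed

lemma expinv_nonneg: "0 \<le> expinv m t"
  by (simp add: expinv_def)

text \<open>
  Since \<open>exp u \<ge> u^n / n!\<close> with \<open>u = 1/t\<close>, the exponential beats any power of \<open>t\<close>. The case
  \<open>k = 2\<close> gives differentiability at \<open>0\<close>, the case \<open>k = 0\<close> boundedness.
\<close>
lemma expinv_le: "expinv m t \<le> fact (m + k) * t ^ k" if "0 \<le> t"
proof (cases "t = 0")
  case False
  with that have t: "t > 0" by simp
  have "(1 / t) ^ (m + k) / fact (m + k) \<le> exp (1 / t)"
    by (rule pow_div_fact_le_exp) (use t in simp)
  then have "exp (- (1 / t)) * ((1 / t) ^ (m + k) / fact (m + k)) \<le> exp (- (1 / t)) * exp (1 / t)"
    by (intro mult_left_mono) auto
  also have "\<dots> = 1" by (simp add: mult_exp_exp)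
  finally have "exp (- (1 / t)) * ((1 / t) ^ (m + k) / fact (m + k)) \<le> 1" .
  then show ?thesis using t by (simp add: expinv_def field_simps power_add)
qed (simp add: expinv_def that)

lemma expinv_has_derivative:
  "(expinv m has_real_derivative expinv (m + 2) t - real m * expinv (m + 1) t) (at t)"
proof -
  consider "t > 0" | "t < 0" | "t = 0" by linarith
  then show ?thesis
  proof cases
    case 1
    have "((\<lambda>t. exp (- (1 / t)) / t ^ m) has_real_derivative
        expinv (m + 2) t - real m * expinv (m + 1) t) (at t)"
    proof (cases m)
      case 0
      then show ?thesis using 1
        by (auto intro!: derivative_eq_intros simp: expinv_def field_simps power2_eq_square)
    next
      case (Suc j)
      have P: "((\<lambda>t. t ^ Suc j) has_real_derivative real (Suc j) * t ^ j) (at t)"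
        using DERIV_pow[of "Suc j" t] by simp
      have E: "((\<lambda>t. exp (- (1 / t))) has_real_derivative exp (- (1 / t)) / t\<^sup>2) (at t)"
        using 1 by (auto intro!: derivative_eq_intros simp: power2_eq_square)
      have "(exp (- (1 / t)) / t\<^sup>2 * t ^ Suc j - exp (- (1 / t)) * (real (Suc j) * t ^ j)) /
          (t ^ Suc j * t ^ Suc j) = expinv (m + 2) t - real m * expinv (m + 1) t"
        using 1 Suc by (simp add: expinv_def field_simps power2_eq_square)
      with DERIV_divide[OF E P] 1 Suc show ?thesis by simp
    qed
    then show ?thesis
      by (rule has_field_derivative_transform_within_open[where S="{0<..}"])
        (use 1 in \<open>auto simp: expinv_def\<close>)
  next
    case 2
    have "((\<lambda>t. 0) has_real_derivative expinv (m + 2) t - real m * expinv (m + 1) t) (at t)"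
      using 2 by (simp add: expinv_def)
    then show ?thesis
      by (rule has_field_derivative_transform_within_open[where S="{..<0}"])
        (use 2 in \<open>auto simp: expinv_def\<close>)
  next
    case 3
    have "((\<lambda>h. (expinv m (0 + h) - expinv m 0) / h) \<longlongrightarrow> 0) (at 0)"
    proof (rule Lim_null_comparison)
      show "\<forall>\<^sub>F h in at 0. norm ((expinv m (0 + h) - expinv m 0) / h) \<le> fact (m + 2) * \<bar>h\<bar>"
      proof (rule always_eventually, rule allI)
        fix h :: real
        show "norm ((expinv m (0 + h) - expinv m 0) / h) \<le> fact (m + 2) * \<bar>h\<bar>"
        proof (cases "h > 0")
          case True
          have "expinv m h \<le> fact (m + 2) * h ^ 2" using True by (intro expinv_le) simp
          then have "expinv m h / h \<le> fact (m + 2) * h" using True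
            by (simp add: field_simps power2_eq_square)
          then show ?thesis using True expinv_nonneg[of m h] by (simp add: expinv_def abs_mult)
        next
          case False
          then have "expinv m h = 0" "expinv m 0 = 0" by (simp_all add: expinv_def)
          then show ?thesis by simp
        qed
      qed
      show "((\<lambda>h. fact (m + 2) * \<bar>h\<bar>) \<longlongrightarrow> 0) (at (0::real))"
        by (auto intro!: tendsto_eq_intros)
    qed
    then show ?thesis using 3 by (simp add: DERIV_def expinv_def)
  qed
qed

text \<open>
  An algebra of functions that contains the bump \<open>exp (- 1 / (1 - a |x|\<^sup>2))\<close> and is closed under
  directional derivatives. Smoothness of the bump follows by induction on the order, without
  a formula for its higher derivatives.
\<close>
inductive bump_alg :: "real \<Rightarrow> ('a::euclidean_space \<Rightarrow> real) \<Rightarrow> bool" for a where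
  const: "bump_alg a (\<lambda>x. c)"
| inner: "bump_alg a (\<lambda>x. x \<bullet> b)"
| expinv: "bump_alg a (\<lambda>x. expinv m (1 - a * (x \<bullet> x)))"
| add: "bump_alg a f \<Longrightarrow> bump_alg a g \<Longrightarrow> bump_alg a (\<lambda>x. f x + g x)"
| mult: "bump_alg a f \<Longrightarrow> bump_alg a g \<Longrightarrow> bump_alg a (\<lambda>x. f x * g x)"

lemma bump_alg_derivative:
  "bump_alg a f \<Longrightarrow> \<exists>f'. \<forall>x. (f has_derivative f' x) (at x) \<and> (\<forall>h. bump_alg a (\<lambda>x. f' x h))"
proof (induction rule: bump_alg.induct)
  case (const c)
  show ?case by (rule exI[of _ "\<lambda>x h. 0"]) (auto intro: bump_alg.const)
next
  case (inner b)
  show ?case by (rule exI[of _ "\<lambda>x h. h \<bullet> b"])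
      (auto intro!: bump_alg.const derivative_eq_intros)
next
  case (expinv m)
  let ?g = "\<lambda>x::'a. expinv (m + 2) (1 - a * (x \<bullet> x)) + (- real m) * expinv (m + 1) (1 - a * (x \<bullet> x))"
  have D: "((\<lambda>x::'a. expinv m (1 - a * (x \<bullet> x))) has_derivative (\<lambda>h. ?g x * (- 2 * a * (x \<bullet> h)))) (at x)" for x
  proof -
    have "((\<lambda>x::'a. 1 - a * (x \<bullet> x)) has_derivative (\<lambda>h. - 2 * a * (x \<bullet> h))) (at x)"
      by (auto intro!: derivative_eq_intros simp: inner_commute algebra_simps)
    from has_derivative_compose[OF this expinv_has_derivative[unfolded has_field_derivative_def]]
    show ?thesis by (simp add: mult.commute)
  qed
  have "bump_alg a (\<lambda>x. ?g x * (- 2 * a * (x \<bullet> h)))" for h :: 'a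
    by (intro bump_alg.intros)
  with D show ?case
    by (intro exI[of _ "\<lambda>x h. ?g x * (- 2 * a * (x \<bullet> h))"]) blast
next
  case (add f g)
  then obtain f' g' where "\<forall>x. (f has_derivative f' x) (at x) \<and> (\<forall>h. bump_alg a (\<lambda>x. f' x h))"
    "\<forall>x. (g has_derivative g' x) (at x) \<and> (\<forall>h. bump_alg a (\<lambda>x. g' x h))" by blast
  then show ?case
    by (intro exI[of _ "\<lambda>x h. f' x h + g' x h"]) (auto intro!: bump_alg.add derivative_intros)
next
  case (mult f g)
  then obtain f' g' where "\<forall>x. (f has_derivative f' x) (at x) \<and> (\<forall>h. bump_alg a (\<lambda>x. f' x h))"
    "\<forall>x. (g has_derivative g' x) (at x) \<and> (\<forall>h. bump_alg a (\<lambda>x. g' x h))" by blast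
  then show ?case using mult.hyps
    by (intro exI[of _ "\<lambda>x h. f x * g' x h + f' x h * g x"])
       (auto intro!: bump_alg.add bump_alg.mult derivative_intros)
qed

lemma bump_alg_imp_Ck: "bump_alg a f \<Longrightarrow> Ck m f"
proof (induction m arbitrary: f)
  case 0
  obtain f' where "\<forall>x. (f has_derivative f' x) (at x)" using bump_alg_derivative[OF 0] by blast
  then have "continuous (at x) f" for x using has_derivative_continuous by blast
  then show ?case by (simp add: continuous_at_imp_continuous_on)
next
  case (Suc m)
  obtain f' where f': "\<forall>x. (f has_derivative f' x) (at x) \<and> (\<forall>h. bump_alg a (\<lambda>x. f' x h))"
    using bump_alg_derivative[OF Suc.prems] by blast
  then have "frechet_derivative f (at x) = f' x" for x using frechet_derivative_at by metis
  then show ?case using f' Suc.IH by (auto simp: differentiable_def)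
qed

text \<open>
  A Lipschitz bound for the profile as a function of the radius. Composing it with \<open>u = 2 |x| / r\<close>
  shows how the Lipschitz constant of the bump scales with its radius.
\<close>
lemma expinv_square_lipschitz:
  "\<bar>expinv 0 (1 - u\<^sup>2) - expinv 0 (1 - v\<^sup>2)\<bar> \<le> 4 * \<bar>u - v\<bar>"
proof -
  have D0: "(expinv 0 has_real_derivative expinv 2 t) (at t)" for t
    using expinv_has_derivative[of 0 t] by (simp add: numeral_2_eq_2)
  have D: "((\<lambda>u. expinv 0 (1 - u\<^sup>2)) has_real_derivative expinv 2 (1 - u\<^sup>2) * (- (2 * u))) (at u)" for u
  proof -
    have "((\<lambda>u. 1 - u\<^sup>2) has_real_derivative - (2 * u)) (at u)"
      by (auto intro!: derivative_eq_intros)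
    from DERIV_chain2[OF D0 this] show ?thesis .
  qed
  have B: "norm (expinv 2 (1 - u\<^sup>2) * (- (2 * u))) \<le> 4" for u
  proof (cases "\<bar>u\<bar> < 1")
    case True
    then have "u\<^sup>2 < 1" by (simp add: abs_square_less_1)
    then have E2: "expinv 2 (1 - u\<^sup>2) \<le> 2" using expinv_le[of "1 - u\<^sup>2" 2 0] by simp
    have "norm (expinv 2 (1 - u\<^sup>2) * (- (2 * u))) = expinv 2 (1 - u\<^sup>2) * \<bar>2 * u\<bar>"
      by (simp only: real_norm_def abs_mult[of "expinv _ _"] abs_minus_cancel abs_of_nonneg[OF expinv_nonneg])
    also have "\<dots> \<le> 2 * 2" by (rule mult_mono[OF E2]) (use True in simp_all)
    finally show ?thesis by simp
  next
    case False
    then have "\<not> u\<^sup>2 < 1" by (simp add: abs_square_less_1)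
    then have "expinv 2 (1 - u\<^sup>2) = 0" unfolding expinv_def by (intro if_not_P) linarith
    then show ?thesis by simp
  qed
  have "norm (expinv 0 (1 - u\<^sup>2) - expinv 0 (1 - v\<^sup>2)) \<le> 4 * norm (u - v)"
    by (rule field_differentiable_bound[of UNIV "\<lambda>u. expinv 0 (1 - u\<^sup>2)"
          "\<lambda>u. expinv 2 (1 - u\<^sup>2) * (- (2 * u))", OF convex_UNIV D B UNIV_I UNIV_I])
  then show ?thesis by (simp only: real_norm_def)
qed

lemma expinv_sphere_lipschitz:
  fixes x y :: "'a::euclidean_space"
  assumes r: "0 < r"
  shows "\<bar>expinv 0 (1 - 4 / r\<^sup>2 * (x \<bullet> x)) - expinv 0 (1 - 4 / r\<^sup>2 * (y \<bullet> y))\<bar> \<le> 8 / r * norm (x - y)"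
proof -
  have eq: "1 - 4 / r\<^sup>2 * (z \<bullet> z) = 1 - (2 / r * norm z)\<^sup>2" for z :: 'a
    by (simp add: power_mult_distrib power_divide dot_square_norm)
  have "\<bar>expinv 0 (1 - 4 / r\<^sup>2 * (x \<bullet> x)) - expinv 0 (1 - 4 / r\<^sup>2 * (y \<bullet> y))\<bar>
      \<le> 4 * \<bar>2 / r * norm x - 2 / r * norm y\<bar>"
    unfolding eq by (rule expinv_square_lipschitz)
  also have "\<bar>2 / r * norm x - 2 / r * norm y\<bar> = 2 / r * \<bar>norm x - norm y\<bar>"
    using r by (simp only: right_diff_distrib[symmetric] abs_mult) simp
  also have "4 * (2 / r * \<bar>norm x - norm y\<bar>) \<le> 4 * (2 / r * norm (x - y))"
    using r by (intro mult_left_mono norm_triangle_ineq3) auto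
  finally show ?thesis by simp
qed

lemma bounded_support_integrable:
  fixes f :: "'a::euclidean_space \<Rightarrow> real"
  assumes "f \<in> borel_measurable borel" "\<And>x. \<bar>f x\<bar> \<le> B" "\<And>x. x \<notin> S \<Longrightarrow> f x = 0"
    "bounded S"
  shows "integrable lborel f"
proof -
  obtain a where a: "S \<subseteq> ball 0 a" using assms(4) bounded_subset_ballD by blast
  have "integrable lborel (\<lambda>x. indicator (ball (0::'a) a) x * B)"
    using emeasure_lborel_ball_finite[of "0::'a" a]
    by (intro integrable_mult_left integrable_real_indicator) (auto simp: less_top)
  then show ?thesis
  proof (rule Bochner_Integration.integrable_bound)
    show "AE x in lborel. norm (f x) \<le> norm (indicator (ball 0 a) x * B :: real)"
    proof (rule AE_I2)
      fix x show "norm (f x) \<le> norm (indicator (ball 0 a) x * B :: real)"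
        using assms(2)[of x] assms(3)[of x] a
        by (cases "x \<in> ball 0 a") (auto simp del: mem_ball_0 mem_ball)
    qed
  qed (use assms in auto)
qed

text \<open>
  The size and Lipschitz bounds are normalised by the volume of the ball of radius \<open>r\<close>, so that one
  constant serves all radii. The support lies in the ball of radius \<open>r / 2\<close>: if
  \<open>|x - y| < r / 2\<close>, then the mollifiers centred at \<open>x\<close> and at \<open>y\<close> both live in the ball of radius \<open>r\<close>
  around \<open>x\<close>.
\<close>
definition mollifier :: "real \<Rightarrow> real \<Rightarrow> ('a::euclidean_space \<Rightarrow> real) \<Rightarrow> bool" where
  "mollifier C r \<eta> \<longleftrightarrow> (\<forall>m. Ck m \<eta>) \<and> (\<forall>x. 0 \<le> \<eta> x \<and> \<eta> x \<le> C / measure lborel (ball (0::'a) r)) \<and>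
     (\<forall>x. r / 2 \<le> norm x \<longrightarrow> \<eta> x = 0) \<and> integral\<^sup>L lborel \<eta> = 1 \<and>
     (\<forall>x y. \<bar>\<eta> x - \<eta> y\<bar> \<le> C * norm (x - y) / (r * measure lborel (ball (0::'a) r)))"

text \<open>
  The bump of radius \<open>r / 2\<close> is at most \<open>1\<close>, and at least \<open>exp (- 4/3)\<close> on the ball of radius
  \<open>r / 4\<close>, whose volume is \<open>4^(-n)\<close> times that of the ball of radius \<open>r\<close>. Dividing the bump by its
  integral therefore changes its bounds by the expected factor.
\<close>
lemma mollifier_exists:
  "\<exists>C>0. \<forall>r>0. \<exists>\<eta>::'a::euclidean_space \<Rightarrow> real. mollifier C r \<eta>"
proof -
  define e where "e = exp (- (4 / 3) :: real)"
  define c where "c = exp (4 / 3) * (4::real) ^ DIM('a)"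
  have c: "c > 0" by (simp add: c_def)
  have "\<exists>\<eta>::'a \<Rightarrow> real. mollifier (8 * c) r \<eta>" if r: "0 < r" for r
  proof -
    define b :: "'a \<Rightarrow> real" where "b x = expinv 0 (1 - 4 / r\<^sup>2 * (x \<bullet> x))" for x
    define I where "I = integral\<^sup>L lborel b"
    let ?V = "measure lborel (ball (0::'a) r)"
    have V: "?V > 0" using r by (simp add: content_ball_pos)
    have b0: "0 \<le> b x" for x by (simp add: b_def expinv_nonneg)
    have b1: "b x \<le> 1" for x by (auto simp: b_def expinv_def)
    have bs: "b x = 0" if "r / 2 \<le> norm x" for x
    proof -
      have "(r / 2)\<^sup>2 \<le> (norm x)\<^sup>2" using that r by (intro power_mono) auto
      then have "4 / r\<^sup>2 * (r / 2)\<^sup>2 \<le> 4 / r\<^sup>2 * (x \<bullet> x)"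
        by (intro mult_left_mono) (simp_all flip: power2_norm_eq_inner)
      moreover have "4 / r\<^sup>2 * (r / 2)\<^sup>2 = 1" using r by (simp add: power2_eq_square)
      ultimately have "1 - 4 / r\<^sup>2 * (x \<bullet> x) \<le> 0" by linarith
      then show ?thesis by (simp add: b_def expinv_def)
    qed
    have blow: "e \<le> b x" if "norm x < r / 4" for x
    proof -
      have "(norm x)\<^sup>2 \<le> (r / 4)\<^sup>2" using that r by (intro power_mono) auto
      then have "4 / r\<^sup>2 * (x \<bullet> x) \<le> 4 / r\<^sup>2 * (r / 4)\<^sup>2"
        by (intro mult_left_mono) (simp_all flip: power2_norm_eq_inner)
      also have "\<dots> = 1 / 4" using r by (simp add: power2_eq_square)
      finally have *: "3 / 4 \<le> 1 - 4 / r\<^sup>2 * (x \<bullet> x)" by simp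
      then have "1 / (1 - 4 / r\<^sup>2 * (x \<bullet> x)) \<le> 4 / 3" 
        using frac_le[OF _ order_refl _ *, of 1] by simp
      moreover have "1 - 4 / r\<^sup>2 * (x \<bullet> x) > 0" using * by linarith
      ultimately show ?thesis by (simp only: b_def expinv_def if_True e_def) simp
    qed
    have balg: "bump_alg (4 / r\<^sup>2) b" unfolding b_def by (rule bump_alg.expinv)
    have bcont: "continuous_on UNIV b" using bump_alg_imp_Ck[OF balg, of 0] by simp
    have bmeas: "b \<in> borel_measurable borel" using bcont borel_measurable_continuous_onI by blast
    have bint: "integrable lborel b"
      by (rule bounded_support_integrable[where B=1 and S="ball 0 (r/2)"])
        (use b0 b1 bs bmeas in \<open>auto simp: abs_le_iff intro: order_trans[OF _ b0]\<close>)
    have "?V / c = e * (?V / 4 ^ DIM('a))"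
      unfolding c_def e_def exp_minus by (simp only: divide_inverse mult_1_left inverse_mult_distrib ac_simps)
    also have "?V / 4 ^ DIM('a) = measure lborel (ball (0::'a) (r / 4))"
      using r content_ball_conv_unit_ball[of r "0::'a"] content_ball_conv_unit_ball[of "r / 4" "0::'a"]
      by (simp add: power_divide)
    also have "e * \<dots> = integral\<^sup>L lborel (\<lambda>x. e * indicator (ball (0::'a) (r/4)) x)"
      using r by simp
    also have "\<dots> \<le> I" unfolding I_def
    proof (rule integral_mono)
      show "integrable lborel (\<lambda>x. e * indicator (ball (0::'a) (r/4)) x)"
        using emeasure_lborel_ball_finite[of "0::'a" "r/4"]
        by (intro integrable_mult_right integrable_real_indicator) (auto simp: less_top)
      show "e * indicator (ball 0 (r/4)) x \<le> b x" for x
        using blow[of x] b0[of x] by (cases "x \<in> ball 0 (r/4)") auto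
    qed (rule bint)
    finally have I: "?V / c \<le> I" .
    have Ipos: "I > 0" using I divide_pos_pos[OF V c] by linarith
    have inv: "1 / I \<le> c / ?V" using frac_le[OF _ order_refl _ I, of 1] V c by simp
    define \<eta> where "\<eta> x = 1 / I * b x" for x
    have "mollifier (8 * c) r \<eta>" unfolding mollifier_def
    proof (intro conjI allI impI)
      show "Ck m \<eta>" for m unfolding \<eta>_def
        by (intro bump_alg_imp_Ck[of "4 / r\<^sup>2"] bump_alg.intros balg)
      show "0 \<le> \<eta> x" for x using b0 Ipos by (simp add: \<eta>_def)
      have "\<eta> x \<le> c / ?V * 1" for x unfolding \<eta>_def
        by (rule mult_mono[OF inv b1]) (use V c b0 in auto)
      also have "c / ?V * 1 \<le> (8 * c) / ?V" using V c by (simp add: divide_right_mono)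
      finally show "\<eta> x \<le> (8 * c) / ?V" for x .
      show "\<eta> x = 0" if "r / 2 \<le> norm x" for x using bs[OF that] by (simp add: \<eta>_def)
      show "integral\<^sup>L lborel \<eta> = 1" unfolding \<eta>_def using Ipos by (simp add: I_def)
      fix x y
      have "\<eta> x - \<eta> y = 1 / I * (b x - b y)" by (simp only: \<eta>_def right_diff_distrib)
      then have "\<bar>\<eta> x - \<eta> y\<bar> = 1 / I * \<bar>b x - b y\<bar>" using Ipos by (simp add: abs_mult)
      also have "\<dots> \<le> c / ?V * (8 / r * norm (x - y))"
        unfolding b_def
        by (rule mult_mono[OF inv expinv_sphere_lipschitz[OF r]]) (use V c in auto)
      also have "\<dots> = (8 * c) * norm (x - y) / (r * ?V)" by (simp add: ac_simps)
      finally show "\<bar>\<eta> x - \<eta> y\<bar> \<le> (8 * c) * norm (x - y) / (r * ?V)" .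
    qed
    then have "\<exists>\<eta>::'a \<Rightarrow> real. mollifier (8 * c) r \<eta>" by (rule exI[of "mollifier (8*c) r" \<eta>])
    then show ?thesis .
  qed
  moreover have "8 * c > 0" using c by simp
  ultimately show ?thesis by blast
qed

definition convol :: "('a::euclidean_space \<Rightarrow> real) \<Rightarrow> ('a \<Rightarrow> real) \<Rightarrow> 'a \<Rightarrow> real" where
  "convol \<eta> v x = (\<integral>z. \<eta> (x - z) * v z \<partial>lborel)"

lemma Ck_imp_continuous: "Ck m f \<Longrightarrow> continuous_on UNIV f"
  by (cases m) (auto simp: continuous_at_imp_continuous_on differentiable_imp_continuous_within)

lemma frechet_derivative_zero_outside:
  fixes \<eta> :: "'a::euclidean_space \<Rightarrow> real"
  assumes "\<And>x. R < norm x \<Longrightarrow> \<eta> x = 0" "R < norm x"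
  shows "frechet_derivative \<eta> (at x) h = 0"
proof -
  have "((\<lambda>x. 0) has_derivative (\<lambda>h. 0)) (at x)" by simp
  then have "(\<eta> has_derivative (\<lambda>h. 0)) (at x)"
    by (rule has_derivative_transform_within_open[of _ _ _ UNIV "- cball 0 R"]) (use assms in auto)
  then show ?thesis using frechet_derivative_at by metis
qed

lemma continuous_compact_support_bounded:
  fixes g :: "'a::euclidean_space \<Rightarrow> real"
  assumes "continuous_on UNIV g" "\<And>x. R < norm x \<Longrightarrow> g x = 0"
  shows "\<exists>B\<ge>0. \<forall>x. \<bar>g x\<bar> \<le> B"
proof -
  have "bounded (g ` cball 0 R)"
    by (intro compact_imp_bounded compact_continuous_image continuous_on_subset[OF assms(1)]) auto
  then obtain B where "\<And>x. x \<in> cball 0 R \<Longrightarrow> \<bar>g x\<bar> \<le> B" unfolding bounded_iff by force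
  then have "\<bar>g x\<bar> \<le> max B 0" for x using assms(2)[of x] by (cases "norm x \<le> R") force+
  then show ?thesis by (intro exI[of _ "max B 0"]) simp
qed

text \<open>
  The partial derivatives are continuous with compact support, hence bounded; expanding the
  direction in the standard basis bounds all directional derivatives.
\<close>
lemma Ck_derivative_bound:
  fixes \<eta> :: "'a::euclidean_space \<Rightarrow> real"
  assumes "\<And>m. Ck m \<eta>" "\<And>x. R < norm x \<Longrightarrow> \<eta> x = 0"
  shows "\<exists>L\<ge>0. \<forall>x h. \<bar>frechet_derivative \<eta> (at x) h\<bar> \<le> L * norm h"
proof -
  have "\<exists>B\<ge>0. \<forall>x. \<bar>frechet_derivative \<eta> (at x) b\<bar> \<le> B" for b
  proof (rule continuous_compact_support_bounded)
    show "continuous_on UNIV (\<lambda>x. frechet_derivative \<eta> (at x) b)"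
      using assms(1)[of "Suc 0"] by auto
  qed (rule frechet_derivative_zero_outside[OF assms(2)])
  then obtain B where B: "\<And>b. B b \<ge> 0" "\<And>b x. \<bar>frechet_derivative \<eta> (at x) b\<bar> \<le> B b" by metis
  have "\<bar>frechet_derivative \<eta> (at x) h\<bar> \<le> (\<Sum>b\<in>Basis. B b) * norm h" for x h
  proof -
    have lin: "linear (frechet_derivative \<eta> (at x))"
      using assms(1)[of "Suc 0"] linear_frechet_derivative by auto
    have "frechet_derivative \<eta> (at x) h = frechet_derivative \<eta> (at x) (\<Sum>b\<in>Basis. (h \<bullet> b) *\<^sub>R b)"
      by (simp add: euclidean_representation)
    also have "\<dots> = (\<Sum>b\<in>Basis. (h \<bullet> b) * frechet_derivative \<eta> (at x) b)"
      using lin by (simp add: linear_sum linear_cmul)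
    finally have "\<bar>frechet_derivative \<eta> (at x) h\<bar> \<le> (\<Sum>b\<in>Basis. \<bar>(h \<bullet> b) * frechet_derivative \<eta> (at x) b\<bar>)"
      by simp
    also have "\<dots> \<le> (\<Sum>b\<in>Basis. norm h * B b)"
      by (intro sum_mono) (auto simp: abs_mult intro!: mult_mono Basis_le_norm B)
    finally show ?thesis by (simp add: sum_distrib_left mult.commute)
  qed
  then show ?thesis using B(1) by (intro exI[of _ "\<Sum>b\<in>Basis. B b"]) (auto intro: sum_nonneg)
qed

lemma Ck_lipschitz:
  fixes \<eta> :: "'a::euclidean_space \<Rightarrow> real"
  assumes "Ck (Suc 0) \<eta>" "\<And>x h. \<bar>frechet_derivative \<eta> (at x) h\<bar> \<le> L * norm h"
  shows "\<bar>\<eta> x - \<eta> y\<bar> \<le> L * norm (x - y)"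
proof -
  have "norm (\<eta> x - \<eta> y) \<le> L * norm (x - y)"
  proof (rule differentiable_bound[where S=UNIV and f'="\<lambda>x. frechet_derivative \<eta> (at x)"])
    show "(\<eta> has_derivative frechet_derivative \<eta> (at x)) (at x within UNIV)" for x
      using assms(1) by (simp add: frechet_derivative_works)
    show "onorm (frechet_derivative \<eta> (at x)) \<le> L" for x
      by (rule onorm_le) (use assms(2) in auto)
  qed auto
  then show ?thesis by simp
qed

lemma has_derivative_at_quotient:
  fixes f :: "'a::real_normed_vector \<Rightarrow> real"
  shows "(f has_derivative f') (at x) \<longleftrightarrow>
    bounded_linear f' \<and> ((\<lambda>y. (f y - f x - f' (y - x)) / norm (y - x)) \<longlongrightarrow> 0) (at x)"
  by (simp only: has_derivative_at2 real_scaleR_def diff_diff_eq times_divide_eq_left mult_1_left)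

text \<open>
  Differentiation under the integral sign: the difference quotients of \<open>\<eta>\<close> are bounded by twice
  the Lipschitz constant, so dominated convergence applies along every sequence tending to \<open>x\<close>.
\<close>
lemma convol_has_derivative:
  fixes \<eta> v :: "'a::euclidean_space \<Rightarrow> real"
  assumes \<eta>: "\<And>m. Ck m \<eta>" "\<And>x. R < norm x \<Longrightarrow> \<eta> x = 0" and v: "integrable lborel v"
  shows "(convol \<eta> v has_derivative (\<lambda>h. convol (\<lambda>x. frechet_derivative \<eta> (at x) h) v x)) (at x)"
proof -
  let ?D = "\<lambda>x. frechet_derivative \<eta> (at x)"
  obtain L where L: "L \<ge> 0" "\<And>x h. \<bar>?D x h\<bar> \<le> L * norm h" using Ck_derivative_bound[OF \<eta>] by blast
  have lip: "\<bar>\<eta> x - \<eta> y\<bar> \<le> L * norm (x - y)" for x y using Ck_lipschitz[OF \<eta>(1) L(2)] .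
  obtain B where B: "B \<ge> 0" "\<And>x. \<bar>\<eta> x\<bar> \<le> B"
    using continuous_compact_support_bounded[OF Ck_imp_continuous[OF \<eta>(1)] \<eta>(2)] by blast
  have [measurable]: "\<eta> \<in> borel_measurable borel"
    using Ck_imp_continuous[OF \<eta>(1)] borel_measurable_continuous_onI by blast
  have [measurable]: "(\<lambda>x. ?D x h) \<in> borel_measurable borel" for h
    using \<eta>(1)[of "Suc 0"] by (auto intro: borel_measurable_continuous_onI)
  have [measurable]: "v \<in> borel_measurable borel" using v by auto
  have lin: "linear (?D x)" for x using \<eta>(1)[of "Suc 0"] linear_frechet_derivative by auto
  have i1: "integrable lborel (\<lambda>z. \<eta> (x - z) * v z)" for x
  proof (rule Bochner_Integration.integrable_bound[where f="\<lambda>z. B * v z"])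
    show "AE z in lborel. norm (\<eta> (x - z) * v z) \<le> norm (B * v z)"
      using B by (auto simp: abs_mult intro!: mult_right_mono)
  qed (use v in auto)
  have i2: "integrable lborel (\<lambda>z. ?D (x - z) h * v z)" for x h
  proof (rule Bochner_Integration.integrable_bound[where f="\<lambda>z. (L * norm h) * v z"])
    show "AE z in lborel. norm (?D (x - z) h * v z) \<le> norm ((L * norm h) * v z)"
      using L by (auto simp: abs_mult intro!: mult_right_mono)
  qed (use v in auto)
  have bl: "bounded_linear (\<lambda>h. convol (\<lambda>x. ?D x h) v x)"
  proof (subst linear_conv_bounded_linear[symmetric], rule linearI)
    show "convol (\<lambda>x. ?D x (a + b)) v x = convol (\<lambda>x. ?D x a) v x + convol (\<lambda>x. ?D x b) v x" for a b
      unfolding convol_def using i2[of x a] i2[of x b]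
      by (simp add: linear_add[OF lin] distrib_right)
    show "convol (\<lambda>x. ?D x (c *\<^sub>R b)) v x = c *\<^sub>R convol (\<lambda>x. ?D x b) v x" for c b
      unfolding convol_def by (simp add: linear_cmul[OF lin] mult.assoc)
  qed
  have "((\<lambda>y. (convol \<eta> v y - convol \<eta> v x - convol (\<lambda>x'. ?D x' (y - x)) v x) / norm (y - x)) \<longlongrightarrow> 0) (at x)"
    unfolding tendsto_at_iff_sequentially comp_def
  proof (intro allI impI)
    fix X assume X: "\<forall>i. X i \<in> UNIV - {x}" "X \<longlonglongrightarrow> x"
    let ?q = "\<lambda>i z. (\<eta> (X i - z) - \<eta> (x - z) - ?D (x - z) (X i - x)) / norm (X i - x) * v z"
    have eq: "(convol \<eta> v (X i) - convol \<eta> v x - convol (\<lambda>x'. ?D x' (X i - x)) v x) / norm (X i - x)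
        = integral\<^sup>L lborel (?q i)" for i
    proof -
      have "integral\<^sup>L lborel (?q i) = integral\<^sup>L lborel (\<lambda>z. (\<eta> (X i - z) * v z - \<eta> (x - z) * v z
         - ?D (x - z) (X i - x) * v z) / norm (X i - x))"
        by (simp only: left_diff_distrib times_divide_eq_left)
      also have "\<dots> = integral\<^sup>L lborel (\<lambda>z. \<eta> (X i - z) * v z - \<eta> (x - z) * v z
         - ?D (x - z) (X i - x) * v z) / norm (X i - x)" by simp
      also have "\<dots> = (convol \<eta> v (X i) - convol \<eta> v x - convol (\<lambda>x'. ?D x' (X i - x)) v x) / norm (X i - x)"
        unfolding convol_def using i1[of "X i"] i1[of x] i2[of x "X i - x"]
        by (simp only: Bochner_Integration.integral_diff Bochner_Integration.integrable_diff)
      finally show ?thesis by (rule sym)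
    qed
    have "(\<lambda>i. integral\<^sup>L lborel (?q i)) \<longlonglongrightarrow> integral\<^sup>L lborel (\<lambda>z::'a. 0::real)"
    proof (rule integral_dominated_convergence[where w="\<lambda>z. 2 * L * \<bar>v z\<bar>"])
      show "AE z in lborel. (\<lambda>i. ?q i z) \<longlonglongrightarrow> 0"
      proof (rule AE_I2)
        fix z
        have "(\<eta> has_derivative ?D (x - z)) (at (x - z))"
          using \<eta>(1)[of "Suc 0"] by (simp add: frechet_derivative_works)
        then have *: "((\<lambda>y. (\<eta> y - \<eta> (x - z) - ?D (x - z) (y - (x - z))) / norm (y - (x - z))) \<longlongrightarrow> 0) (at (x - z))"
          by (simp only: has_derivative_at_quotient)
        have "(\<lambda>i. X i - z) \<longlonglongrightarrow> x - z" using X by (auto intro: tendsto_intros)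
        moreover have "\<forall>i. X i - z \<in> UNIV - {x - z}" using X(1) by auto
        ultimately have "(\<lambda>i. (\<eta> (X i - z) - \<eta> (x - z) - ?D (x - z) ((X i - z) - (x - z))) / norm ((X i - z) - (x - z))) \<longlonglongrightarrow> 0"
          using *[unfolded tendsto_at_iff_sequentially comp_def, rule_format, of "\<lambda>i. X i - z"] by blast
        then have "(\<lambda>i. (\<eta> (X i - z) - \<eta> (x - z) - ?D (x - z) (X i - x)) / norm (X i - x)) \<longlonglongrightarrow> 0" by simp
        then show "(\<lambda>i. ?q i z) \<longlonglongrightarrow> 0" by (rule tendsto_mult_left_zero)
      qed
      show "AE z in lborel. norm (?q i z) \<le> 2 * L * \<bar>v z\<bar>" for i
      proof (rule AE_I2)
        fix z
        have n: "norm (X i - x) > 0" using X(1) by auto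
        have "\<bar>\<eta> (X i - z) - \<eta> (x - z) - ?D (x - z) (X i - x)\<bar> \<le> 2 * L * norm (X i - x)"
          using lip[of "X i - z" "x - z"] L(2)[of "x - z" "X i - x"] by simp
        then have "\<bar>\<eta> (X i - z) - \<eta> (x - z) - ?D (x - z) (X i - x)\<bar> / norm (X i - x) \<le> 2 * L"
          using n by (simp add: divide_le_eq)
        then show "norm (?q i z) \<le> 2 * L * \<bar>v z\<bar>"
          by (simp add: abs_mult mult_right_mono del: times_divide_eq_left)
      qed
      show "integrable lborel (\<lambda>z. 2 * L * \<bar>v z\<bar>)" using v by auto
    qed auto
    then show "(\<lambda>i. (convol \<eta> v (X i) - convol \<eta> v x - convol (\<lambda>x'. ?D x' (X i - x)) v x) / norm (X i - x)) \<longlonglongrightarrow> 0"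
      by (simp add: eq)
  qed
  then show ?thesis using bl
    by (simp only: has_derivative_at_quotient simp_thms)
qed

text \<open>
  A directional derivative of \<open>\<eta> * v\<close> is again a convolution of \<open>v\<close> with a smooth function supported
  in the same ball, so the claim is proved for all \<open>\<eta>\<close> simultaneously.
\<close>
lemma convol_Ck:
  fixes \<eta> v :: "'a::euclidean_space \<Rightarrow> real"
  assumes "\<And>m. Ck m \<eta>" "\<And>x. R < norm x \<Longrightarrow> \<eta> x = 0" and v: "integrable lborel v"
  shows "Ck m (convol \<eta> v)"
  using assms(1,2)
proof (induction m arbitrary: \<eta>)
  case 0
  have "(convol \<eta> v has_derivative (\<lambda>h. convol (\<lambda>x. frechet_derivative \<eta> (at x) h) v x)) (at x)" for x
    by (rule convol_has_derivative[OF 0(1) 0(2) v])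
  then have "continuous (at x) (convol \<eta> v)" for x using has_derivative_continuous by blast
  then show ?case by (simp add: continuous_at_imp_continuous_on)
next
  case (Suc m)
  have D: "(convol \<eta> v has_derivative (\<lambda>h. convol (\<lambda>x. frechet_derivative \<eta> (at x) h) v x)) (at x)" for x
    by (rule convol_has_derivative[OF Suc.prems v])
  then have F: "frechet_derivative (convol \<eta> v) (at x) = (\<lambda>h. convol (\<lambda>x. frechet_derivative \<eta> (at x) h) v x)" for x
    using frechet_derivative_at by metis
  have "Ck m (convol (\<lambda>x. frechet_derivative \<eta> (at x) h) v)" for h
  proof (rule Suc.IH)
    show "Ck k (\<lambda>x. frechet_derivative \<eta> (at x) h)" for k using Suc.prems(1)[of "Suc k"] by simp
  qed (rule frechet_derivative_zero_outside[OF Suc.prems(2)])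
  then show ?case using D by (auto simp: F differentiable_def)
qed

section \<open>Measures satisfying the averaging inequality\<close>
definition avg :: "'a::euclidean_space \<Rightarrow> real \<Rightarrow> ('a \<Rightarrow> real) \<Rightarrow> real" where
  "avg x r f = (\<integral>z. indicator (ball x r) z * f z \<partial>lborel) / measure lborel (ball (0::'a) r)"

lemma measure_lborel_ball: 
  fixes x :: "'a::euclidean_space"
  shows "0 < r \<Longrightarrow> measure lborel (ball x r) = measure lborel (ball (0::'a) r)"
  using content_ball_conv_unit_ball[of r x] content_ball_conv_unit_ball[of r "0::'a"] by simp

lemma ball_subset_mid:
  fixes x y :: "'a::euclidean_space"
  assumes "dist x y + r \<le> r'" shows "ball x r \<subseteq> ball y r'"
  using assms by (metis (no_types) dist_commute subset_ball dual_order.trans add.commute ball_subset_ball_iff less_eq_real_def linorder_not_less)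

text \<open>
  The last assumption is the \<open>A_p\<close> condition in the form in which it is used: averages over a ball with
  respect to Lebesgue measure are controlled by averages with respect to \<open>w dx\<close>. The density is a
  Borel function, nonnegative everywhere, so that products and iterated integrals are
  governed by Borel measurability and Tonelli's theorem.
\<close>
locale Ap_density =
  fixes w :: "'a::euclidean_space \<Rightarrow> real" and p K s :: real
  assumes w_measurable [measurable]: "w \<in> borel_measurable borel"
    and w_nonneg: "0 \<le> w x"
    and p: "1 < p" and s: "0 < s" "s < 1" and K: "0 < K"
    and ball_finite: "emeasure (density lborel (\<lambda>x. ennreal (w x))) (ball x r) < \<infinity>"
    and ball_pos: "0 < r \<Longrightarrow> 0 < emeasure (density lborel (\<lambda>x. ennreal (w x))) (ball x r)"
    and Ap: "f \<in> borel_measurable borel \<Longrightarrow> (\<And>x. 0 \<le> f x) \<Longrightarrow> (\<And>x. f x \<le> B) \<Longrightarrow> 0 < r \<Longrightarrow>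
      ennreal (measure (density lborel (\<lambda>x. ennreal (w x))) (ball x r) * avg x r f powr p)
      \<le> ennreal K * (\<integral>\<^sup>+ z. ennreal (indicator (ball x r) z * f z powr p) \<partial>density lborel (\<lambda>x. ennreal (w x)))"
begin

definition \<mu> :: "'a measure" where "\<mu> = density lborel (\<lambda>x. ennreal (w x))"

definition m :: "'a \<Rightarrow> real \<Rightarrow> real" where "m x r = measure \<mu> (ball x r)"

text \<open>
  The kernel that multiplies \<open>|v(x) - v(y)|^p\<close> in the energy, taken with respect to \<open>\<mu> \<Otimes> \<mu>\<close>. On
  the diagonal it has the value \<open>0\<close>, because \<open>0 powr a = 0\<close>.
\<close>
definition kern :: "'a \<Rightarrow> 'a \<Rightarrow> real" where
  "kern x y = norm (x - y) powr (- (s * p)) / measure \<mu> (mid_ball x y)"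

lemma sets_mu [measurable_cong, simp]: "sets \<mu> = sets borel"
  by (simp add: \<mu>_def)

lemma space_mu [simp]: "space \<mu> = UNIV"
  by (simp add: \<mu>_def)

lemma emeasure_ball: "emeasure \<mu> (ball x r) = ennreal (m x r)"
  using ball_finite[of x r] by (simp add: m_def \<mu>_def emeasure_eq_ennreal_measure less_top)

lemma m_nonneg: "0 \<le> m x r" by (simp add: m_def)

lemma m_pos: "0 < r \<Longrightarrow> 0 < m x r"
  using ball_pos[of r x] emeasure_ball[of x r] by (simp add: \<mu>_def)

lemma m_mono: "ball x r \<subseteq> ball y r' \<Longrightarrow> m x r \<le> m y r'"
proof -
  assume "ball x r \<subseteq> ball y r'"
  then have "emeasure \<mu> (ball x r) \<le> emeasure \<mu> (ball y r')" by (intro emeasure_mono) auto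
  then show ?thesis using m_nonneg by (simp add: emeasure_ball)
qed

lemma mid_ball_m: "measure \<mu> (mid_ball x y) = m ((1/2) *\<^sub>R (x + y)) (norm (x - y) / 2)"
  by (simp add: m_def mid_ball_def)

lemma AE_mu: "(AE x in lborel. P x) \<Longrightarrow> (AE x in \<mu>. P x)"
proof -
  assume "AE x in lborel. P x"
  then have "AE x in lborel. 0 < ennreal (w x) \<longrightarrow> P x" by eventually_elim simp
  then show ?thesis unfolding \<mu>_def by (subst AE_density) auto
qed

sublocale sigma_finite_measure \<mu>
  unfolding \<mu>_def
  using sigma_finite_measure.sigma_finite_iff_density_finite[OF lborel.sigma_finite_measure_axioms, of "\<lambda>x. ennreal (w x)"]
  by simp

sublocale pair: pair_sigma_finite \<mu> \<mu> ..

text \<open>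
  The relation \<open>z \<in> B_{x,y}\<close> is open in \<open>(x,y,z)\<close>, so the mass of its sections is measurable.
\<close>
lemma measure_mid_measurable: "(\<lambda>z. measure \<mu> (mid_ball (fst z) (snd z))) \<in> borel_measurable (borel \<Otimes>\<^sub>M borel)"
proof -
  let ?Q = "{q :: ('a \<times> 'a) \<times> 'a. dist ((1/2) *\<^sub>R (fst (fst q) + snd (fst q))) (snd q) < norm (fst (fst q) - snd (fst q)) / 2}"
  have "open ?Q" by (intro open_Collect_less continuous_intros) auto
  then have "?Q \<in> sets borel" by (rule borel_open)
  then have Q: "?Q \<in> sets ((borel \<Otimes>\<^sub>M borel) \<Otimes>\<^sub>M \<mu>)"
    by (simp only: sets_pair_measure_cong[OF refl sets_mu] borel_prod)
  have "mid_ball (fst z) (snd z) = Pair z -` ?Q" for z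
    by (auto simp: mid_ball_def)
  then show ?thesis using measurable_emeasure_Pair[OF Q] unfolding measure_def by simp
qed

lemma m_measurable: "(\<lambda>x. m x r) \<in> borel_measurable borel"
proof -
  let ?Q = "{q :: 'a \<times> 'a. dist (fst q) (snd q) < r}"
  have "open ?Q" by (intro open_Collect_less continuous_intros)
  then have "?Q \<in> sets borel" by (rule borel_open)
  then have Q: "?Q \<in> sets (borel \<Otimes>\<^sub>M \<mu>)"
    by (simp only: sets_pair_measure_cong[OF refl sets_mu] borel_prod)
  have "ball x r = Pair x -` ?Q" for x by auto
  then show ?thesis using measurable_emeasure_Pair[OF Q] unfolding m_def measure_def by simp
qed

lemma mid_measurable [measurable (raw)]:
  assumes "f \<in> N \<rightarrow>\<^sub>M borel" "g \<in> N \<rightarrow>\<^sub>M borel"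
  shows "(\<lambda>x. measure \<mu> (mid_ball (f x) (g x))) \<in> borel_measurable N"
  using measurable_compose[OF measurable_Pair[OF assms] measure_mid_measurable] by simp

lemma kern_measurable [measurable (raw)]:
  assumes [measurable]: "f \<in> N \<rightarrow>\<^sub>M borel" "g \<in> N \<rightarrow>\<^sub>M borel"
  shows "(\<lambda>x. kern (f x) (g x)) \<in> borel_measurable N"
  unfolding kern_def by measurable

lemma m_measurable' [measurable (raw)]:
  assumes "f \<in> N \<rightarrow>\<^sub>M borel"
  shows "(\<lambda>x. m (f x) r) \<in> borel_measurable N"
  using measurable_compose[OF assms m_measurable] .

lemma kern_nonneg: "0 \<le> kern x y" by (simp add: kern_def)

lemma kern_commute: "kern x y = kern y x"
  by (simp add: kern_def mid_ball_def norm_minus_commute add.commute)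

lemma Ap': "f \<in> borel_measurable borel \<Longrightarrow> (\<And>x. 0 \<le> f x) \<Longrightarrow> (\<And>x. f x \<le> B) \<Longrightarrow> 0 < r \<Longrightarrow>
      ennreal (m x r * avg x r f powr p)
      \<le> ennreal K * (\<integral>\<^sup>+ z. ennreal (indicator (ball x r) z * f z powr p) \<partial>\<mu>)"
  using Ap unfolding m_def \<mu>_def .

text \<open>
  The averaging inequality for an indicator function: a subset that fills the fraction \<open>\<theta>\<close> of a ball in volume
  carries at least a fraction of order \<open>\<theta>^p\<close> of its mass. It yields doubling (for a smaller ball), and later
  the mass of the complement of \<open>\<Omega>\<close>.
\<close>
lemma Ap_subset:
  assumes E: "E \<in> sets borel" "E \<subseteq> ball x r" and r: "0 < r" and \<theta>: "0 \<le> \<theta>"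
    "\<theta> * measure lborel (ball x r) \<le> measure lborel E"
  shows "\<theta> powr p * m x r \<le> K * measure \<mu> E"
proof -
  let ?V = "measure lborel (ball (0::'a) r)"
  have V: "?V > 0" using r by (simp add: content_ball_pos)
  have eq: "(\<lambda>z. indicator (ball x r) z * indicator E z :: real) = indicator E"
    using E(2) by (auto simp: indicator_def fun_eq_iff)
  have "avg x r (indicator E) = measure lborel E / ?V"
    using E by (simp add: avg_def eq)
  then have "\<theta> \<le> avg x r (indicator E)"
    using \<theta> V measure_lborel_ball[OF r, of x] by (simp add: le_divide_eq)
  then have le: "\<theta> powr p * m x r \<le> avg x r (indicator E) powr p * m x r"
    using \<theta> p m_nonneg by (intro mult_right_mono powr_mono2) simp_all
  have fE: "emeasure \<mu> E \<noteq> top"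
    using emeasure_mono[OF E(2), of \<mu>] emeasure_ball[of x r] by (auto simp: top_unique)
  have "ennreal (m x r * avg x r (indicator E) powr p)
    \<le> ennreal K * (\<integral>\<^sup>+ z. ennreal (indicator (ball x r) z * indicator E z powr p) \<partial>\<mu>)"
    by (rule Ap'[where B=1]) (use E r in simp_all)
  also have "(\<integral>\<^sup>+ z. ennreal (indicator (ball x r) z * indicator E z powr p) \<partial>\<mu>) = (\<integral>\<^sup>+ z. indicator E z \<partial>\<mu>)"
  proof (rule nn_integral_cong)
    fix z
    show "ennreal (indicator (ball x r) z * indicator E z powr p) = indicator E z"
      using E(2) by (cases "z \<in> E") auto
  qed
  also have "\<dots> = ennreal (measure \<mu> E)"
    using E fE by (simp add: emeasure_eq_ennreal_measure)
  finally have "m x r * avg x r (indicator E) powr p \<le> K * measure \<mu> E"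
    using K by (simp add: ennreal_mult'[symmetric])
  then have "avg x r (indicator E) powr p * m x r \<le> K * measure \<mu> E"
    by (simp only: mult.commute)
  with le show ?thesis by linarith
qed

text \<open>The doubling constant of \<open>\<mu>\<close>.\<close>
definition D :: real where "D = K * (2 ^ DIM('a)) powr p"

lemma D_pos: "0 < D" using K by (simp add: D_def)

lemma doubling: "m x (2 * r) \<le> D * m x r" if r: "0 < r"
proof -
  have "(1 / 2 ^ DIM('a)) powr p * m x (2 * r) \<le> K * measure \<mu> (ball x r)"
  proof (rule Ap_subset)
    show "1 / 2 ^ DIM('a) * measure lborel (ball x (2 * r)) \<le> measure lborel (ball x r)"
      using r content_ball_conv_unit_ball[of "2 * r" x] content_ball_conv_unit_ball[of r x]
      by (simp add: power_mult_distrib)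
  qed (use r in auto)
  then show ?thesis by (simp add: m_def D_def powr_divide field_simps)
qed

lemma doubling_power: "0 < r \<Longrightarrow> m x (2 ^ k * r) \<le> D ^ k * m x r"
proof (induction k)
  case (Suc k)
  have "m x (2 ^ Suc k * r) \<le> D * m x (2 ^ k * r)"
    using doubling[of "2 ^ k * r" x] Suc.prems by (simp add: mult.assoc)
  also have "\<dots> \<le> D * (D ^ k * m x r)" using Suc D_pos by (intro mult_left_mono) auto
  finally show ?case by (simp add: mult.assoc)
qed simp

lemma m_compare: "dist x y + r \<le> 2 ^ k * r' \<Longrightarrow> 0 < r' \<Longrightarrow> m x r \<le> D ^ k * m y r'"
  using m_mono[OF ball_subset_mid, of x y r "2 ^ k * r'"] doubling_power[of r' y k] by linarith

text \<open>
  The form in which doubling is applied: a ball contained in a \<open>2^k\<close>-fold enlargement of another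
  one has at most \<open>D^k\<close> times its mass.
\<close>
lemma inverse_m_compare: 
  assumes "dist x y + r \<le> 2 ^ k * r'" "0 < r'" "0 < r"
  shows "1 / m y r' \<le> D ^ k / m x r"
proof -
  have Dk: "D ^ k > 0" using D_pos by simp
  have "D ^ k / (D ^ k * m y r') \<le> D ^ k / m x r"
    using m_compare[OF assms(1,2)] m_pos[OF assms(2), of y] m_pos[OF assms(3), of x] Dk
    by (intro divide_left_mono mult_pos_pos) auto
  moreover have "D ^ k / (D ^ k * m y r') = 1 / m y r'" using Dk D_pos by simp
  ultimately show ?thesis by simp
qed

lemma dist_mid: "dist x ((1/2) *\<^sub>R (x + y)) = norm (x - y) / 2" for x y :: 'a
proof -
  have "x - (1/2) *\<^sub>R (x + y) = (1/2) *\<^sub>R (x - y)"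
    by (simp add: algebra_simps flip: scaleR_left_distrib)
  then show ?thesis by (simp add: dist_norm)
qed

lemma emeasure_ball_over_m: "0 < r \<Longrightarrow> (\<integral>\<^sup>+ y. ennreal (c * indicator (ball x r) y / m x r) \<partial>\<mu>) = ennreal c"
  if "0 \<le> c"
proof -
  assume r: "0 < r"
  have "(\<integral>\<^sup>+ y. ennreal (c * indicator (ball x r) y / m x r) \<partial>\<mu>) =
      (\<integral>\<^sup>+ y. ennreal (c / m x r) * indicator (ball x r) y \<partial>\<mu>)"
    by (intro nn_integral_cong) (auto simp: indicator_def)
  also have "\<dots> = ennreal (c / m x r) * ennreal (m x r)"
    by (simp add: nn_integral_cmult_indicator emeasure_ball)
  also have "\<dots> = ennreal c" using that r m_pos[OF r, of x]
    by (simp flip: ennreal_mult')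
  finally show ?thesis .
qed

text \<open>
  The adjoint of averaging over balls of radius \<open>r\<close> is bounded on constants, since \<open>m x r\<close> is
  comparable to \<open>m x' r\<close> for \<open>x\<close> in the ball around \<open>x'\<close>.
\<close>
lemma averaging_bounded:
  assumes r: "0 < r"
  shows "(\<integral>\<^sup>+ x. ennreal (indicator (ball x' r) x / m x r) \<partial>\<mu>) \<le> ennreal D"
proof -
  have "(\<integral>\<^sup>+ x. ennreal (indicator (ball x' r) x / m x r) \<partial>\<mu>)
      \<le> (\<integral>\<^sup>+ x. ennreal (D * indicator (ball x' r) x / m x' r) \<partial>\<mu>)"
  proof (intro nn_integral_mono ennreal_leI)
    fix x
    show "indicator (ball x' r) x / m x r \<le> D * indicator (ball x' r) x / m x' r"
      using inverse_m_compare[of x' x r 1 r] r by (auto simp: indicator_def)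
  qed
  also have "\<dots> = ennreal D" using emeasure_ball_over_m[OF less_imp_le[OF D_pos] r] .
  finally show ?thesis .
qed

text \<open>
  The factor \<open>1 / \<mu>(B_{x,y})\<close> of the kernel on a dyadic annulus around \<open>x\<close>. There \<open>B_{x,y}\<close> and the
  ball of radius \<open>\<rho>\<close> around \<open>x\<close> have comparable mass, which makes its integral bounded
  independently of \<open>x\<close> and \<open>\<rho>\<close>.
\<close>
definition ann :: "'a \<Rightarrow> real \<Rightarrow> 'a \<Rightarrow> real" where
  "ann x \<rho> = (\<lambda>y. if \<rho> / 2 \<le> norm (x - y) \<and> norm (x - y) < \<rho> then 1 / measure \<mu> (mid_ball x y) else 0)"

lemma ann_measurable [measurable]: "ann x \<rho> \<in> borel_measurable borel"
  unfolding ann_def by measurable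

lemma ann_integral:
  assumes \<rho>: "0 < \<rho>"
  shows "(\<integral>\<^sup>+ y. ennreal (ann x \<rho> y) \<partial>\<mu>) \<le> ennreal (D ^ 3)"
proof -
  have "(\<integral>\<^sup>+ y. ennreal (ann x \<rho> y) \<partial>\<mu>) \<le> (\<integral>\<^sup>+ y. ennreal (D ^ 3 * indicator (ball x \<rho>) y / m x \<rho>) \<partial>\<mu>)"
  proof (intro nn_integral_mono ennreal_leI)
    fix y
    show "ann x \<rho> y \<le> D ^ 3 * indicator (ball x \<rho>) y / m x \<rho>"
    proof (cases "\<rho> / 2 \<le> norm (x - y) \<and> norm (x - y) < \<rho>")
      case True
      then have "1 / m ((1/2) *\<^sub>R (x + y)) (norm (x - y) / 2) \<le> D ^ 3 / m x \<rho>"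
        by (intro inverse_m_compare) (use \<rho> in \<open>auto simp: dist_mid\<close>)
      then show ?thesis using True by (simp add: ann_def mid_ball_m dist_norm)
    next
      case False
      have "0 \<le> D ^ 3 * indicator (ball x \<rho>) y / m x \<rho>" using D_pos m_nonneg by simp
      then show ?thesis using False by (auto simp: ann_def)
    qed
  qed
  also have "\<dots> = ennreal (D ^ 3)" using emeasure_ball_over_m[of "D ^ 3", OF _ \<rho>] D_pos by simp
  finally show ?thesis .
qed

text \<open>
  The annuli inside the ball of radius \<open>t\<close> contribute a geometric series with ratio \<open>2^(-(1-s)p)\<close>,
  because there \<open>min 1 (|x-y|/t)^p\<close> compensates the singularity; those outside contribute one with
  ratio \<open>2^(-sp)\<close>. \<open>CK\<close> is the sum of both.
\<close>
definition q1 :: real where "q1 = 2 powr (- ((1 - s) * p))"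
definition q2 :: real where "q2 = 2 powr (- (s * p))"
definition CK :: real where "CK = (2 powr (s * p) / (1 - q1) + 1 / (1 - q2)) * D ^ 3"

lemma q_bounds: "0 < q1" "q1 < 1" "0 < q2" "q2 < 1"
proof -
  have "2 powr (- ((1 - s) * p)) < 2 powr 0" by (rule powr_less_mono) (use p s in auto)
  then show "q1 < 1" by (simp add: q1_def)
  have "2 powr (- (s * p)) < 2 powr 0" by (rule powr_less_mono) (use p s in auto)
  then show "q2 < 1" by (simp add: q2_def)
qed (auto simp: q1_def q2_def)

lemma CK_pos: "0 < CK"
  using q_bounds D_pos by (auto simp: CK_def intro!: mult_pos_pos add_pos_pos)

lemma q1_power: "q1 ^ j = 2 powr (- (real j * ((1 - s) * p)))"
  by (simp add: q1_def powr_power)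
lemma q2_power: "q2 ^ j = 2 powr (- (real j * (s * p)))"
  by (simp add: q2_def powr_power)

text \<open>
  Only the annulus that contains \<open>y\<close> matters; its index is the integer part of
  \<open>log 2 (|x - y| / t)\<close>, negative inside the ball of radius \<open>t\<close>.
\<close>
lemma min_kern_pointwise:
  assumes t: "0 < t" and ne: "x \<noteq> y"
  shows "\<exists>j::nat. min 1 (norm (x - y) / t) powr p * kern x y
      \<le> t powr (- (s * p)) * 2 powr (s * p) * q1 ^ j * ann x (t * 2 powr (- real j)) y \<or>
    min 1 (norm (x - y) / t) powr p * kern x y
      \<le> t powr (- (s * p)) * q2 ^ j * ann x (t * 2 powr (real j + 1)) y"
proof -
  define z where "z = norm (x - y) / t"
  have z: "z > 0" using t ne by (simp add: z_def)
  have n: "norm (x - y) = t * z" using t by (simp add: z_def)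
  (* the dyadic annulus around x, in units of t, that contains y *)
  define k where "k = \<lfloor>log 2 z\<rfloor>"
  have k: "2 powr k \<le> z" "z < 2 powr (real_of_int k + 1)"
    using z floor_log_eq_powr_iff[of z 2 k] by (auto simp: k_def)
  let ?M = "measure \<mu> (mid_ball x y)"
  have npow: "norm (x - y) powr (- (s * p)) \<le> t powr (- (s * p)) * 2 powr (- (k * (s * p)))"
  proof -
    have "norm (x - y) powr (- (s * p)) \<le> (t * 2 powr k) powr (- (s * p))"
      using t k(1) p s unfolding n by (intro powr_mono2') auto
    also have "\<dots> = t powr (- (s * p)) * 2 powr (- (k * (s * p)))"
      using t by (simp add: powr_mult powr_powr)
    finally show ?thesis .
  qed
  show ?thesis
  proof (cases "k \<ge> 0")
    case True
    define j where "j = nat k"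
    have kj: "real_of_int k = real j" using True by (simp add: j_def)
    have "min 1 (norm (x - y) / t) powr p \<le> 1 powr p" using z p
      unfolding z_def[symmetric] by (intro powr_mono2) simp_all
    then have "min 1 (norm (x - y) / t) powr p * norm (x - y) powr (- (s * p)) \<le>
        1 * (t powr (- (s * p)) * 2 powr (- (k * (s * p))))"
      using npow by (intro mult_mono) auto
    also have "\<dots> = t powr (- (s * p)) * q2 ^ j" by (simp add: q2_power kj)
    finally have "min 1 (norm (x - y) / t) powr p * norm (x - y) powr (- (s * p)) / ?M \<le>
        t powr (- (s * p)) * q2 ^ j / ?M"
      by (rule divide_right_mono) simp
    moreover have "ann x (t * 2 powr (real j + 1)) y = 1 / ?M"
      using k[unfolded kj] t unfolding ann_def n by (simp add: powr_add)
    ultimately show ?thesis by (intro exI[of _ j] disjI2) (simp add: kern_def)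
  next
    case False
    (* here 2^k \<le> |x - y| / t < 2^(k+1) \<le> 1, and j is chosen so that 2^(k+1) = 2^(-j) *)
    define j where "j = nat (- k - 1)"
    have kj: "real_of_int k = - real j - 1" using False by (simp add: j_def)
    have "min 1 z \<le> 2 powr (- real j)" using k(2)[unfolded kj] by simp
    then have "min 1 (norm (x - y) / t) powr p \<le> (2 powr (- real j)) powr p" using z p
      unfolding z_def[symmetric] by (intro powr_mono2) simp_all
    then have "min 1 (norm (x - y) / t) powr p * norm (x - y) powr (- (s * p)) \<le>
        (2 powr (- real j)) powr p * (t powr (- (s * p)) * 2 powr (- (k * (s * p))))"
      using npow by (intro mult_mono) auto
    also have "\<dots> = t powr (- (s * p)) * ((2 powr (- real j)) powr p * 2 powr (- (k * (s * p))))"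
      by (rule mult.left_commute)
    also have "(2 powr (- real j)) powr p * 2 powr (- (k * (s * p))) = 2 powr (s * p) * q1 ^ j"
      unfolding kj q1_power powr_powr powr_add[symmetric] by (simp add: algebra_simps)
    finally have "min 1 (norm (x - y) / t) powr p * norm (x - y) powr (- (s * p)) / ?M \<le>
        t powr (- (s * p)) * (2 powr (s * p) * q1 ^ j) / ?M"
      by (rule divide_right_mono) simp
    moreover have "ann x (t * 2 powr (- real j)) y = 1 / ?M"
    proof -
      have "2 powr (- real j) / 2 \<le> z" "z < 2 powr (- real j)"
        using k unfolding kj by (simp_all add: powr_diff)
      then show ?thesis using t unfolding ann_def n by simp
    qed
    ultimately show ?thesis by (intro exI[of _ j] disjI1) (simp add: kern_def mult.assoc)
  qed
qed

lemma suminf_geometric_ennreal: "0 \<le> c \<Longrightarrow> 0 \<le> q \<Longrightarrow> q < 1 \<Longrightarrow> (\<Sum>j. ennreal (c * q ^ j)) = ennreal (c / (1 - q))"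
  using sums_mult[OF geometric_sums[of q], of c] by (intro suminf_ennreal_eq) simp_all

text \<open>
  The central kernel estimate. Cutting the singularity off at scale \<open>t\<close> leaves a kernel
  whose total mass is the one that scaling predicts.
\<close>
lemma min_kern_integral:
  assumes t: "0 < t"
  shows "(\<integral>\<^sup>+ y. ennreal (min 1 (norm (x - y) / t) powr p * kern x y) \<partial>\<mu>) \<le> ennreal (CK * t powr (- (s * p)))"
proof -
  define a b :: "nat \<Rightarrow> real" where "a j = t powr (- (s * p)) * 2 powr (s * p) * q1 ^ j"
    and "b j = t powr (- (s * p)) * q2 ^ j" for j
  define g where "g j y = ennreal (a j * ann x (t * 2 powr (- real j)) y) + ennreal (b j * ann x (t * 2 powr (real j + 1)) y)" for j y
  have ab: "0 \<le> a j" "0 \<le> b j" for j using q_bounds by (auto simp: a_def b_def)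
  have [measurable]: "g j \<in> borel_measurable borel" for j unfolding g_def by measurable
  have le: "ennreal (min 1 (norm (x - y) / t) powr p * kern x y) \<le> (\<Sum>j. g j y)" for y
  proof (cases "x = y")
    case False
    from min_kern_pointwise[OF t this] obtain j where
      "min 1 (norm (x - y) / t) powr p * kern x y \<le> a j * ann x (t * 2 powr (- real j)) y \<or>
       min 1 (norm (x - y) / t) powr p * kern x y \<le> b j * ann x (t * 2 powr (real j + 1)) y"
      unfolding a_def b_def by blast
    then have "ennreal (min 1 (norm (x - y) / t) powr p * kern x y) \<le> g j y"
      unfolding g_def by (metis add.commute add_increasing2 ennreal_leI zero_le)
    also have "\<dots> \<le> (\<Sum>j. g j y)" using sum_le_suminf[of "\<lambda>j. g j y" "{j}"] by simp
    finally show ?thesis .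
  qed (simp add: kern_def)
  have gi: "(\<integral>\<^sup>+ y. g j y \<partial>\<mu>) \<le> ennreal (a j * D ^ 3) + ennreal (b j * D ^ 3)" for j
  proof -
    have "(\<integral>\<^sup>+ y. g j y \<partial>\<mu>) = ennreal (a j) * (\<integral>\<^sup>+ y. ennreal (ann x (t * 2 powr (- real j)) y) \<partial>\<mu>)
        + ennreal (b j) * (\<integral>\<^sup>+ y. ennreal (ann x (t * 2 powr (real j + 1)) y) \<partial>\<mu>)"
      unfolding g_def by (simp add: nn_integral_add nn_integral_cmult ennreal_mult' ab)
    also have "\<dots> \<le> ennreal (a j) * ennreal (D ^ 3) + ennreal (b j) * ennreal (D ^ 3)"
      using t by (intro add_mono mult_left_mono ann_integral) auto
    finally show ?thesis by (simp add: ennreal_mult' ab)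
  qed
  have "(\<integral>\<^sup>+ y. ennreal (min 1 (norm (x - y) / t) powr p * kern x y) \<partial>\<mu>) \<le> (\<integral>\<^sup>+ y. (\<Sum>j. g j y) \<partial>\<mu>)"
    by (rule nn_integral_mono) (rule le)
  also have "\<dots> = (\<Sum>j. \<integral>\<^sup>+ y. g j y \<partial>\<mu>)" by (rule nn_integral_suminf) simp
  also have "\<dots> \<le> (\<Sum>j. ennreal (a j * D ^ 3) + ennreal (b j * D ^ 3))"
    by (rule suminf_le) (auto intro: gi)
  also have "\<dots> = (\<Sum>j. ennreal (a j * D ^ 3)) + (\<Sum>j. ennreal (b j * D ^ 3))"
    by (rule suminf_add[symmetric]) auto
  also have "(\<Sum>j. ennreal (a j * D ^ 3)) = ennreal (t powr (- (s * p)) * 2 powr (s * p) * D ^ 3 / (1 - q1))"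
  proof -
    have "a j * D ^ 3 = (t powr (- (s * p)) * 2 powr (s * p) * D ^ 3) * q1 ^ j" for j
      unfolding a_def by (simp only: mult_ac)
    then show ?thesis
      by (simp only:) (rule suminf_geometric_ennreal, use q_bounds D_pos in simp_all)
  qed
  also have "(\<Sum>j. ennreal (b j * D ^ 3)) = ennreal (t powr (- (s * p)) * D ^ 3 / (1 - q2))"
  proof -
    have "b j * D ^ 3 = (t powr (- (s * p)) * D ^ 3) * q2 ^ j" for j
      unfolding b_def by (simp only: mult_ac)
    then show ?thesis
      by (simp only:) (rule suminf_geometric_ennreal, use q_bounds D_pos in simp_all)
  qed
  also have "ennreal (t powr (- (s * p)) * 2 powr (s * p) * D ^ 3 / (1 - q1)) + ennreal (t powr (- (s * p)) * D ^ 3 / (1 - q2))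
     = ennreal (t powr (- (s * p)) * 2 powr (s * p) * D ^ 3 / (1 - q1) + t powr (- (s * p)) * D ^ 3 / (1 - q2))"
    using q_bounds D_pos by (intro ennreal_plus[symmetric]) auto
  also have "t powr (- (s * p)) * 2 powr (s * p) * D ^ 3 / (1 - q1) + t powr (- (s * p)) * D ^ 3 / (1 - q2) = CK * t powr (- (s * p))"
    unfolding CK_def by (simp add: distrib_right distrib_left mult_ac)
  finally show ?thesis .
qed

lemma min_kern_integral_left:
  assumes "0 < t"
  shows "(\<integral>\<^sup>+ x. ennreal (min 1 (norm (x - y) / t) powr p * kern x y) \<partial>\<mu>) \<le> ennreal (CK * t powr (- (s * p)))"
  using min_kern_integral[OF assms, of y] by (simp only: kern_commute norm_minus_commute)

end

section \<open>Convolutions and averages\<close>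
lemma powr_add_le: "0 \<le> a \<Longrightarrow> 0 \<le> b \<Longrightarrow> 0 \<le> p \<Longrightarrow> (a + b) powr p \<le> 2 powr p * (a powr p + b powr p)" for a b p :: real
proof -
  assume ab: "0 \<le> a" "0 \<le> b" "0 \<le> p"
  have "(a + b) powr p \<le> (2 * max a b) powr p" using ab by (intro powr_mono2) auto
  also have "\<dots> = 2 powr p * max a b powr p" using ab by (simp add: powr_mult)
  also have "\<dots> \<le> 2 powr p * (a powr p + b powr p)"
    by (intro mult_left_mono) (auto simp: max_def)
  finally show ?thesis .
qed

lemma lborel_integral_reflect:
  fixes f :: "'a::euclidean_space \<Rightarrow> real"
  assumes [measurable]: "f \<in> borel_measurable borel"
  shows "(\<integral>z. f (x - z) \<partial>lborel) = integral\<^sup>L lborel f"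
proof -
  have "lborel = density (distr lborel borel (\<lambda>z. x + (-1) *\<^sub>R z)) (\<lambda>_. ennreal (\<bar>-1\<bar> ^ DIM('a)))"
    by (rule lborel_affine) simp
  then have "(lborel :: 'a measure) = distr lborel borel (\<lambda>z. x - z)"
    by (simp add: density_1)
  then have "integral\<^sup>L lborel f = integral\<^sup>L (distr lborel borel (\<lambda>z. x - z)) f" by simp
  also have "\<dots> = (\<integral>z. f (x - z) \<partial>lborel)" by (rule integral_distr) auto
  finally show ?thesis by simp
qed

lemma indicator_ball_measurable [measurable (raw)]:
  fixes a :: "'a::euclidean_space"
  assumes [measurable]: "f \<in> N \<rightarrow>\<^sub>M borel"
  shows "(\<lambda>x. indicator (ball a r) (f x) :: real) \<in> borel_measurable N"
  unfolding indicator_def mem_ball by measurable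

lemma avg_integrable:
  fixes f :: "'a::euclidean_space \<Rightarrow> real"
  assumes "f \<in> borel_measurable borel" "\<And>z. \<bar>f z\<bar> \<le> B"
  shows "integrable lborel (\<lambda>z. indicator (ball x r) z * f z)"
proof (rule bounded_support_integrable[where B=B and S="ball x r"])
  show "\<bar>indicator (ball x r) z * f z\<bar> \<le> B" for z
    using assms(2)[of z] by (cases "z \<in> ball x r") auto
  note [measurable] = assms(1)
  show "(\<lambda>z. indicator (ball x r) z * f z) \<in> borel_measurable borel" by measurable
qed auto

lemma avg_nonneg: "(\<And>z. 0 \<le> f z) \<Longrightarrow> 0 \<le> avg x r f"
  by (simp add: avg_def)

lemma avg_mono:
  fixes f g :: "'a::euclidean_space \<Rightarrow> real"
  assumes "f \<in> borel_measurable borel" "\<And>z. \<bar>f z\<bar> \<le> B" "g \<in> borel_measurable borel" "\<And>z. \<bar>g z\<bar> \<le> B'"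
    "\<And>z. z \<in> ball x r \<Longrightarrow> f z \<le> g z"
  shows "avg x r f \<le> avg x r g"
  unfolding avg_def
proof (intro divide_right_mono integral_mono avg_integrable)
  show "indicator (ball x r) z * f z \<le> indicator (ball x r) z * g z" for z
    using assms(5) by (cases "z \<in> ball x r") auto
qed (use assms in auto)

lemma avg_const: "0 < r \<Longrightarrow> avg x r (\<lambda>z. c) = c"
proof -
  assume r: "0 < r"
  have "0 < measure lborel (ball (0::'a) r)" using r by (rule content_ball_pos)
  then show ?thesis using measure_lborel_ball[OF r, of x] by (simp add: avg_def)
qed

lemma avg_cmult: "avg x r (\<lambda>z. c * f z) = c * avg x r f"
proof -
  have "(\<integral>z. indicator (ball x r) z * (c * f z) \<partial>lborel) = (\<integral>z. c * (indicator (ball x r) z * f z) \<partial>lborel)"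
    by (simp only: mult.left_commute)
  then show ?thesis by (simp add: avg_def)
qed

lemma avg_add:
  fixes f g :: "'a::euclidean_space \<Rightarrow> real"
  assumes "f \<in> borel_measurable borel" "\<And>z. \<bar>f z\<bar> \<le> B" "g \<in> borel_measurable borel" "\<And>z. \<bar>g z\<bar> \<le> B'"
  shows "avg x r (\<lambda>z. f z + g z) = avg x r f + avg x r g"
proof -
  have "(\<integral>z. indicator (ball x r) z * f z + indicator (ball x r) z * g z \<partial>lborel)
    = (\<integral>z. indicator (ball x r) z * f z \<partial>lborel) + (\<integral>z. indicator (ball x r) z * g z \<partial>lborel)"
    by (rule Bochner_Integration.integral_add[OF avg_integrable[OF assms(1,2)] avg_integrable[OF assms(3,4)]])
  then show ?thesis by (simp only: avg_def distrib_left add_divide_distrib)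
qed

lemma avg_le:
  fixes f :: "'a::euclidean_space \<Rightarrow> real"
  assumes "f \<in> borel_measurable borel" "\<And>z. \<bar>f z\<bar> \<le> B" "0 < r"
    "\<And>z. z \<in> ball x r \<Longrightarrow> f z \<le> c"
  shows "avg x r f \<le> c"
proof -
  have "avg x r f \<le> avg x r (\<lambda>z. c)"
    by (rule avg_mono[where B=B and B'="\<bar>c\<bar>"]) (use assms in auto)
  then show ?thesis using avg_const[OF assms(3), of x c] by simp
qed

lemma avg_measurable:
  assumes [measurable]: "(\<lambda>q. f (fst q) (snd q)) \<in> borel_measurable (N \<Otimes>\<^sub>M borel)"
  shows "(\<lambda>a. avg x r (f a)) \<in> borel_measurable N"
proof -
  have [measurable]: "(\<lambda>q. f (fst q) (snd q)) \<in> borel_measurable (N \<Otimes>\<^sub>M lborel)"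
    using assms by (simp cong: measurable_cong_sets sets_pair_measure_cong)
  show ?thesis unfolding avg_def indicator_def mem_ball by measurable
qed

lemma mollifier_measurable: "mollifier C r \<eta> \<Longrightarrow> \<eta> \<in> borel_measurable borel"
proof -
  assume "mollifier C r \<eta>"
  then have "Ck 0 \<eta>" unfolding mollifier_def by blast
  then have "continuous_on UNIV \<eta>" by simp
  then show ?thesis by (rule borel_measurable_continuous_onI)
qed

lemma mollifier_times_integrable:
  fixes \<eta> u :: "'a::euclidean_space \<Rightarrow> real"
  assumes \<eta>: "mollifier C r \<eta>" and u: "u \<in> borel_measurable borel" "\<And>z. \<bar>u z\<bar> \<le> B"
  shows "integrable lborel (\<lambda>z. \<eta> (x - z) * u z)"
proof (rule bounded_support_integrable[where S="cball x (r / 2)"])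
  note [measurable] = mollifier_measurable[OF \<eta>] u(1)
  show "(\<lambda>z. \<eta> (x - z) * u z) \<in> borel_measurable borel" by measurable
  fix z
  show "\<bar>\<eta> (x - z) * u z\<bar> \<le> (C / measure lborel (ball (0::'a) r)) * B"
    using \<eta> u(2)[of z] unfolding abs_mult mollifier_def by (intro mult_mono) auto
  show "\<eta> (x - z) * u z = 0" if "z \<notin> cball x (r / 2)"
    using \<eta> that unfolding mollifier_def by (auto simp: dist_norm)
qed auto

lemma mollifier_integral:
  assumes "mollifier C r \<eta>" shows "(\<integral>z. \<eta> (x - z) \<partial>lborel) = 1"
proof -
  have "integral\<^sup>L lborel \<eta> = 1" using assms unfolding mollifier_def by blast
  then show ?thesis using lborel_integral_reflect[OF mollifier_measurable[OF assms], of x] by simp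
qed

lemma convol_minus_const:
  fixes \<eta> u :: "'a::euclidean_space \<Rightarrow> real"
  assumes \<eta>: "mollifier C r \<eta>" and u: "u \<in> borel_measurable borel" "\<And>z. \<bar>u z\<bar> \<le> B"
  shows "convol \<eta> u x - c = (\<integral>z. \<eta> (x - z) * (u z - c) \<partial>lborel)"
proof -
  have "(\<integral>z. \<eta> (x - z) * (u z - c) \<partial>lborel) = (\<integral>z. \<eta> (x - z) * u z - \<eta> (x - z) * c \<partial>lborel)"
    by (simp only: right_diff_distrib)
  also have "\<dots> = (\<integral>z. \<eta> (x - z) * u z \<partial>lborel) - (\<integral>z. \<eta> (x - z) * c \<partial>lborel)"
    by (intro Bochner_Integration.integral_diff mollifier_times_integrable[OF \<eta> u]
        mollifier_times_integrable[OF \<eta>, of "\<lambda>_. c" "\<bar>c\<bar>"]) auto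
  also have "(\<integral>z. \<eta> (x - z) * c \<partial>lborel) = c" using mollifier_integral[OF \<eta>] by simp
  finally show ?thesis by (simp add: convol_def)
qed

text \<open>
  A mollifier has integral one, so subtracting a constant commutes with convolution; its size bound
  then turns the convolution into an average over the ball of radius \<open>r\<close>.
\<close>
lemma convol_minus_const_le:
  fixes \<eta> u :: "'a::euclidean_space \<Rightarrow> real"
  assumes \<eta>: "mollifier C r \<eta>" and r: "0 < r" and u: "u \<in> borel_measurable borel" "\<And>z. \<bar>u z\<bar> \<le> B"
  shows "\<bar>convol \<eta> u x - c\<bar> \<le> C * avg x r (\<lambda>z. \<bar>u z - c\<bar>)"
proof -
  let ?V = "measure lborel (ball (0::'a) r)"
  note [measurable] = mollifier_measurable[OF \<eta>] u(1)
  have bd: "\<bar>u z - c\<bar> \<le> B + \<bar>c\<bar>" for z using u(2)[of z] by linarith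
  have "\<bar>convol \<eta> u x - c\<bar> \<le> (\<integral>z. \<bar>\<eta> (x - z) * (u z - c)\<bar> \<partial>lborel)"
    unfolding convol_minus_const[OF \<eta> u] by (rule integral_abs_bound)
  also have "\<dots> \<le> (\<integral>z. (C / ?V) * (indicator (ball x r) z * \<bar>u z - c\<bar>) \<partial>lborel)"
  proof (rule integral_mono)
    show "integrable lborel (\<lambda>z. \<bar>\<eta> (x - z) * (u z - c)\<bar>)"
      by (intro integrable_abs mollifier_times_integrable[OF \<eta> _ bd]) measurable
    show "integrable lborel (\<lambda>z. (C / ?V) * (indicator (ball x r) z * \<bar>u z - c\<bar>))"
      by (intro integrable_mult_right avg_integrable[where B="B + \<bar>c\<bar>"]) (use bd in auto)
    fix z
    show "\<bar>\<eta> (x - z) * (u z - c)\<bar> \<le> (C / ?V) * (indicator (ball x r) z * \<bar>u z - c\<bar>)"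
    proof (cases "z \<in> ball x r")
      case True
      have "\<bar>\<eta> (x - z)\<bar> \<le> C / ?V" using \<eta> unfolding mollifier_def by simp
      from mult_right_mono[OF this, of "\<bar>u z - c\<bar>"] True show ?thesis by (simp add: abs_mult)
    next
      case False
      then have "r / 2 \<le> norm (x - z)" using r by (simp add: dist_norm)
      then show ?thesis using \<eta> False unfolding mollifier_def by simp
    qed
  qed
  also have "\<dots> = C * avg x r (\<lambda>z. \<bar>u z - c\<bar>)" by (simp add: avg_def)
  finally show ?thesis .
qed

text \<open>
  For nearby points the difference of the two mollifiers has integral zero, so a
  constant may again be subtracted from \<open>u\<close>; the Lipschitz bound supplies the factor \<open>|x - y| / r\<close>.
\<close>
lemma convol_diff_le_near:
  fixes \<eta> u :: "'a::euclidean_space \<Rightarrow> real"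
  assumes \<eta>: "mollifier C r \<eta>" and r: "0 < r" and u: "u \<in> borel_measurable borel" "\<And>z. \<bar>u z\<bar> \<le> B"
    and near: "norm (x - y) < r / 2"
  shows "\<bar>convol \<eta> u x - convol \<eta> u y\<bar> \<le> C * (norm (x - y) / r) * avg x r (\<lambda>z. \<bar>u z - c\<bar>)"
proof -
  let ?V = "measure lborel (ball (0::'a) r)"
  note [measurable] = mollifier_measurable[OF \<eta>] u(1)
  have bd: "\<bar>u z - c\<bar> \<le> B + \<bar>c\<bar>" for z using u(2)[of z] by linarith
  have int: "integrable lborel (\<lambda>z. \<eta> (x - z) * (u z - c))" for x
    by (intro mollifier_times_integrable[OF \<eta> _ bd]) measurable
  have "convol \<eta> u x - convol \<eta> u y = (convol \<eta> u x - c) - (convol \<eta> u y - c)" by simp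
  also have "\<dots> = (\<integral>z. \<eta> (x - z) * (u z - c) - \<eta> (y - z) * (u z - c) \<partial>lborel)"
    unfolding convol_minus_const[OF \<eta> u] by (intro Bochner_Integration.integral_diff[symmetric] int)
  finally have "\<bar>convol \<eta> u x - convol \<eta> u y\<bar> \<le> (\<integral>z. \<bar>\<eta> (x - z) * (u z - c) - \<eta> (y - z) * (u z - c)\<bar> \<partial>lborel)"
    by (simp only: integral_abs_bound)
  also have "\<dots> \<le> (\<integral>z. (C * norm (x - y) / (r * ?V)) * (indicator (ball x r) z * \<bar>u z - c\<bar>) \<partial>lborel)"
  proof (rule integral_mono)
    show "integrable lborel (\<lambda>z. \<bar>\<eta> (x - z) * (u z - c) - \<eta> (y - z) * (u z - c)\<bar>)"
      by (intro integrable_abs Bochner_Integration.integrable_diff int)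
    show "integrable lborel (\<lambda>z. (C * norm (x - y) / (r * ?V)) * (indicator (ball x r) z * \<bar>u z - c\<bar>))"
      by (intro integrable_mult_right avg_integrable[where B="B + \<bar>c\<bar>"]) (use bd in auto)
    fix z
    have e: "\<bar>\<eta> (x - z) * (u z - c) - \<eta> (y - z) * (u z - c)\<bar> = \<bar>\<eta> (x - z) - \<eta> (y - z)\<bar> * \<bar>u z - c\<bar>"
      by (simp only: left_diff_distrib[symmetric] abs_mult)
    show "\<bar>\<eta> (x - z) * (u z - c) - \<eta> (y - z) * (u z - c)\<bar> \<le> (C * norm (x - y) / (r * ?V)) * (indicator (ball x r) z * \<bar>u z - c\<bar>)"
    proof (cases "z \<in> ball x r")
      case True
      have "\<bar>\<eta> (x - z) - \<eta> (y - z)\<bar> \<le> C * norm ((x - z) - (y - z)) / (r * ?V)"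
        using \<eta> unfolding mollifier_def by blast
      then have "\<bar>\<eta> (x - z) - \<eta> (y - z)\<bar> \<le> C * norm (x - y) / (r * ?V)" by simp
      from mult_right_mono[OF this, of "\<bar>u z - c\<bar>"] show ?thesis unfolding e using True by simp
    next
      case False
      then have far: "r \<le> norm (x - z)" by (simp add: dist_norm)
      have "norm (x - z) \<le> norm (x - y) + norm (y - z)" using norm_triangle_ineq[of "x - y" "y - z"] by simp
      with far near r have "r / 2 \<le> norm (x - z)" "r / 2 \<le> norm (y - z)" by linarith+
      then have "\<eta> (x - z) = 0" "\<eta> (y - z) = 0" using \<eta> unfolding mollifier_def by blast+
      then show ?thesis using False by simp
    qed
  qed
  also have "\<dots> = C * (norm (x - y) / r) * avg x r (\<lambda>z. \<bar>u z - c\<bar>)" by (simp add: avg_def)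
  finally show ?thesis .
qed

lemma convol_measurable:
  assumes \<eta>: "mollifier C r \<eta>" and u: "u \<in> borel_measurable borel"
  shows "convol \<eta> u \<in> borel_measurable borel"
proof -
  note [measurable] = mollifier_measurable[OF \<eta>] u
  show ?thesis unfolding convol_def[abs_def] by measurable
qed

text \<open>
  Nearby points use the previous lemma with \<open>c = u y'\<close>, averaged over all \<open>y'\<close> in the ball around \<open>y\<close>.
  For distant points the two convolutions are compared one after the other with values of \<open>u\<close>, which averages
  both variables independently. Either way the right-hand side only contains differences \<open>u x' - u y'\<close>.
\<close>
lemma convol_diff_le:
  fixes \<eta> u :: "'a::euclidean_space \<Rightarrow> real"
  assumes \<eta>: "mollifier C r \<eta>" and C: "0 < C" and r: "0 < r"
    and u: "u \<in> borel_measurable borel" "\<And>z. \<bar>u z\<bar> \<le> B"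
  shows "\<bar>convol \<eta> u x - convol \<eta> u y\<bar>
    \<le> (2 * C\<^sup>2 + C) * (min 1 (norm (x - y) / r) * avg y r (\<lambda>y'. avg x r (\<lambda>x'. \<bar>u x' - u y'\<bar>)))"
proof -
  note [measurable] = u(1)
  let ?F = "\<lambda>y'. avg x r (\<lambda>x'. \<bar>u x' - u y'\<bar>)"
  have Fm [measurable]: "?F \<in> borel_measurable borel"
    by (rule avg_measurable) measurable
  have bd: "\<bar>\<bar>u x' - u y'\<bar>\<bar> \<le> 2 * B" for x' y' using u(2)[of x'] u(2)[of y'] by linarith
  have F0: "0 \<le> ?F y'" for y' by (rule avg_nonneg) simp
  have FB: "\<bar>?F y'\<bar> \<le> 2 * B" for y'
  proof -
    have "?F y' \<le> 2 * B" by (rule avg_le[where B="2 * B"]) (use bd r in auto)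
    then show ?thesis using F0[of y'] by simp
  qed
  have A0: "0 \<le> avg y r ?F" by (rule avg_nonneg) (rule F0)
  show ?thesis
  proof (cases "norm (x - y) < r / 2")
    case True
    let ?c = "C * (norm (x - y) / r)"
    have c0: "0 \<le> ?c" using C r by simp
    have "\<bar>convol \<eta> u x - convol \<eta> u y\<bar> = avg y r (\<lambda>y'. \<bar>convol \<eta> u x - convol \<eta> u y\<bar>)"
      using r by (simp only: avg_const)
    also have "\<dots> \<le> avg y r (\<lambda>y'. ?c * ?F y')"
    proof (rule avg_mono[where B="\<bar>convol \<eta> u x - convol \<eta> u y\<bar>" and B'="?c * (2 * B)"])
      show "\<bar>?c * ?F z\<bar> \<le> ?c * (2 * B)" for z
        unfolding abs_mult[of ?c] abs_of_nonneg[OF c0] by (rule mult_left_mono[OF FB c0])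
      show "\<bar>convol \<eta> u x - convol \<eta> u y\<bar> \<le> ?c * ?F z" for z
        by (rule convol_diff_le_near[OF \<eta> r u True])
    qed auto
    also have "\<dots> = ?c * avg y r ?F" by (rule avg_cmult)
    also have "\<dots> = C * (min 1 (norm (x - y) / r) * avg y r ?F)"
      using True r by (simp add: min_def divide_le_eq le_divide_eq)
    also have "\<dots> \<le> (2 * C\<^sup>2 + C) * (min 1 (norm (x - y) / r) * avg y r ?F)"
      by (rule mult_right_mono) (use A0 r in auto)
    finally show ?thesis .
  next
    case False
    have "\<bar>convol \<eta> u y - convol \<eta> u x\<bar> \<le> C * avg y r (\<lambda>y'. \<bar>u y' - convol \<eta> u x\<bar>)"
      by (rule convol_minus_const_le[OF \<eta> r u])
    also have "avg y r (\<lambda>y'. \<bar>u y' - convol \<eta> u x\<bar>) \<le> avg y r (\<lambda>y'. C * ?F y')"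
    proof (rule avg_mono[where B="B + \<bar>convol \<eta> u x\<bar>" and B'="C * (2 * B)"])
      show "\<bar>\<bar>u z - convol \<eta> u x\<bar>\<bar> \<le> B + \<bar>convol \<eta> u x\<bar>" for z using u(2)[of z] by linarith
      show "\<bar>C * ?F z\<bar> \<le> C * (2 * B)" for z
        using C FB[of z] by (simp add: abs_mult)
      show "\<bar>u z - convol \<eta> u x\<bar> \<le> C * ?F z" for z
        using convol_minus_const_le[OF \<eta> r u, of x "u z"] by (simp add: abs_minus_commute)
    qed auto
    also have "avg y r (\<lambda>y'. C * ?F y') = C * avg y r ?F" by (rule avg_cmult)
    finally have 1: "\<bar>convol \<eta> u x - convol \<eta> u y\<bar> \<le> C * (C * avg y r ?F)"
      using C by (simp add: abs_minus_commute)
    have h: "1 / 2 \<le> min 1 (norm (x - y) / r)" using False r by (simp add: le_divide_eq)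
    have "C * (C * avg y r ?F) = 2 * C\<^sup>2 * (1 / 2 * avg y r ?F)" by (simp add: power2_eq_square)
    also have "\<dots> \<le> (2 * C\<^sup>2 + C) * (min 1 (norm (x - y) / r) * avg y r ?F)"
      by (intro mult_mono mult_right_mono h A0) (use C A0 in auto)
    finally show ?thesis using 1 by linarith
  qed
qed

context Ap_density
begin

section \<open>The kernel under independent averaging\<close>

text \<open>
  The kernel of the averaging operator at scale \<open>r\<close> with respect to \<open>\<mu>\<close>, from the point of view of a
  fixed point \<open>x'\<close>: the weight with which it enters the average at \<open>x\<close>.
\<close>
definition pk :: "real \<Rightarrow> 'a \<Rightarrow> 'a \<Rightarrow> real" where
  "pk r x' x = (if dist x x' < r then 1 / m x r else 0)"

lemma pk_nonneg: "0 \<le> pk r x' x" by (simp add: pk_def m_nonneg)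

lemma pk_measurable [measurable (raw)]:
  assumes [measurable]: "f \<in> N \<rightarrow>\<^sub>M borel" "g \<in> N \<rightarrow>\<^sub>M borel"
  shows "(\<lambda>x. pk r (f x) (g x)) \<in> borel_measurable N"
  unfolding pk_def by measurable

lemma pk_integral: "0 < r \<Longrightarrow> (\<integral>\<^sup>+ x. ennreal (pk r x' x) \<partial>\<mu>) \<le> ennreal D"
proof -
  assume r: "0 < r"
  have "pk r x' x = indicator (ball x' r) x / m x r" for x
    by (simp add: pk_def dist_commute indicator_def)
  then show ?thesis using averaging_bounded[OF r] by simp
qed

lemma Ap_avg:
  assumes "f \<in> borel_measurable borel" "\<And>x. 0 \<le> f x" "\<And>x. f x \<le> B" and r: "0 < r"
  shows "ennreal (avg x r f powr p) \<le> ennreal K * (\<integral>\<^sup>+ z. ennreal (pk r z x * f z powr p) \<partial>\<mu>)"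
proof -
  note [measurable] = assms(1)
  have mp: "0 < m x r" using m_pos[OF r] .
  let ?J = "\<integral>\<^sup>+ z. ennreal (indicator (ball x r) z * f z powr p) \<partial>\<mu>"
  have I: "(\<integral>\<^sup>+ z. ennreal (pk r z x * f z powr p) \<partial>\<mu>) = ennreal (1 / m x r) * ?J"
  proof -
    have "(\<integral>\<^sup>+ z. ennreal (pk r z x * f z powr p) \<partial>\<mu>)
        = (\<integral>\<^sup>+ z. ennreal (1 / m x r) * ennreal (indicator (ball x r) z * f z powr p) \<partial>\<mu>)"
    proof (rule nn_integral_cong)
      fix z show "ennreal (pk r z x * f z powr p) = ennreal (1 / m x r) * ennreal (indicator (ball x r) z * f z powr p)"
        using mp by (cases "z \<in> ball x r") (auto simp: pk_def simp flip: ennreal_mult')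
    qed
    also have "\<dots> = ennreal (1 / m x r) * ?J" by (rule nn_integral_cmult) measurable
    finally show ?thesis .
  qed
  have "ennreal (avg x r f powr p) = ennreal (1 / m x r * (m x r * avg x r f powr p))"
    using mp by simp
  also have "\<dots> = ennreal (1 / m x r) * ennreal (m x r * avg x r f powr p)"
    by (rule ennreal_mult') (use mp in simp)
  also have "\<dots> \<le> ennreal (1 / m x r) * (ennreal K * ?J)"
    by (rule mult_left_mono[OF Ap'[OF assms] zero_le])
  also have "\<dots> = ennreal K * (ennreal (1 / m x r) * ?J)" by (rule mult.left_commute)
  finally show ?thesis by (simp only: I)
qed

text \<open>
  The averaging inequality used once in each variable. This is where the two points have to be averaged
  independently of each other.
\<close>
lemma Ap_avg2:
  assumes fm: "(\<lambda>q. f (fst q) (snd q)) \<in> borel_measurable (borel \<Otimes>\<^sub>M borel)"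
    and f0: "\<And>x y. 0 \<le> f x y" and fB: "\<And>x y. f x y \<le> B" and r: "0 < r"
  shows "ennreal (avg y r (\<lambda>y'. avg x r (\<lambda>x'. f x' y')) powr p)
    \<le> ennreal (K\<^sup>2) * (\<integral>\<^sup>+ y'. \<integral>\<^sup>+ x'. ennreal (pk r x' x * pk r y' y * f x' y' powr p) \<partial>\<mu> \<partial>\<mu>)"
proof -
  note [measurable] = fm
  have [measurable]: "(\<lambda>x'. f x' y') \<in> borel_measurable borel" for y'
    using measurable_compose[OF _ fm, of "\<lambda>x'. (x', y')" borel] by simp
  have [measurable]: "(\<lambda>q. f (snd q) (fst q)) \<in> borel_measurable (borel \<Otimes>\<^sub>M borel)"
    using measurable_compose[OF _ fm, of "\<lambda>q. (snd q, fst q)" "borel \<Otimes>\<^sub>M borel"] by simp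
  let ?F = "\<lambda>y'. avg x r (\<lambda>x'. f x' y')"
  have abs: "\<bar>f x' y'\<bar> \<le> B" for x' y' using f0 fB by (simp add: abs_of_nonneg)
  have [measurable]: "?F \<in> borel_measurable borel" by (rule avg_measurable) measurable
  have "ennreal (avg y r ?F powr p) \<le> ennreal K * (\<integral>\<^sup>+ y'. ennreal (pk r y' y * ?F y' powr p) \<partial>\<mu>)"
    by (rule Ap_avg[where B=B]) (use r f0 fB abs in \<open>auto intro!: avg_nonneg avg_le[where B=B]\<close>)
  also have "\<dots> \<le> ennreal K * (\<integral>\<^sup>+ y'. ennreal K * (\<integral>\<^sup>+ x'. ennreal (pk r x' x * pk r y' y * f x' y' powr p) \<partial>\<mu>) \<partial>\<mu>)"
  proof (intro mult_left_mono nn_integral_mono)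
    fix y'
    have "ennreal (pk r y' y * ?F y' powr p) = ennreal (pk r y' y) * ennreal (?F y' powr p)"
      by (simp add: ennreal_mult' pk_nonneg)
    also have "\<dots> \<le> ennreal (pk r y' y) * (ennreal K * (\<integral>\<^sup>+ x'. ennreal (pk r x' x * f x' y' powr p) \<partial>\<mu>))"
      by (intro mult_left_mono Ap_avg[where B=B]) (use r f0 fB in auto)
    also have "\<dots> = ennreal K * (\<integral>\<^sup>+ x'. ennreal (pk r y' y) * ennreal (pk r x' x * f x' y' powr p) \<partial>\<mu>)"
      by (subst nn_integral_cmult) (auto simp: mult.left_commute)
    also have "\<dots> = ennreal K * (\<integral>\<^sup>+ x'. ennreal (pk r x' x * pk r y' y * f x' y' powr p) \<partial>\<mu>)"
      by (simp add: pk_nonneg mult_ac flip: ennreal_mult')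
    finally show "ennreal (pk r y' y * ?F y' powr p) \<le> ennreal K * (\<integral>\<^sup>+ x'. ennreal (pk r x' x * pk r y' y * f x' y' powr p) \<partial>\<mu>)" .
  qed auto
  also have "\<dots> = ennreal (K\<^sup>2) * (\<integral>\<^sup>+ y'. \<integral>\<^sup>+ x'. ennreal (pk r x' x * pk r y' y * f x' y' powr p) \<partial>\<mu> \<partial>\<mu>)"
    using K by (subst nn_integral_cmult) (auto simp: power2_eq_square ennreal_mult mult.assoc)
  finally show ?thesis .
qed

text \<open>The two summands come from pairs at distance at least, respectively less than, \<open>4 r\<close>.\<close>
definition CS :: real where "CS = D ^ 4 * 2 powr (s * p) + D ^ 4 * CK * 4 powr (s * p)"

lemma CS_pos: "0 < CS" using D_pos CK_pos by (auto simp: CS_def intro!: add_pos_pos)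

text \<open>
  The weight with which the pair \<open>(x', y')\<close> contributes to the energy density of a mollified function at
  \<open>(x, y)\<close>, restricted to \<open>|x - y| < \<delta>\<close>.
\<close>
definition G :: "real \<Rightarrow> real \<Rightarrow> 'a \<Rightarrow> 'a \<Rightarrow> 'a \<Rightarrow> 'a \<Rightarrow> real" where
  "G \<delta> r x y x' y' = indicator {..<\<delta>} (norm (x - y)) * (pk r x' x * pk r y' y * (min 1 (norm (x - y) / r) powr p * kern x y))"

lemma G_nonneg: "0 < r \<Longrightarrow> 0 \<le> G \<delta> r x y x' y'"
  by (simp add: G_def pk_nonneg kern_nonneg)

text \<open>
  Moving both points of a pair by less than a quarter of their distance changes the distance and the mass of the ball
  between them only by bounded factors.
\<close>
lemma kern_compare_far:
  assumes r: "0 < r" and far: "4 * r \<le> norm (x' - y')" and c: "dist x x' < r" "dist y y' < r"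
  shows "kern x y \<le> 2 powr (s * p) * D ^ 2 * kern x' y'"
proof -
  have t1: "norm (x' - y') \<le> norm (x - y) + 2 * r" "norm (x - y) \<le> norm (x' - y') + 2 * r"
  proof -
    have "dist x' y' \<le> dist x' x + dist x y + dist y y'"
      using dist_triangle[of x' y' x] dist_triangle[of x y' y] by linarith
    then show "norm (x' - y') \<le> norm (x - y) + 2 * r" using c by (simp add: dist_norm norm_minus_commute)
    have "dist x y \<le> dist x x' + dist x' y' + dist y' y"
      using dist_triangle[of x y x'] dist_triangle[of x' y y'] by linarith
    then show "norm (x - y) \<le> norm (x' - y') + 2 * r" using c by (simp add: dist_norm norm_minus_commute)
  qed
  have pos: "0 < norm (x - y)" "0 < norm (x' - y')" using t1 far r by linarith+
  have "norm (x - y) powr (- (s * p)) \<le> (norm (x' - y') / 2) powr (- (s * p))"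
    using t1 far r p s pos by (intro powr_mono2') auto
  also have "\<dots> = 2 powr (s * p) * norm (x' - y') powr (- (s * p))"
    by (simp add: powr_divide powr_minus_divide)
  finally have A: "norm (x - y) powr (- (s * p)) \<le> 2 powr (s * p) * norm (x' - y') powr (- (s * p))" .
  have "1 / m ((1/2) *\<^sub>R (x + y)) (norm (x - y) / 2) \<le> D ^ 2 / m ((1/2) *\<^sub>R (x' + y')) (norm (x' - y') / 2)"
  proof (rule inverse_m_compare)
    have "dist ((1/2) *\<^sub>R (x' + y')) ((1/2) *\<^sub>R (x + y)) = norm ((x' - x) + (y' - y)) / 2"
    proof -
      have "(1/2) *\<^sub>R (x' + y') - (1/2) *\<^sub>R (x + y) = (1/2) *\<^sub>R ((x' - x) + (y' - y))"
        by (simp add: algebra_simps)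
      then show ?thesis by (simp add: dist_norm)
    qed
    also have "\<dots> \<le> r" using norm_triangle_ineq[of "x' - x" "y' - y"] c by (simp add: dist_norm norm_minus_commute)
    finally show "dist ((1/2) *\<^sub>R (x' + y')) ((1/2) *\<^sub>R (x + y)) + norm (x' - y') / 2 \<le> 2\<^sup>2 * (norm (x - y) / 2)"
      using t1 far by simp
  qed (use pos in auto)
  then have B: "1 / measure \<mu> (mid_ball x y) \<le> D ^ 2 / measure \<mu> (mid_ball x' y')" by (simp only: mid_ball_m)
  have "norm (x - y) powr (- (s * p)) * (1 / measure \<mu> (mid_ball x y)) \<le>
      (2 powr (s * p) * norm (x' - y') powr (- (s * p))) * (D ^ 2 / measure \<mu> (mid_ball x' y'))"
    by (rule mult_mono[OF A B]) auto
  then show ?thesis unfolding kern_def by (simp add: mult_ac)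
qed

text \<open>
  Near the diagonal the ball \<open>B_{x',y'}\<close> may be much smaller than \<open>r\<close>, but it is contained in a fixed
  enlargement of the ball of radius \<open>r\<close> around \<open>x\<close>.
\<close>
lemma inverse_m_near:
  assumes r: "0 < r" and near: "norm (x' - y') < 4 * r" and ne: "x' \<noteq> y'" and c: "dist x x' < r"
  shows "1 / m x r \<le> D ^ 3 / measure \<mu> (mid_ball x' y')"
  unfolding mid_ball_m
proof (rule inverse_m_compare)
  have "dist ((1/2) *\<^sub>R (x' + y')) x \<le> dist x' ((1/2) *\<^sub>R (x' + y')) + dist x x'"
    using dist_triangle[of "(1/2) *\<^sub>R (x' + y')" x x'] by (simp add: dist_commute)
  then show "dist ((1/2) *\<^sub>R (x' + y')) x + norm (x' - y') / 2 \<le> 2 ^ 3 * r"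
    using c near r unfolding dist_mid by simp
qed (use r ne in auto)

text \<open>
  Averaging the kernel, cut off at scale \<open>r\<close>, over both variables gives back at most a multiple of the kernel. For
  \<open>|x' - y'| \<ge> 4 r\<close> the kernel is essentially constant over the averaging balls. For
  \<open>|x' - y'| < 4 r\<close> the cutoff leaves a total mass of order \<open>r^(-sp)\<close>, and
  \<open>r^(-sp) \<le> C |x' - y'|^(-sp)\<close>.
\<close>
lemma S_bound:
  assumes r: "0 < r" and ne: "x' \<noteq> y'"
  shows "(\<integral>\<^sup>+ y. \<integral>\<^sup>+ x. ennreal (G \<delta> r x y x' y') \<partial>\<mu> \<partial>\<mu>)
    \<le> ennreal (CS * (indicator {..<\<delta> + 2 * r} (norm (x' - y')) * kern x' y'))"
proof (cases "norm (x' - y') < \<delta> + 2 * r")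
  case False
  have "G \<delta> r x y x' y' = 0" for x y
  proof -
    have "dist x' y' \<le> dist x x' + dist x y + dist y y'"
      using dist_triangle[of x' y' x] dist_triangle[of x y' y] by (simp add: dist_commute)
    then have "\<not> (dist x x' < r \<and> dist y y' < r \<and> norm (x - y) < \<delta>)"
      using False by (simp add: dist_norm)
    then show ?thesis by (auto simp: G_def pk_def)
  qed
  then show ?thesis by simp
next
  case True
  let ?M = "measure \<mu> (mid_ball x' y')"
  show ?thesis
  proof (cases "4 * r \<le> norm (x' - y')")
    case far: True
    let ?c = "2 powr (s * p) * D ^ 2 * kern x' y'"
    have c0: "0 \<le> ?c" using D_pos kern_nonneg by simp
    have "G \<delta> r x y x' y' \<le> pk r x' x * (pk r y' y * ?c)" for x y
    proof (cases "dist x x' < r \<and> dist y y' < r")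
      case True
      have "min 1 (norm (x - y) / r) powr p \<le> 1 powr p" using p r by (intro powr_mono2) auto
      then have "min 1 (norm (x - y) / r) powr p * kern x y \<le> 1 * ?c"
        using kern_compare_far[OF r far, of x y] True by (intro mult_mono) (auto simp: kern_nonneg)
      then have "pk r x' x * pk r y' y * (min 1 (norm (x - y) / r) powr p * kern x y) \<le> pk r x' x * pk r y' y * ?c"
        by (intro mult_left_mono) (auto simp: pk_nonneg)
      moreover have "G \<delta> r x y x' y' \<le> pk r x' x * pk r y' y * (min 1 (norm (x - y) / r) powr p * kern x y)"
        unfolding G_def by (rule mult_left_le_one_le) (auto simp: pk_nonneg kern_nonneg r)
      ultimately show ?thesis by (simp only: mult.assoc)
    next
      case False
      then have "G \<delta> r x y x' y' = 0" by (auto simp: G_def pk_def)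
      then show ?thesis using c0 pk_nonneg by simp
    qed
    then have "(\<integral>\<^sup>+ y. \<integral>\<^sup>+ x. ennreal (G \<delta> r x y x' y') \<partial>\<mu> \<partial>\<mu>) \<le>
       (\<integral>\<^sup>+ y. \<integral>\<^sup>+ x. ennreal (pk r x' x) * ennreal (pk r y' y * ?c) \<partial>\<mu> \<partial>\<mu>)"
      by (intro nn_integral_mono) (simp add: pk_nonneg ennreal_leI flip: ennreal_mult')
    also have "\<dots> = (\<integral>\<^sup>+ y. (\<integral>\<^sup>+ x. ennreal (pk r x' x) \<partial>\<mu>) * ennreal (pk r y' y * ?c) \<partial>\<mu>)"
      by (intro nn_integral_cong nn_integral_multc) measurable
    also have "\<dots> \<le> (\<integral>\<^sup>+ y. ennreal D * ennreal (pk r y' y * ?c) \<partial>\<mu>)"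
      by (rule nn_integral_mono, rule mult_right_mono[OF pk_integral[OF r] zero_le])
    also have "\<dots> = ennreal D * (\<integral>\<^sup>+ y. ennreal (pk r y' y * ?c) \<partial>\<mu>)"
      by (rule nn_integral_cmult) measurable
    also have "(\<integral>\<^sup>+ y. ennreal (pk r y' y * ?c) \<partial>\<mu>) = (\<integral>\<^sup>+ y. ennreal (pk r y' y) * ennreal ?c \<partial>\<mu>)"
      by (rule nn_integral_cong, rule ennreal_mult'[OF pk_nonneg])
    also have "\<dots> = (\<integral>\<^sup>+ y. ennreal (pk r y' y) \<partial>\<mu>) * ennreal ?c"
      by (rule nn_integral_multc) measurable
    also have "ennreal D * ((\<integral>\<^sup>+ y. ennreal (pk r y' y) \<partial>\<mu>) * ennreal ?c) \<le> ennreal D * (ennreal D * ennreal ?c)"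
      by (rule mult_left_mono[OF mult_right_mono[OF pk_integral[OF r] zero_le] zero_le])
    also have "\<dots> = ennreal (D * (?c * D))" using D_pos c0
      by (simp only: ennreal_mult'[OF less_imp_le[OF D_pos]] ennreal_mult'[OF c0] mult.commute)
    also have "\<dots> \<le> ennreal (CS * (indicator {..<\<delta> + 2 * r} (norm (x' - y')) * kern x' y'))"
    proof (rule ennreal_leI)
      have "D * (?c * D) = (D ^ 4 * 2 powr (s * p)) * kern x' y'" by (simp add: power2_eq_square power4_eq_xxxx)
      also have "\<dots> \<le> CS * kern x' y'" using D_pos CK_pos kern_nonneg by (intro mult_right_mono) (auto simp: CS_def)
      finally show "D * (?c * D) \<le> CS * (indicator {..<\<delta> + 2 * r} (norm (x' - y')) * kern x' y')" using True by simp
    qed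
    finally show ?thesis .
  next
    case False
    then have near: "norm (x' - y') < 4 * r" by simp
    have M: "?M > 0" unfolding mid_ball_m using ne by (intro m_pos) simp
    let ?c = "D ^ 3 / ?M"
    have c0: "0 \<le> ?c" using D_pos by simp
    let ?k = "\<lambda>x y. min 1 (norm (x - y) / r) powr p * kern x y"
    have "G \<delta> r x y x' y' \<le> ?c * pk r y' y * ?k x y" for x y
    proof (cases "dist x x' < r")
      case True
      have "G \<delta> r x y x' y' \<le> pk r x' x * pk r y' y * ?k x y"
        unfolding G_def by (rule mult_left_le_one_le) (auto simp: pk_nonneg kern_nonneg r)
      also have "\<dots> \<le> ?c * pk r y' y * ?k x y"
        using inverse_m_near[OF r near ne True] True
        by (intro mult_right_mono) (auto simp: pk_nonneg kern_nonneg pk_def[of r x'])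
      finally show ?thesis .
    next
      case False
      then have "G \<delta> r x y x' y' = 0" by (auto simp: G_def pk_def)
      then show ?thesis
        using mult_nonneg_nonneg[OF mult_nonneg_nonneg[OF c0 pk_nonneg] mult_nonneg_nonneg[OF powr_ge_zero kern_nonneg]]
        by simp
    qed
    note Gle = this
    have "(\<integral>\<^sup>+ y. \<integral>\<^sup>+ x. ennreal (G \<delta> r x y x' y') \<partial>\<mu> \<partial>\<mu>) \<le>
       (\<integral>\<^sup>+ y. \<integral>\<^sup>+ x. ennreal (?c * pk r y' y) * ennreal (?k y x) \<partial>\<mu> \<partial>\<mu>)"
    proof (intro nn_integral_mono)
      fix x y
      have "?k x y = ?k y x" by (simp only: kern_commute norm_minus_commute)
      then have "ennreal (G \<delta> r x y x' y') \<le> ennreal (?c * pk r y' y * ?k y x)"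
        using Gle[of x y] by (intro ennreal_leI) (simp only:)
      also have "\<dots> = ennreal (?c * pk r y' y) * ennreal (?k y x)"
        by (rule ennreal_mult'[OF mult_nonneg_nonneg[OF c0 pk_nonneg]])
      finally show "ennreal (G \<delta> r x y x' y') \<le> ennreal (?c * pk r y' y) * ennreal (?k y x)" .
    qed
    also have "\<dots> = (\<integral>\<^sup>+ y. ennreal (?c * pk r y' y) * (\<integral>\<^sup>+ x. ennreal (?k y x) \<partial>\<mu>) \<partial>\<mu>)"
      by (intro nn_integral_cong nn_integral_cmult) measurable
    also have "\<dots> \<le> (\<integral>\<^sup>+ y. ennreal (?c * pk r y' y) * ennreal (CK * r powr (- (s * p))) \<partial>\<mu>)"
      by (intro nn_integral_mono mult_left_mono min_kern_integral r) auto
    also have "\<dots> = (\<integral>\<^sup>+ y. ennreal (?c * (CK * r powr (- (s * p)))) * ennreal (pk r y' y) \<partial>\<mu>)"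
    proof (rule nn_integral_cong)
      fix y
      let ?d = "CK * r powr (- (s * p))"
      have "ennreal (?c * pk r y' y) * ennreal ?d = ennreal (?c * pk r y' y * ?d)"
        by (rule ennreal_mult'[symmetric, OF mult_nonneg_nonneg[OF c0 pk_nonneg]])
      also have "?c * pk r y' y * ?d = ?c * ?d * pk r y' y" by (simp only: mult_ac)
      also have "ennreal \<dots> = ennreal (?c * ?d) * ennreal (pk r y' y)"
        by (rule ennreal_mult'') (rule pk_nonneg)
      finally show "ennreal (?c * pk r y' y) * ennreal ?d = ennreal (?c * ?d) * ennreal (pk r y' y)" .
    qed
    also have "\<dots> = ennreal (?c * (CK * r powr (- (s * p)))) * (\<integral>\<^sup>+ y. ennreal (pk r y' y) \<partial>\<mu>)"
      by (intro nn_integral_cmult) measurable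
    also have "\<dots> \<le> ennreal (?c * (CK * r powr (- (s * p)))) * ennreal D"
      by (intro mult_left_mono pk_integral r) auto
    also have "\<dots> = ennreal (?c * (CK * r powr (- (s * p))) * D)" by (rule ennreal_mult''[symmetric]) (use D_pos in simp)
    also have "\<dots> \<le> ennreal (CS * (indicator {..<\<delta> + 2 * r} (norm (x' - y')) * kern x' y'))"
    proof (rule ennreal_leI)
      have n0: "0 < norm (x' - y')" using ne by simp
      have "r powr (- (s * p)) \<le> (norm (x' - y') / 4) powr (- (s * p))"
        using near r p s n0 by (intro powr_mono2') auto
      also have "\<dots> = 4 powr (s * p) * norm (x' - y') powr (- (s * p))"
        by (simp add: powr_divide powr_minus_divide)
      finally have "?c * (CK * r powr (- (s * p))) * D \<le> ?c * (CK * (4 powr (s * p) * norm (x' - y') powr (- (s * p)))) * D"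
        using D_pos CK_pos c0 by (intro mult_left_mono mult_right_mono) auto
      also have "\<dots> = (D ^ 4 * CK * 4 powr (s * p)) * kern x' y'"
        by (simp add: kern_def power3_eq_cube power4_eq_xxxx)
      also have "\<dots> \<le> CS * kern x' y'" using D_pos CK_pos kern_nonneg by (intro mult_right_mono) (auto simp: CS_def)
      finally show "?c * (CK * r powr (- (s * p))) * D \<le> CS * (indicator {..<\<delta> + 2 * r} (norm (x' - y')) * kern x' y')"
        using True by simp
    qed
    finally show ?thesis .
  qed
qed

end

section \<open>The energy and its part near the diagonal\<close>
lemma nn_integral_le_cmult:
  assumes "\<And>x. f x \<le> c * g x" "g \<in> borel_measurable M"
  shows "(\<integral>\<^sup>+ x. f x \<partial>M) \<le> c * (\<integral>\<^sup>+ x. g x \<partial>M)"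
  using nn_integral_mono[of M f "\<lambda>x. c * g x"] assms by (simp add: nn_integral_cmult)

context Ap_density
begin

definition En :: "('a \<Rightarrow> real) \<Rightarrow> ennreal" where
  "En u = (\<integral>\<^sup>+ y. \<integral>\<^sup>+ x. ennreal (\<bar>u x - u y\<bar> powr p * kern x y) \<partial>\<mu> \<partial>\<mu>)"

definition Enl :: "real \<Rightarrow> ('a \<Rightarrow> real) \<Rightarrow> ennreal" where
  "Enl \<delta> u = (\<integral>\<^sup>+ y. \<integral>\<^sup>+ x. ennreal (indicator {..<\<delta>} (norm (x - y)) * (\<bar>u x - u y\<bar> powr p * kern x y)) \<partial>\<mu> \<partial>\<mu>)"

lemma nn_integral_iterated:
  assumes [measurable]: "(\<lambda>q. h (fst q) (snd q)) \<in> borel_measurable (\<mu> \<Otimes>\<^sub>M \<mu>)"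
  shows "(\<integral>\<^sup>+ y. \<integral>\<^sup>+ x. h x y \<partial>\<mu> \<partial>\<mu>) = (\<integral>\<^sup>+ q. h (fst q) (snd q) \<partial>(\<mu> \<Otimes>\<^sub>M \<mu>))"
  using pair.nn_integral_snd[OF assms] by simp

lemma nn_integral_swap:
  assumes [measurable]: "(\<lambda>q. h (fst q) (snd q)) \<in> borel_measurable (\<mu> \<Otimes>\<^sub>M \<mu>)"
  shows "(\<integral>\<^sup>+ y. \<integral>\<^sup>+ x. h x y \<partial>\<mu> \<partial>\<mu>) = (\<integral>\<^sup>+ x. \<integral>\<^sup>+ y. h x y \<partial>\<mu> \<partial>\<mu>)"
  using pair.Fubini'[of h] assms by (simp add: case_prod_unfold)

text \<open>
  Tonelli's theorem on the product of \<open>\<mu> \<Otimes> \<mu>\<close> with itself.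
\<close>
lemma nn_integral_swap4:
  assumes hm: "(\<lambda>q. h (fst (fst q)) (snd (fst q)) (fst (snd q)) (snd (snd q)))
    \<in> borel_measurable ((\<mu> \<Otimes>\<^sub>M \<mu>) \<Otimes>\<^sub>M (\<mu> \<Otimes>\<^sub>M \<mu>))"
  shows "(\<integral>\<^sup>+ y. \<integral>\<^sup>+ x. \<integral>\<^sup>+ y'. \<integral>\<^sup>+ x'. h x y x' y' \<partial>\<mu> \<partial>\<mu> \<partial>\<mu> \<partial>\<mu>) =
    (\<integral>\<^sup>+ y'. \<integral>\<^sup>+ x'. \<integral>\<^sup>+ y. \<integral>\<^sup>+ x. h x y x' y' \<partial>\<mu> \<partial>\<mu> \<partial>\<mu> \<partial>\<mu>)"
proof -
  let ?N = "\<mu> \<Otimes>\<^sub>M \<mu>"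
  interpret NN: pair_sigma_finite ?N ?N
    by (intro pair_sigma_finite.intro) (rule pair.sigma_finite_measure_axioms)+
  let ?h = "\<lambda>z z'. h (fst z) (snd z) (fst z') (snd z')"
  have m1: "(\<lambda>z'. ?h z z') \<in> borel_measurable ?N" for z
    using measurable_compose[OF measurable_Pair1'[of z ?N ?N] hm] by (simp add: space_pair_measure)
  have m2: "(\<lambda>z. ?h z z') \<in> borel_measurable ?N" for z'
    using measurable_compose[OF measurable_Pair2'[of z' ?N ?N] hm] by (simp add: space_pair_measure)
  have M1: "(\<lambda>z. \<integral>\<^sup>+ z'. ?h z z' \<partial>?N) \<in> borel_measurable ?N"
    by (rule sigma_finite_measure.borel_measurable_nn_integral[OF pair.sigma_finite_measure_axioms]) (use hm in \<open>simp add: case_prod_unfold\<close>)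
  have M2: "(\<lambda>z'. \<integral>\<^sup>+ z. ?h z z' \<partial>?N) \<in> borel_measurable ?N"
  proof (rule sigma_finite_measure.borel_measurable_nn_integral[OF pair.sigma_finite_measure_axioms])
    show "(\<lambda>(z', z). ?h z z') \<in> borel_measurable (?N \<Otimes>\<^sub>M ?N)"
      using measurable_compose[OF measurable_pair_swap' hm] by (simp add: case_prod_unfold)
  qed
  have 1: "(\<integral>\<^sup>+ y'. \<integral>\<^sup>+ x'. h x y x' y' \<partial>\<mu> \<partial>\<mu>) = (\<integral>\<^sup>+ z'. ?h (x, y) z' \<partial>?N)" for x y
    using nn_integral_iterated[of "h x y"] m1[of "(x, y)"] by simp
  have 2: "(\<integral>\<^sup>+ y. \<integral>\<^sup>+ x. h x y x' y' \<partial>\<mu> \<partial>\<mu>) = (\<integral>\<^sup>+ z. ?h z (x', y') \<partial>?N)" for x' y'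
    using nn_integral_iterated[of "\<lambda>x y. h x y x' y'"] m2[of "(x', y')"] by simp
  have "(\<integral>\<^sup>+ y. \<integral>\<^sup>+ x. \<integral>\<^sup>+ y'. \<integral>\<^sup>+ x'. h x y x' y' \<partial>\<mu> \<partial>\<mu> \<partial>\<mu> \<partial>\<mu>)
      = (\<integral>\<^sup>+ z. \<integral>\<^sup>+ z'. ?h z z' \<partial>?N \<partial>?N)"
    unfolding 1 using nn_integral_iterated[of "\<lambda>x y. \<integral>\<^sup>+ z'. ?h (x, y) z' \<partial>?N"] M1 by simp
  also have "\<dots> = (\<integral>\<^sup>+ z'. \<integral>\<^sup>+ z. ?h z z' \<partial>?N \<partial>?N)"
    by (rule NN.Fubini'[symmetric]) (use hm in \<open>simp add: case_prod_unfold\<close>)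
  also have "\<dots> = (\<integral>\<^sup>+ y'. \<integral>\<^sup>+ x'. \<integral>\<^sup>+ y. \<integral>\<^sup>+ x. h x y x' y' \<partial>\<mu> \<partial>\<mu> \<partial>\<mu> \<partial>\<mu>)"
    unfolding 2 using nn_integral_iterated[of "\<lambda>x' y'. \<integral>\<^sup>+ z. ?h z (x', y') \<partial>?N"] M2 by simp
  finally show ?thesis .
qed

lemma Enl_mono: "\<delta> \<le> \<delta>' \<Longrightarrow> Enl \<delta> u \<le> Enl \<delta>' u"
  unfolding Enl_def
  by (intro nn_integral_mono ennreal_leI mult_right_mono) (auto simp: kern_nonneg split: split_indicator)

lemma diff_powr_le:
  fixes a b c d :: real
  shows "\<bar>(a - b) - (c - d)\<bar> powr p \<le> 2 powr p * (\<bar>a - c\<bar> powr p + \<bar>b - d\<bar> powr p)"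
proof -
  have "\<bar>(a - b) - (c - d)\<bar> powr p \<le> (\<bar>a - c\<bar> + \<bar>b - d\<bar>) powr p"
    using p by (intro powr_mono2) auto
  also have "\<dots> \<le> 2 powr p * (\<bar>a - c\<bar> powr p + \<bar>b - d\<bar> powr p)"
    using p by (intro powr_add_le) auto
  finally show ?thesis .
qed

lemma indicator_lessThan_measurable [measurable (raw)]:
  fixes a :: real
  assumes [measurable]: "f \<in> borel_measurable N"
  shows "(\<lambda>x. indicator {..<a} (f x) :: real) \<in> borel_measurable N"
  unfolding indicator_def lessThan_iff by measurable

lemma energy_integrand_measurable:
  assumes [measurable]: "u \<in> borel_measurable borel"
  shows "(\<lambda>q. ennreal (\<bar>u (fst q) - u (snd q)\<bar> powr p * kern (fst q) (snd q))) \<in> borel_measurable (\<mu> \<Otimes>\<^sub>M \<mu>)"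
    "(\<lambda>q. ennreal (indicator {..<\<delta>} (norm (fst q - snd q)) * (\<bar>u (fst q) - u (snd q)\<bar> powr p * kern (fst q) (snd q)))) \<in> borel_measurable (\<mu> \<Otimes>\<^sub>M \<mu>)"
  by (measurable; fail)+

lemma kernel_energy_diff:
  assumes [measurable]: "f \<in> borel_measurable borel" "g \<in> borel_measurable borel"
    and [measurable]: "(\<lambda>q. \<kappa> (fst q) (snd q)) \<in> borel_measurable (\<mu> \<Otimes>\<^sub>M \<mu>)" and \<kappa>: "\<And>x y. 0 \<le> \<kappa> x y"
  defines "E \<equiv> \<lambda>u. \<integral>\<^sup>+ y. \<integral>\<^sup>+ x. ennreal (\<kappa> x y * \<bar>u x - u y\<bar> powr p) \<partial>\<mu> \<partial>\<mu>"
  shows "E (\<lambda>x. f x - g x) \<le> ennreal (2 powr p) * (E f + E g)"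
proof -
  let ?F = "\<lambda>u q. ennreal (\<kappa> (fst q) (snd q) * \<bar>u (fst q) - u (snd q)\<bar> powr p)"
  have Fm: "?F u \<in> borel_measurable (\<mu> \<Otimes>\<^sub>M \<mu>)" if [measurable]: "u \<in> borel_measurable borel" for u
    by measurable
  have eq: "E u = (\<integral>\<^sup>+ q. ?F u q \<partial>(\<mu> \<Otimes>\<^sub>M \<mu>))" if "u \<in> borel_measurable borel" for u
    unfolding E_def by (rule nn_integral_iterated[OF Fm[OF that]])
  have fm [measurable]: "?F f \<in> borel_measurable (\<mu> \<Otimes>\<^sub>M \<mu>)" "?F g \<in> borel_measurable (\<mu> \<Otimes>\<^sub>M \<mu>)"
    by (rule Fm, fact)+
  have "E (\<lambda>x. f x - g x) = (\<integral>\<^sup>+ q. ?F (\<lambda>x. f x - g x) q \<partial>(\<mu> \<Otimes>\<^sub>M \<mu>))"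
    by (rule eq) measurable
  also have "\<dots> \<le> (\<integral>\<^sup>+ q. ennreal (2 powr p) * (?F f q + ?F g q) \<partial>(\<mu> \<Otimes>\<^sub>M \<mu>))"
  proof (rule nn_integral_mono)
    fix q
    let ?k = "\<kappa> (fst q) (snd q)"
    have k0: "0 \<le> ?k" by (rule \<kappa>)
    from mult_left_mono[OF diff_powr_le this, of "f (fst q)" "g (fst q)" "f (snd q)" "g (snd q)"]
    have "ennreal (?k * \<bar>f (fst q) - g (fst q) - (f (snd q) - g (snd q))\<bar> powr p) \<le>
      ennreal (2 powr p * (?k * \<bar>f (fst q) - f (snd q)\<bar> powr p + ?k * \<bar>g (fst q) - g (snd q)\<bar> powr p))"
      by (intro ennreal_leI) (simp only: distrib_left mult_ac)
    also have "\<dots> = ennreal (2 powr p) * (?F f q + ?F g q)"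
      using mult_nonneg_nonneg[OF k0 powr_ge_zero] by (subst ennreal_mult', simp, subst ennreal_plus, simp_all)
    finally show "?F (\<lambda>x. f x - g x) q \<le> ennreal (2 powr p) * (?F f q + ?F g q)" .
  qed
  also have "\<dots> = ennreal (2 powr p) * (\<integral>\<^sup>+ q. ?F f q + ?F g q \<partial>(\<mu> \<Otimes>\<^sub>M \<mu>))"
    by (rule nn_integral_cmult) measurable
  also have "(\<integral>\<^sup>+ q. ?F f q + ?F g q \<partial>(\<mu> \<Otimes>\<^sub>M \<mu>)) = E f + E g"
    unfolding eq[OF assms(1)] eq[OF assms(2)] by (rule nn_integral_add) measurable
  finally show ?thesis .
qed

lemma Enl_diff:
  assumes "f \<in> borel_measurable borel" "g \<in> borel_measurable borel"
  shows "Enl \<delta> (\<lambda>x. f x - g x) \<le> ennreal (2 powr p) * (Enl \<delta> f + Enl \<delta> g)"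
  using kernel_energy_diff[OF assms, of "\<lambda>x y. indicator {..<\<delta>} (norm (x - y)) * kern x y"]
  by (simp add: Enl_def kern_nonneg mult_ac)

lemma En_diff:
  assumes "f \<in> borel_measurable borel" "g \<in> borel_measurable borel"
  shows "En (\<lambda>x. f x - g x) \<le> ennreal (2 powr p) * (En f + En g)"
  using kernel_energy_diff[OF assms, of kern] by (simp add: En_def kern_nonneg mult_ac)

text \<open>
  Dominated convergence: the energy density is integrable and vanishes on the diagonal.
\<close>
lemma Enl_vanishes:
  assumes um: "u \<in> borel_measurable borel" and fin: "En u < \<infinity>" and \<epsilon>: "0 < (\<epsilon>::ennreal)"
  shows "\<exists>\<delta>>0. Enl \<delta> u < \<epsilon>"
proof -
  let ?N = "\<mu> \<Otimes>\<^sub>M \<mu>"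
  let ?e = "\<lambda>q. ennreal (\<bar>u (fst q) - u (snd q)\<bar> powr p * kern (fst q) (snd q))"
  let ?F = "\<lambda>\<delta> q. ennreal (indicator {..<\<delta>} (norm (fst q - snd q)) * (\<bar>u (fst q) - u (snd q)\<bar> powr p * kern (fst q) (snd q)))"
  have em: "?e \<in> borel_measurable ?N" and Fm: "\<And>\<delta>. ?F \<delta> \<in> borel_measurable ?N"
    using energy_integrand_measurable[OF um] by blast+
  have E: "En u = (\<integral>\<^sup>+ q. ?e q \<partial>?N)" unfolding En_def
    by (rule nn_integral_iterated[where h="\<lambda>x y. ennreal (\<bar>u x - u y\<bar> powr p * kern x y)", OF em])
  have El: "Enl \<delta> u = (\<integral>\<^sup>+ q. ?F \<delta> q \<partial>?N)" for \<delta> unfolding Enl_def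
    by (rule nn_integral_iterated[where h="\<lambda>x y. ennreal (indicator {..<\<delta>} (norm (x - y)) * (\<bar>u x - u y\<bar> powr p * kern x y))", OF Fm])
  have "(\<lambda>i. \<integral>\<^sup>+ q. ?F (inverse (real (Suc i))) q \<partial>?N) \<longlonglongrightarrow> (\<integral>\<^sup>+ q. 0 \<partial>?N)"
  proof (rule nn_integral_dominated_convergence[where w="?e"])
    show "AE q in ?N. ?F (inverse (real (Suc i))) q \<le> ?e q" for i
      by (intro AE_I2 ennreal_leI mult_left_le_one_le) (auto simp: kern_nonneg)
    show "AE q in ?N. (\<lambda>i. ?F (inverse (real (Suc i))) q) \<longlonglongrightarrow> 0"
    proof (rule AE_I2)
      fix q
      show "(\<lambda>i. ?F (inverse (real (Suc i))) q) \<longlonglongrightarrow> 0"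
      proof (cases "fst q = snd q")
        case False
        then have "0 < norm (fst q - snd q)" by simp
        then have "\<forall>\<^sub>F i in sequentially. inverse (real (Suc i)) < norm (fst q - snd q)"
          using LIMSEQ_inverse_real_of_nat by (rule order_tendstoD(2)[rotated])
        then have "\<forall>\<^sub>F i in sequentially. ?F (inverse (real (Suc i))) q = 0"
          by eventually_elim simp
        then show ?thesis by (rule tendsto_eventually)
      next
        case True
        then show ?thesis by (simp add: kern_def)
      qed
    qed
    show "(\<integral>\<^sup>+ q. ?e q \<partial>?N) < \<infinity>" using fin E by simp
  qed (auto intro: em Fm)
  then have "\<forall>\<^sub>F i in sequentially. (\<integral>\<^sup>+ q. ?F (inverse (real (Suc i))) q \<partial>?N) < \<epsilon>"
    using \<epsilon> by (intro order_tendstoD(2)) simp_all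
  then obtain i where "(\<integral>\<^sup>+ q. ?F (inverse (real (Suc i))) q \<partial>?N) < \<epsilon>"
    using eventually_happens'[OF sequentially_bot] by blast
  then show ?thesis unfolding El by (intro exI[of _ "inverse (real (Suc i))"]) simp
qed

text \<open>
  Tonelli's theorem and the symmetry of the kernel reduce both summands to the central kernel estimate.
\<close>
lemma kernel_mass:
  assumes [measurable]: "g \<in> borel_measurable borel" and t: "0 < t"
  shows "(\<integral>\<^sup>+ y. \<integral>\<^sup>+ x. (g x + g y) * ennreal (min 1 (norm (x - y) / t) powr p * kern x y) \<partial>\<mu> \<partial>\<mu>)
    \<le> ennreal (2 * CK * t powr (- (s * p))) * (\<integral>\<^sup>+ x. g x \<partial>\<mu>)"
proof -
  let ?k = "\<lambda>x y. ennreal (min 1 (norm (x - y) / t) powr p * kern x y)"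
  let ?c = "CK * t powr (- (s * p))"
  have c0: "0 \<le> ?c" using CK_pos by simp
  have A: "(\<integral>\<^sup>+ x. \<integral>\<^sup>+ y. g x * ?k x y \<partial>\<mu> \<partial>\<mu>) \<le> ennreal ?c * (\<integral>\<^sup>+ x. g x \<partial>\<mu>)"
  proof (rule nn_integral_le_cmult)
    fix x
    have "(\<integral>\<^sup>+ y. g x * ?k x y \<partial>\<mu>) = g x * (\<integral>\<^sup>+ y. ?k x y \<partial>\<mu>)" by (rule nn_integral_cmult) measurable
    also have "\<dots> \<le> g x * ennreal ?c" by (rule mult_left_mono[OF min_kern_integral[OF t] zero_le])
    finally show "(\<integral>\<^sup>+ y. g x * ?k x y \<partial>\<mu>) \<le> ennreal ?c * g x" by (simp only: mult.commute)
  qed simp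
  have B: "(\<integral>\<^sup>+ y. \<integral>\<^sup>+ x. g y * ?k x y \<partial>\<mu> \<partial>\<mu>) \<le> ennreal ?c * (\<integral>\<^sup>+ x. g x \<partial>\<mu>)"
    using A by (simp only: kern_commute norm_minus_commute)
  have [measurable]: "(\<lambda>y. \<integral>\<^sup>+ x. g x * ?k x y \<partial>\<mu>) \<in> borel_measurable borel"
    "(\<lambda>y. \<integral>\<^sup>+ x. g y * ?k x y \<partial>\<mu>) \<in> borel_measurable borel" by measurable
  have "(\<integral>\<^sup>+ y. \<integral>\<^sup>+ x. (g x + g y) * ?k x y \<partial>\<mu> \<partial>\<mu>)
      = (\<integral>\<^sup>+ y. (\<integral>\<^sup>+ x. g x * ?k x y \<partial>\<mu>) + (\<integral>\<^sup>+ x. g y * ?k x y \<partial>\<mu>) \<partial>\<mu>)"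
    unfolding distrib_right by (intro nn_integral_cong nn_integral_add) measurable
  also have "\<dots> = (\<integral>\<^sup>+ y. \<integral>\<^sup>+ x. g x * ?k x y \<partial>\<mu> \<partial>\<mu>) + (\<integral>\<^sup>+ y. \<integral>\<^sup>+ x. g y * ?k x y \<partial>\<mu> \<partial>\<mu>)"
    by (rule nn_integral_add) measurable
  also have "(\<integral>\<^sup>+ y. \<integral>\<^sup>+ x. g x * ?k x y \<partial>\<mu> \<partial>\<mu>) = (\<integral>\<^sup>+ x. \<integral>\<^sup>+ y. g x * ?k x y \<partial>\<mu> \<partial>\<mu>)"
    by (rule nn_integral_swap) measurable
  also have "\<dots> + (\<integral>\<^sup>+ y. \<integral>\<^sup>+ x. g y * ?k x y \<partial>\<mu> \<partial>\<mu>) \<le> ennreal ?c * (\<integral>\<^sup>+ x. g x \<partial>\<mu>) + ennreal ?c * (\<integral>\<^sup>+ x. g x \<partial>\<mu>)"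
    by (rule add_mono[OF A B])
  also have "\<dots> = ennreal (2 * ?c) * (\<integral>\<^sup>+ x. g x \<partial>\<mu>)"
    by (simp only: mult_2 ennreal_plus[OF c0 c0] distrib_right)
  finally show ?thesis by (simp only: mult.assoc)
qed

text \<open>
  For \<open>|x - y| \<ge> \<delta>\<close> the cutoff factor in the central kernel estimate equals one, so that part of the energy is
  controlled by the \<open>L^p\<close> norm alone.
\<close>
lemma En_split:
  assumes [measurable]: "f \<in> borel_measurable borel" and \<delta>: "0 < \<delta>"
  shows "En f \<le> Enl \<delta> f + ennreal (2 powr p * (2 * CK * \<delta> powr (- (s * p)))) * (\<integral>\<^sup>+ x. ennreal (\<bar>f x\<bar> powr p) \<partial>\<mu>)"
proof -
  let ?k = "\<lambda>x y. min 1 (norm (x - y) / \<delta>) powr p * kern x y"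
  let ?g = "\<lambda>x. ennreal (\<bar>f x\<bar> powr p)"
  let ?L = "\<lambda>x y. ennreal (indicator {..<\<delta>} (norm (x - y)) * (\<bar>f x - f y\<bar> powr p * kern x y))"
  let ?Q = "\<lambda>x y. (?g x + ?g y) * ennreal (?k x y)"
  have le: "ennreal (\<bar>f x - f y\<bar> powr p * kern x y) \<le> ?L x y + ennreal (2 powr p) * ?Q x y" for x y
  proof (cases "norm (x - y) < \<delta>")
    case False
    then have kk: "?k x y = kern x y" using \<delta> by (simp add: min_def divide_le_eq)
    have "\<bar>f x - f y\<bar> powr p \<le> 2 powr p * (\<bar>f x\<bar> powr p + \<bar>f y\<bar> powr p)"
      using diff_powr_le[of "f x" "f y" 0 0] by simp
    from mult_right_mono[OF this kern_nonneg[of x y]]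
    have "ennreal (\<bar>f x - f y\<bar> powr p * kern x y) \<le> ennreal (2 powr p * ((\<bar>f x\<bar> powr p + \<bar>f y\<bar> powr p) * ?k x y))"
      unfolding kk by (intro ennreal_leI) (simp only: mult.assoc)
    also have "\<dots> = ennreal (2 powr p) * ?Q x y"
      by (simp only: ennreal_mult'[OF powr_ge_zero] ennreal_mult'[OF add_nonneg_nonneg[OF powr_ge_zero powr_ge_zero]]
          ennreal_plus[OF powr_ge_zero powr_ge_zero])
    finally show ?thesis by (simp add: add_increasing)
  qed simp
  have [measurable]: "(\<lambda>y. \<integral>\<^sup>+ x. ?Q x y \<partial>\<mu>) \<in> borel_measurable borel" "(\<lambda>y. \<integral>\<^sup>+ x. ?L x y \<partial>\<mu>) \<in> borel_measurable borel"
    by measurable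
  have "En f \<le> (\<integral>\<^sup>+ y. \<integral>\<^sup>+ x. ?L x y + ennreal (2 powr p) * ?Q x y \<partial>\<mu> \<partial>\<mu>)"
    unfolding En_def by (intro nn_integral_mono le)
  also have "\<dots> = (\<integral>\<^sup>+ y. (\<integral>\<^sup>+ x. ?L x y \<partial>\<mu>) + ennreal (2 powr p) * (\<integral>\<^sup>+ x. ?Q x y \<partial>\<mu>) \<partial>\<mu>)"
    by (intro nn_integral_cong) (simp add: nn_integral_add nn_integral_cmult)
  also have "\<dots> = Enl \<delta> f + ennreal (2 powr p) * (\<integral>\<^sup>+ y. \<integral>\<^sup>+ x. ?Q x y \<partial>\<mu> \<partial>\<mu>)"
    unfolding Enl_def by (simp add: nn_integral_add nn_integral_cmult)
  also have "\<dots> \<le> Enl \<delta> f + ennreal (2 powr p) * (ennreal (2 * CK * \<delta> powr (- (s * p))) * (\<integral>\<^sup>+ x. ?g x \<partial>\<mu>))"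
    by (intro add_left_mono mult_left_mono kernel_mass \<delta>) simp_all
  finally show ?thesis by (simp only: ennreal_mult'[OF powr_ge_zero] mult.assoc)
qed

text \<open>
  Insert the pointwise bound for differences of \<open>u_r\<close>, apply the averaging inequality in both variables and integrate over
  \<open>(x, y)\<close> first: what remains is the bound for the averaged kernel, which is uniform in \<open>r\<close>.
\<close>
lemma convol_Enl:
  assumes \<eta>: "mollifier C r \<eta>" and C: "0 < C" and r: "0 < r"
    and um: "u \<in> borel_measurable borel" and uB: "\<And>z. \<bar>u z\<bar> \<le> B"
  shows "Enl \<delta> (convol \<eta> u) \<le> ennreal ((2 * C\<^sup>2 + C) powr p * K\<^sup>2 * CS) * Enl (\<delta> + 2 * r) u"
proof -
  note [measurable] = um
  let ?c1 = "2 * C\<^sup>2 + C"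
  let ?v = "convol \<eta> u"
  let ?c = "?c1 powr p * K\<^sup>2"
  let ?H = "\<lambda>x y x' y'. ennreal (G \<delta> r x y x' y') * ennreal (\<bar>u x' - u y'\<bar> powr p)"
  have c1: "0 < ?c1" using C by (simp add: add_pos_pos)
  have c0: "0 \<le> ?c" by simp
  have point: "ennreal (indicator {..<\<delta>} (norm (x - y)) * (\<bar>?v x - ?v y\<bar> powr p * kern x y))
      \<le> ennreal ?c * (\<integral>\<^sup>+ y'. \<integral>\<^sup>+ x'. ?H x y x' y' \<partial>\<mu> \<partial>\<mu>)" for x y
  proof -
    let ?A = "avg y r (\<lambda>y'. avg x r (\<lambda>x'. \<bar>u x' - u y'\<bar>))"
    let ?mn = "min 1 (norm (x - y) / r)"
    let ?e = "indicator {..<\<delta>} (norm (x - y)) * (?mn powr p * kern x y)"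
    have A0: "0 \<le> ?A" by (intro avg_nonneg) simp
    have mn0: "0 \<le> ?mn" using r by simp
    have e0: "0 \<le> ?e" by (simp add: kern_nonneg)
    have "\<bar>?v x - ?v y\<bar> powr p \<le> (?c1 * (?mn * ?A)) powr p"
      using convol_diff_le[OF \<eta> C r um uB] p by (intro powr_mono2) auto
    also have "\<dots> = ?c1 powr p * (?mn powr p * ?A powr p)"
      using c1 mn0 A0 by (simp only: powr_mult less_imp_le mult_nonneg_nonneg)
    finally have "indicator {..<\<delta>} (norm (x - y)) * (\<bar>?v x - ?v y\<bar> powr p * kern x y) \<le>
      indicator {..<\<delta>} (norm (x - y)) * (?c1 powr p * (?mn powr p * ?A powr p) * kern x y)"
      by (intro mult_left_mono mult_right_mono) (auto simp: kern_nonneg)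
    also have "\<dots> = ?c1 powr p * (?e * ?A powr p)" by (simp only: mult_ac)
    finally have "ennreal (indicator {..<\<delta>} (norm (x - y)) * (\<bar>?v x - ?v y\<bar> powr p * kern x y)) \<le> ennreal (?c1 powr p * (?e * ?A powr p))"
      by (rule ennreal_leI)
    also have "\<dots> = ennreal (?c1 powr p) * (ennreal ?e * ennreal (?A powr p))"
      by (simp only: ennreal_mult'[OF powr_ge_zero] ennreal_mult'[OF e0])
    also have "\<dots> \<le> ennreal (?c1 powr p) * (ennreal ?e * (ennreal (K\<^sup>2) *
        (\<integral>\<^sup>+ y'. \<integral>\<^sup>+ x'. ennreal (pk r x' x * pk r y' y * \<bar>u x' - u y'\<bar> powr p) \<partial>\<mu> \<partial>\<mu>)))"
    proof (intro mult_left_mono zero_le Ap_avg2[where B="2 * B"])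
      show "(\<lambda>q. \<bar>u (fst q) - u (snd q)\<bar>) \<in> borel_measurable (borel \<Otimes>\<^sub>M borel)" by measurable
      show "\<bar>u x - u y\<bar> \<le> 2 * B" for x y using uB[of x] uB[of y] by linarith
    qed (use r in auto)
    also have "\<dots> = ennreal ?c * (ennreal ?e *
        (\<integral>\<^sup>+ y'. \<integral>\<^sup>+ x'. ennreal (pk r x' x * pk r y' y * \<bar>u x' - u y'\<bar> powr p) \<partial>\<mu> \<partial>\<mu>))"
    proof -
      have ce: "ennreal ?c = ennreal (?c1 powr p) * ennreal (K\<^sup>2)" by (rule ennreal_mult') simp
      show ?thesis unfolding ce by (simp only: mult_ac)
    qed
    also have "ennreal ?e * (\<integral>\<^sup>+ y'. \<integral>\<^sup>+ x'. ennreal (pk r x' x * pk r y' y * \<bar>u x' - u y'\<bar> powr p) \<partial>\<mu> \<partial>\<mu>)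
       = (\<integral>\<^sup>+ y'. ennreal ?e * (\<integral>\<^sup>+ x'. ennreal (pk r x' x * pk r y' y * \<bar>u x' - u y'\<bar> powr p) \<partial>\<mu>) \<partial>\<mu>)"
      by (rule nn_integral_cmult[symmetric]) measurable
    also have "\<dots> = (\<integral>\<^sup>+ y'. \<integral>\<^sup>+ x'. ennreal ?e * ennreal (pk r x' x * pk r y' y * \<bar>u x' - u y'\<bar> powr p) \<partial>\<mu> \<partial>\<mu>)"
      by (intro nn_integral_cong nn_integral_cmult[symmetric]) measurable
    also have "\<dots> = (\<integral>\<^sup>+ y'. \<integral>\<^sup>+ x'. ?H x y x' y' \<partial>\<mu> \<partial>\<mu>)"
    proof (intro nn_integral_cong)
      fix x' y'
      have "ennreal ?e * ennreal (pk r x' x * pk r y' y * \<bar>u x' - u y'\<bar> powr p) = ennreal (?e * (pk r x' x * pk r y' y * \<bar>u x' - u y'\<bar> powr p))"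
        by (simp only: ennreal_mult'[OF e0])
      also have "?e * (pk r x' x * pk r y' y * \<bar>u x' - u y'\<bar> powr p) = G \<delta> r x y x' y' * \<bar>u x' - u y'\<bar> powr p"
        unfolding G_def by (simp only: mult_ac)
      also have "ennreal \<dots> = ?H x y x' y'" by (rule ennreal_mult'[OF G_nonneg[OF r]])
      finally show "ennreal ?e * ennreal (pk r x' x * pk r y' y * \<bar>u x' - u y'\<bar> powr p) = ?H x y x' y'" .
    qed
    finally show ?thesis .
  qed
  have Gm: "(\<lambda>q. ?H (fst (fst q)) (snd (fst q)) (fst (snd q)) (snd (snd q)))
    \<in> borel_measurable ((\<mu> \<Otimes>\<^sub>M \<mu>) \<Otimes>\<^sub>M (\<mu> \<Otimes>\<^sub>M \<mu>))"
    unfolding G_def by measurable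
  have "Enl \<delta> ?v \<le> (\<integral>\<^sup>+ y. \<integral>\<^sup>+ x. ennreal ?c * (\<integral>\<^sup>+ y'. \<integral>\<^sup>+ x'. ?H x y x' y' \<partial>\<mu> \<partial>\<mu>) \<partial>\<mu> \<partial>\<mu>)"
    unfolding Enl_def by (intro nn_integral_mono point)
  also have "\<dots> = (\<integral>\<^sup>+ y. ennreal ?c * (\<integral>\<^sup>+ x. \<integral>\<^sup>+ y'. \<integral>\<^sup>+ x'. ?H x y x' y' \<partial>\<mu> \<partial>\<mu> \<partial>\<mu>) \<partial>\<mu>)"
    by (intro nn_integral_cong nn_integral_cmult) (unfold G_def, measurable)
  also have "\<dots> = ennreal ?c * (\<integral>\<^sup>+ y. \<integral>\<^sup>+ x. \<integral>\<^sup>+ y'. \<integral>\<^sup>+ x'. ?H x y x' y' \<partial>\<mu> \<partial>\<mu> \<partial>\<mu> \<partial>\<mu>)"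
    by (intro nn_integral_cmult) (unfold G_def, measurable)
  also have "(\<integral>\<^sup>+ y. \<integral>\<^sup>+ x. \<integral>\<^sup>+ y'. \<integral>\<^sup>+ x'. ?H x y x' y' \<partial>\<mu> \<partial>\<mu> \<partial>\<mu> \<partial>\<mu>) =
    (\<integral>\<^sup>+ y'. \<integral>\<^sup>+ x'. \<integral>\<^sup>+ y. \<integral>\<^sup>+ x. ?H x y x' y' \<partial>\<mu> \<partial>\<mu> \<partial>\<mu> \<partial>\<mu>)"
    by (rule nn_integral_swap4[OF Gm])
  also have "\<dots> \<le> (\<integral>\<^sup>+ y'. \<integral>\<^sup>+ x'. ennreal CS * ennreal (indicator {..<\<delta> + 2 * r} (norm (x' - y')) * (\<bar>u x' - u y'\<bar> powr p * kern x' y')) \<partial>\<mu> \<partial>\<mu>)"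
  proof (intro nn_integral_mono)
    fix x' y'
    have "(\<integral>\<^sup>+ y. \<integral>\<^sup>+ x. ?H x y x' y' \<partial>\<mu> \<partial>\<mu>) = (\<integral>\<^sup>+ y. (\<integral>\<^sup>+ x. ennreal (G \<delta> r x y x' y') \<partial>\<mu>) * ennreal (\<bar>u x' - u y'\<bar> powr p) \<partial>\<mu>)"
      by (intro nn_integral_cong nn_integral_multc) (unfold G_def, measurable)
    also have "\<dots> = (\<integral>\<^sup>+ y. \<integral>\<^sup>+ x. ennreal (G \<delta> r x y x' y') \<partial>\<mu> \<partial>\<mu>) * ennreal (\<bar>u x' - u y'\<bar> powr p)"
      by (intro nn_integral_multc) (unfold G_def, measurable)
    also have "\<dots> \<le> ennreal (CS * (indicator {..<\<delta> + 2 * r} (norm (x' - y')) * kern x' y')) * ennreal (\<bar>u x' - u y'\<bar> powr p)"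
    proof (cases "x' = y'")
      case False
      show ?thesis by (rule mult_right_mono[OF S_bound[OF r False] zero_le])
    qed simp
    also have "\<dots> = ennreal (CS * (indicator {..<\<delta> + 2 * r} (norm (x' - y')) * kern x' y') * \<bar>u x' - u y'\<bar> powr p)"
      by (rule ennreal_mult'[symmetric]) (use CS_pos kern_nonneg in simp)
    also have "\<dots> = ennreal (CS * (indicator {..<\<delta> + 2 * r} (norm (x' - y')) * (\<bar>u x' - u y'\<bar> powr p * kern x' y')))"
      by (simp only: mult_ac)
    also have "\<dots> = ennreal CS * ennreal (indicator {..<\<delta> + 2 * r} (norm (x' - y')) * (\<bar>u x' - u y'\<bar> powr p * kern x' y'))"
      by (rule ennreal_mult') (use CS_pos in simp)
    finally show "(\<integral>\<^sup>+ y. \<integral>\<^sup>+ x. ?H x y x' y' \<partial>\<mu> \<partial>\<mu>) \<le> ennreal CS * ennreal (indicator {..<\<delta> + 2 * r} (norm (x' - y')) * (\<bar>u x' - u y'\<bar> powr p * kern x' y'))" .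
  qed
  also have "\<dots> = (\<integral>\<^sup>+ y'. ennreal CS * (\<integral>\<^sup>+ x'. ennreal (indicator {..<\<delta> + 2 * r} (norm (x' - y')) * (\<bar>u x' - u y'\<bar> powr p * kern x' y')) \<partial>\<mu>) \<partial>\<mu>)"
    by (intro nn_integral_cong nn_integral_cmult) measurable
  also have "\<dots> = ennreal CS * Enl (\<delta> + 2 * r) u"
    unfolding Enl_def by (intro nn_integral_cmult) measurable
  finally have "Enl \<delta> ?v \<le> ennreal ?c * (ennreal CS * Enl (\<delta> + 2 * r) u)"
    by (simp add: mult_left_mono)
  also have "\<dots> = ennreal (?c * CS) * Enl (\<delta> + 2 * r) u"
    by (subst ennreal_mult'[OF c0]) (rule mult.assoc[symmetric])
  finally show ?thesis .
qed

end

section \<open>Convergence of mollifications\<close>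
lemma uniformly_continuous_of_compact_support:
  fixes g :: "'a::euclidean_space \<Rightarrow> real"
  assumes "continuous_on UNIV g" "\<And>x. R \<le> norm x \<Longrightarrow> g x = 0" "0 < e"
  shows "\<exists>d>0. \<forall>x z. dist x z < d \<longrightarrow> \<bar>g z - g x\<bar> < e"
proof -
  have "uniformly_continuous_on (cball 0 (R + 2)) g"
    by (rule compact_uniformly_continuous) (auto intro: continuous_on_subset[OF assms(1)])
  then obtain d0 where d0: "d0 > 0"
    "\<And>x z. x \<in> cball 0 (R + 2) \<Longrightarrow> z \<in> cball 0 (R + 2) \<Longrightarrow> dist z x < d0 \<Longrightarrow> dist (g z) (g x) < e"
    unfolding uniformly_continuous_on_def using assms(3) by metis
  have "\<bar>g z - g x\<bar> < e" if d: "dist x z < min d0 1" for x z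
  proof (cases "x \<in> cball 0 (R + 2) \<and> z \<in> cball 0 (R + 2)")
    case True
    then show ?thesis using d0(2)[of x z] d by (simp add: dist_commute dist_real_def)
  next
    case False
    have "norm x \<le> norm z + dist x z" "norm z \<le> norm x + dist x z"
      using norm_triangle_sub[of x z] norm_triangle_sub[of z x] by (simp_all add: dist_norm norm_minus_commute)
    then have "R \<le> norm x" "R \<le> norm z" using False d by auto
    then show ?thesis using assms by simp
  qed
  then show ?thesis using d0(1) by (intro exI[of _ "min d0 1"]) auto
qed

context Ap_density
begin

text \<open>
  Averaging is bounded on \<open>L^p(\<mu>)\<close>, uniformly in \<open>r\<close>: the averaging inequality inside, then Tonelli and the bound
  on the adjoint.
\<close>
lemma Lp_avg:
  assumes [measurable]: "g \<in> borel_measurable borel" and g: "\<And>x. 0 \<le> g x" "\<And>x. g x \<le> B" and r: "0 < r"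
  shows "(\<integral>\<^sup>+ x. ennreal (avg x r g powr p) \<partial>\<mu>) \<le> ennreal (K * D) * (\<integral>\<^sup>+ z. ennreal (g z powr p) \<partial>\<mu>)"
proof -
  have "(\<integral>\<^sup>+ x. ennreal (avg x r g powr p) \<partial>\<mu>) \<le> (\<integral>\<^sup>+ x. ennreal K * (\<integral>\<^sup>+ z. ennreal (pk r z x * g z powr p) \<partial>\<mu>) \<partial>\<mu>)"
    by (intro nn_integral_mono Ap_avg[where B=B]) (use g r in auto)
  also have "\<dots> = ennreal K * (\<integral>\<^sup>+ x. \<integral>\<^sup>+ z. ennreal (pk r z x * g z powr p) \<partial>\<mu> \<partial>\<mu>)"
    by (rule nn_integral_cmult) measurable
  also have "(\<integral>\<^sup>+ x. \<integral>\<^sup>+ z. ennreal (pk r z x * g z powr p) \<partial>\<mu> \<partial>\<mu>) = (\<integral>\<^sup>+ z. \<integral>\<^sup>+ x. ennreal (pk r z x * g z powr p) \<partial>\<mu> \<partial>\<mu>)"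
    by (rule nn_integral_swap) measurable
  also have "\<dots> = (\<integral>\<^sup>+ z. \<integral>\<^sup>+ x. ennreal (pk r z x) * ennreal (g z powr p) \<partial>\<mu> \<partial>\<mu>)"
    by (simp only: ennreal_mult'[OF pk_nonneg])
  also have "\<dots> = (\<integral>\<^sup>+ z. (\<integral>\<^sup>+ x. ennreal (pk r z x) \<partial>\<mu>) * ennreal (g z powr p) \<partial>\<mu>)"
    by (intro nn_integral_cong nn_integral_multc) measurable
  also have "\<dots> \<le> (\<integral>\<^sup>+ z. ennreal D * ennreal (g z powr p) \<partial>\<mu>)"
    by (rule nn_integral_mono, rule mult_right_mono[OF pk_integral[OF r] zero_le])
  also have "\<dots> = ennreal D * (\<integral>\<^sup>+ z. ennreal (g z powr p) \<partial>\<mu>)"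
    by (rule nn_integral_cmult) measurable
  finally have "(\<integral>\<^sup>+ x. ennreal (avg x r g powr p) \<partial>\<mu>) \<le> ennreal K * (ennreal D * (\<integral>\<^sup>+ z. ennreal (g z powr p) \<partial>\<mu>))"
    by (simp add: mult_left_mono)
  also have "\<dots> = ennreal (K * D) * (\<integral>\<^sup>+ z. ennreal (g z powr p) \<partial>\<mu>)"
    by (subst ennreal_mult'[OF less_imp_le[OF K]]) (rule mult.assoc[symmetric])
  finally show ?thesis .
qed

text \<open>
  A measurable function is an almost everywhere limit of continuous ones; clamping these to the range of \<open>u\<close>
  and cutting them off outside its support supplies an integrable majorant.
\<close>
lemma continuous_approx:
  assumes um: "u \<in> borel_measurable borel" and uB: "\<And>x. \<bar>u x\<bar> \<le> B" and us: "\<And>x. \<rho> \<le> norm x \<Longrightarrow> u x = 0"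
    and \<epsilon>: "0 < (\<epsilon>::ennreal)"
  shows "\<exists>g. continuous_on UNIV g \<and> (\<forall>x. \<bar>g x\<bar> \<le> B) \<and> (\<forall>x. \<rho> + 1 \<le> norm x \<longrightarrow> g x = 0) \<and>
    (\<integral>\<^sup>+ x. ennreal (\<bar>u x - g x\<bar> powr p) \<partial>\<mu>) < \<epsilon>"
proof -
  note [measurable] = um
  have B0: "0 \<le> B" using uB[of 0] by linarith
  have "u \<in> borel_measurable lebesgue" using um by (intro measurable_completion) simp
  then have "u measurable_on UNIV" by (rule lebesgue_measurable_imp_measurable_on_real) simp
  then obtain N h where N: "negligible N" and h: "\<And>n. continuous_on UNIV (h n)"
    and lim: "\<And>x. x \<notin> N \<Longrightarrow> (\<lambda>n. h n x) \<longlonglongrightarrow> u x"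
    unfolding measurable_on_def by auto
  define \<theta> where "\<theta> x = max 0 (min 1 (\<rho> + 1 - norm x))" for x :: 'a
  define g where "g n x = \<theta> x * max (- B) (min B (h n x))" for n x
  have \<theta>: "0 \<le> \<theta> x" "\<theta> x \<le> 1" "\<rho> + 1 \<le> norm x \<Longrightarrow> \<theta> x = 0" "norm x \<le> \<rho> \<Longrightarrow> \<theta> x = 1" for x
    by (auto simp: \<theta>_def)
  have gc: "continuous_on UNIV (g n)" for n
    unfolding g_def \<theta>_def by (intro continuous_intros h)
  have [measurable]: "g n \<in> borel_measurable borel" for n
    using gc borel_measurable_continuous_onI by blast
  have gB: "\<bar>g n x\<bar> \<le> B" for n x
  proof -
    have "\<bar>max (- B) (min B (h n x))\<bar> \<le> B" using B0 by auto
    then have "\<bar>\<theta> x\<bar> * \<bar>max (- B) (min B (h n x))\<bar> \<le> 1 * B" using \<theta>[of x] by (intro mult_mono) auto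
    then show ?thesis by (simp add: g_def abs_mult)
  qed
  have gs: "g n x = 0" if "\<rho> + 1 \<le> norm x" for n x using \<theta>(3)[OF that] by (simp add: g_def)
  have "AE x in lebesgue. x \<notin> N"
    using N by (intro AE_not_in) (simp add: negligible_iff_null_sets)
  then have AE: "AE x in \<mu>. x \<notin> N" by (intro AE_mu) (simp add: AE_completion_iff)
  let ?w = "\<lambda>x. ennreal ((2 * B) powr p * indicator (ball 0 (\<rho> + 1)) x)"
  have "(\<lambda>n. \<integral>\<^sup>+ x. ennreal (\<bar>u x - g n x\<bar> powr p) \<partial>\<mu>) \<longlonglongrightarrow> (\<integral>\<^sup>+ x. 0 \<partial>\<mu>)"
  proof (rule nn_integral_dominated_convergence[where w="?w"])
    show "AE x in \<mu>. ennreal (\<bar>u x - g n x\<bar> powr p) \<le> ?w x" for n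
    proof (intro AE_I2 ennreal_leI)
      fix x
      show "\<bar>u x - g n x\<bar> powr p \<le> (2 * B) powr p * indicator (ball 0 (\<rho> + 1)) x"
      proof (cases "norm x < \<rho> + 1")
        case True
        have "\<bar>u x - g n x\<bar> \<le> 2 * B" using uB[of x] gB[of n x] by linarith
        then have "\<bar>u x - g n x\<bar> powr p \<le> (2 * B) powr p" using p by (intro powr_mono2) auto
        then show ?thesis using True by simp
      next
        case False
        then show ?thesis using us[of x] gs[of x n] by simp
      qed
    qed
    show "AE x in \<mu>. (\<lambda>n. ennreal (\<bar>u x - g n x\<bar> powr p)) \<longlonglongrightarrow> 0"
      using AE
    proof eventually_elim
      case (elim x)
      have "(\<lambda>n. g n x) \<longlonglongrightarrow> \<theta> x * max (- B) (min B (u x))"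
        unfolding g_def by (intro tendsto_intros lim elim)
      also have "\<theta> x * max (- B) (min B (u x)) = u x"
        using uB[of x] us[of x] \<theta>(4)[of x] by (cases "\<rho> \<le> norm x") (auto simp: max_def min_def)
      finally have "(\<lambda>n. \<bar>u x - g n x\<bar>) \<longlonglongrightarrow> \<bar>u x - u x\<bar>" by (intro tendsto_intros)
      then have "(\<lambda>n. \<bar>u x - g n x\<bar> powr p) \<longlonglongrightarrow> 0 powr p"
        using p by (intro tendsto_powr2) (auto intro!: always_eventually)
      then have "(\<lambda>n. ennreal (\<bar>u x - g n x\<bar> powr p)) \<longlonglongrightarrow> ennreal 0" by (intro tendsto_ennrealI) simp
      then show ?case by simp
    qed
    have "(\<integral>\<^sup>+ x. ?w x \<partial>\<mu>) = (\<integral>\<^sup>+ x. ennreal ((2 * B) powr p) * indicator (ball 0 (\<rho> + 1)) x \<partial>\<mu>)"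
      by (intro nn_integral_cong) (auto split: split_indicator)
    also have "\<dots> = ennreal ((2 * B) powr p) * ennreal (m 0 (\<rho> + 1))"
      by (simp add: nn_integral_cmult_indicator emeasure_ball)
    also have "\<dots> < \<infinity>" by (simp add: ennreal_mult_less_top)
    finally show "(\<integral>\<^sup>+ x. ?w x \<partial>\<mu>) < \<infinity>" .
  qed measurable
  then have "\<forall>\<^sub>F n in sequentially. (\<integral>\<^sup>+ x. ennreal (\<bar>u x - g n x\<bar> powr p) \<partial>\<mu>) < \<epsilon>"
    using \<epsilon> by (intro order_tendstoD(2)) simp_all
  then obtain n where "(\<integral>\<^sup>+ x. ennreal (\<bar>u x - g n x\<bar> powr p) \<partial>\<mu>) < \<epsilon>"
    using eventually_happens'[OF sequentially_bot] by blast
  then show ?thesis using gc gB gs by (intro exI[of _ "g n"]) blast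
qed

text \<open>
  Approximate \<open>u\<close> in \<open>L^p(\<mu>)\<close> by a continuous \<open>g\<close> with compact support. The difference \<open>u - g\<close> stays
  small under averaging, and \<open>g\<close> oscillates little on small balls.
\<close>
lemma convol_Lp:
  assumes C: "0 < C" and um: "u \<in> borel_measurable borel" and uB: "\<And>x. \<bar>u x\<bar> \<le> B"
    and us: "\<And>x. \<rho> \<le> norm x \<Longrightarrow> u x = 0" and \<epsilon>: "0 < (\<epsilon>::real)"
  shows "\<exists>r0>0. \<forall>r \<eta>. 0 < r \<longrightarrow> r < r0 \<longrightarrow> mollifier C r \<eta> \<longrightarrow>
    (\<integral>\<^sup>+ x. ennreal (\<bar>convol \<eta> u x - u x\<bar> powr p) \<partial>\<mu>) < ennreal \<epsilon>"
proof -
  note [measurable] = um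
  define M where "M = m 0 (\<rho> + 2)"
  (* c4 multiplies the L^p distance of u and g in the final estimate, c2 2^p the oscillation of g *)
  define c2 where "c2 = C powr p * 2 powr p"
  define c4 where "c4 = c2 * (K * D + 2 powr p)"
  have M0: "0 \<le> M" by (simp add: M_def m_nonneg)
  have c2: "0 < c2" using C by (simp add: c2_def)
  have c4: "0 < c4" using c2 K D_pos by (simp add: c4_def add_pos_pos)
  (* M + 1 instead of M, because the ball may be empty and then M = 0 *)
  define e where "e = (\<epsilon> / (2 * (c2 * 2 powr p) * (M + 1))) powr (1 / p)"
  have q0: "0 < \<epsilon> / (2 * (c2 * 2 powr p) * (M + 1))" using \<epsilon> c2 M0 by simp
  have e0: "0 < e" unfolding e_def powr_gt_zero using q0 by (metis less_irrefl)
  have ep: "e powr p = \<epsilon> / (2 * (c2 * 2 powr p) * (M + 1))"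
  proof -
    have "e powr p = (\<epsilon> / (2 * (c2 * 2 powr p) * (M + 1))) powr 1"
      unfolding e_def powr_powr using p by simp
    then show ?thesis using q0 by (simp only: powr_one_gt_zero_iff less_imp_le)
  qed
  have eM: "c2 * 2 powr p * e powr p * M \<le> \<epsilon> / 2"
  proof -
    have "c2 * 2 powr p * e powr p * M = \<epsilon> / 2 * (M / (M + 1))"
    proof -
      define q where "q = c2 * 2 powr p"
      have q: "q > 0" using c2 by (simp add: q_def)
      have "q * (\<epsilon> / (2 * q * (M + 1))) = \<epsilon> / (2 * (M + 1))" using q by simp
      then show ?thesis unfolding ep q_def[symmetric] by simp
    qed
    also have "\<dots> \<le> \<epsilon> / 2 * 1" using \<epsilon> M0 by (intro mult_left_mono) (auto simp: divide_le_eq)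
    finally show ?thesis by simp
  qed
  obtain g where g: "continuous_on UNIV g" "\<And>x. \<bar>g x\<bar> \<le> B" "\<And>x. \<rho> + 1 \<le> norm x \<Longrightarrow> g x = 0"
    and I: "(\<integral>\<^sup>+ x. ennreal (\<bar>u x - g x\<bar> powr p) \<partial>\<mu>) < ennreal (\<epsilon> / (2 * c4))"
    using continuous_approx[OF um uB us, where \<epsilon>="ennreal (\<epsilon> / (2 * c4))" and \<rho>=\<rho>] \<epsilon> c4 by (auto simp: ennreal_less_zero_iff)
  have [measurable]: "g \<in> borel_measurable borel" using g(1) by (rule borel_measurable_continuous_onI)
  obtain i where i: "(\<integral>\<^sup>+ x. ennreal (\<bar>u x - g x\<bar> powr p) \<partial>\<mu>) = ennreal i" "0 \<le> i"
    using I by (cases "\<integral>\<^sup>+ x. ennreal (\<bar>u x - g x\<bar> powr p) \<partial>\<mu>") auto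
  have "i < \<epsilon> / (2 * c4)" using I i by (simp add: ennreal_less_iff)
  then have ci: "c4 * i < \<epsilon> / 2" using c4 by (simp add: less_divide_eq mult.commute mult.left_commute)
  obtain d where d: "d > 0" "\<And>x z. dist x z < d \<Longrightarrow> \<bar>g z - g x\<bar> < e"
    using uniformly_continuous_of_compact_support[OF g(1) g(3) e0] by blast
  let ?h = "\<lambda>z. \<bar>u z - g z\<bar>"
  let ?\<theta> = "\<lambda>x. indicator (ball (0::'a) (\<rho> + 2)) x :: real"
  have hB: "?h z \<le> 2 * B" for z using uB[of z] g(2)[of z] by linarith
  have main: "(\<integral>\<^sup>+ x. ennreal (\<bar>convol \<eta> u x - u x\<bar> powr p) \<partial>\<mu>) < ennreal \<epsilon>"
    if r: "0 < r" "r < min d 1" and \<eta>: "mollifier C r \<eta>" for r \<eta>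
  proof -
    have pt: "\<bar>convol \<eta> u x - u x\<bar> powr p \<le> c2 * avg x r ?h powr p + (c2 * 2 powr p * e powr p * ?\<theta> x + c2 * 2 powr p * ?h x powr p)" for x
    proof -
      let ?c = "e * ?\<theta> x + ?h x"
      have c0: "0 \<le> ?c" using e0 by simp
      have A0: "0 \<le> avg x r ?h" by (rule avg_nonneg) simp
      have "avg x r (\<lambda>z. \<bar>u z - u x\<bar>) \<le> avg x r (\<lambda>z. ?h z + ?c)"
      proof (rule avg_mono[where B="2 * B" and B'="2 * B + ?c"])
        show "\<bar>\<bar>u z - u x\<bar>\<bar> \<le> 2 * B" for z using uB[of z] uB[of x] by linarith
        show "\<bar>?h z + ?c\<bar> \<le> 2 * B + ?c" for z using hB[of z] c0 by simp
        fix z assume z: "z \<in> ball x r"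
        have "\<bar>g z - g x\<bar> \<le> e * ?\<theta> x"
        proof (cases "norm x < \<rho> + 2")
          case True
          then show ?thesis using d(2)[of x z] z r by simp
        next
          case False
          have "norm x \<le> norm z + dist x z"
            using norm_triangle_sub[of x z] by (simp add: dist_norm)
          then have "\<rho> + 1 \<le> norm x" "\<rho> + 1 \<le> norm z" using False z r by auto
          then show ?thesis using g(3) e0 by simp
        qed
        then show "\<bar>u z - u x\<bar> \<le> ?h z + ?c" by linarith
      qed measurable
      also have "\<dots> = avg x r ?h + ?c"
        using avg_add[of ?h "2 * B" "\<lambda>z. ?c" "\<bar>?c\<bar>" x r] avg_const[OF r(1), of x ?c] hB by simp
      finally have "C * avg x r (\<lambda>z. \<bar>u z - u x\<bar>) \<le> C * (avg x r ?h + ?c)"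
        using C by (intro mult_left_mono) auto
      with convol_minus_const_le[OF \<eta> r(1) um uB, of x "u x"]
      have "\<bar>convol \<eta> u x - u x\<bar> \<le> C * (avg x r ?h + ?c)" by linarith
      then have "\<bar>convol \<eta> u x - u x\<bar> powr p \<le> (C * (avg x r ?h + ?c)) powr p"
        using p by (intro powr_mono2) auto
      also have "\<dots> = C powr p * (avg x r ?h + ?c) powr p" by (rule powr_mult)
      also have "\<dots> \<le> C powr p * (2 powr p * (avg x r ?h powr p + ?c powr p))"
        using p A0 c0 by (intro mult_left_mono powr_add_le) auto
      also have "\<dots> = c2 * avg x r ?h powr p + c2 * ?c powr p" by (simp add: c2_def algebra_simps)
      also have "c2 * ?c powr p \<le> c2 * (2 powr p * ((e * ?\<theta> x) powr p + ?h x powr p))"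
        using p c2 e0 by (intro mult_left_mono powr_add_le) auto
      also have "(e * ?\<theta> x) powr p = e powr p * ?\<theta> x" by (auto split: split_indicator)
      finally show ?thesis by (simp only: distrib_left mult.assoc)
    qed
    have am: "(\<lambda>x. avg x r ?h) \<in> borel_measurable borel"
    proof -
      have "(\<lambda>x. \<integral>z. (if dist x z < r then ?h z else 0) \<partial>lborel) \<in> borel_measurable borel" by measurable
      moreover have "(\<integral>z. (if dist x z < r then ?h z else 0) \<partial>lborel) = (\<integral>z. indicator (ball x r) z * ?h z \<partial>lborel)" for x
        by (intro Bochner_Integration.integral_cong) (auto split: split_indicator)
      ultimately show ?thesis unfolding avg_def by simp
    qed
    define A where "A x = avg x r ?h" for x
    have [measurable]: "A \<in> borel_measurable borel" using am by (simp only: A_def[abs_def])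
    have [measurable]: "(\<lambda>x. indicator (ball 0 (\<rho> + 2)) x :: ennreal) \<in> borel_measurable borel"
      by (rule borel_measurable_indicator) simp
    define H where "H x = ?h x" for x
    have [measurable]: "H \<in> borel_measurable borel" unfolding H_def[abs_def] by measurable
    have A0: "0 \<le> A x" for x unfolding A_def by (rule avg_nonneg) simp
    have "(\<integral>\<^sup>+ x. ennreal (\<bar>convol \<eta> u x - u x\<bar> powr p) \<partial>\<mu>) \<le>
      (\<integral>\<^sup>+ x. ennreal c2 * ennreal (A x powr p) + (ennreal (c2 * 2 powr p * e powr p) * indicator (ball 0 (\<rho> + 2)) x
        + ennreal (c2 * 2 powr p) * ennreal (H x powr p)) \<partial>\<mu>)"
    proof (rule nn_integral_mono)
      fix x
      have "ennreal (\<bar>convol \<eta> u x - u x\<bar> powr p) \<le> ennreal (c2 * A x powr p + (c2 * 2 powr p * e powr p * ?\<theta> x + c2 * 2 powr p * H x powr p))"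
        unfolding A_def H_def by (rule ennreal_leI[OF pt])
      also have "\<dots> = ennreal (c2 * A x powr p) + (ennreal (c2 * 2 powr p * e powr p * ?\<theta> x) + ennreal (c2 * 2 powr p * H x powr p))"
        using c2 by (subst ennreal_plus, simp, simp, subst ennreal_plus, simp_all)
      also have "ennreal (c2 * A x powr p) = ennreal c2 * ennreal (A x powr p)"
        by (rule ennreal_mult') (use c2 in simp)
      also have "ennreal (c2 * 2 powr p * e powr p * ?\<theta> x) = ennreal (c2 * 2 powr p * e powr p) * indicator (ball 0 (\<rho> + 2)) x"
        by (auto split: split_indicator)
      also have "ennreal (c2 * 2 powr p * H x powr p) = ennreal (c2 * 2 powr p) * ennreal (H x powr p)"
        by (rule ennreal_mult') (use c2 in simp)
      finally show "ennreal (\<bar>convol \<eta> u x - u x\<bar> powr p) \<le> ennreal c2 * ennreal (A x powr p) + (ennreal (c2 * 2 powr p * e powr p) * indicator (ball 0 (\<rho> + 2)) x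
        + ennreal (c2 * 2 powr p) * ennreal (H x powr p))" .
    qed
    also have "\<dots> = (\<integral>\<^sup>+ x. ennreal c2 * ennreal (A x powr p) \<partial>\<mu>)
        + (\<integral>\<^sup>+ x. ennreal (c2 * 2 powr p * e powr p) * indicator (ball 0 (\<rho> + 2)) x
        + ennreal (c2 * 2 powr p) * ennreal (H x powr p) \<partial>\<mu>)"
      by (rule nn_integral_add) measurable
    also have "(\<integral>\<^sup>+ x. ennreal (c2 * 2 powr p * e powr p) * indicator (ball 0 (\<rho> + 2)) x
        + ennreal (c2 * 2 powr p) * ennreal (H x powr p) \<partial>\<mu>)
      = (\<integral>\<^sup>+ x. ennreal (c2 * 2 powr p * e powr p) * indicator (ball 0 (\<rho> + 2)) x \<partial>\<mu>)
        + (\<integral>\<^sup>+ x. ennreal (c2 * 2 powr p) * ennreal (H x powr p) \<partial>\<mu>)"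
      by (rule nn_integral_add) measurable
    also have "(\<integral>\<^sup>+ x. ennreal (c2 * 2 powr p * e powr p) * indicator (ball 0 (\<rho> + 2)) x \<partial>\<mu>) = ennreal (c2 * 2 powr p * e powr p) * ennreal M"
      unfolding M_def emeasure_ball[symmetric] by (rule nn_integral_cmult_indicator) simp
    also have "(\<integral>\<^sup>+ x. ennreal (c2 * 2 powr p) * ennreal (H x powr p) \<partial>\<mu>) = ennreal (c2 * 2 powr p) * ennreal i"
      unfolding i(1)[symmetric] H_def[symmetric] by (rule nn_integral_cmult) measurable
    also have "(\<integral>\<^sup>+ x. ennreal c2 * ennreal (A x powr p) \<partial>\<mu>) = ennreal c2 * (\<integral>\<^sup>+ x. ennreal (A x powr p) \<partial>\<mu>)"
      by (rule nn_integral_cmult) measurable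
    also have "(\<integral>\<^sup>+ x. ennreal (A x powr p) \<partial>\<mu>) \<le> ennreal (K * D) * ennreal i"
      unfolding i(1)[symmetric] A_def by (rule Lp_avg[where B="2 * B"]) (use hB r in auto)
    also have "ennreal c2 * (ennreal (K * D) * ennreal i) + (ennreal (c2 * 2 powr p * e powr p) * ennreal M
        + ennreal (c2 * 2 powr p) * ennreal i) = ennreal (c2 * (K * D * i) + (c2 * 2 powr p * e powr p * M + c2 * 2 powr p * i))"
    proof -
      have n: "0 \<le> c2 * (K * D * i)" "0 \<le> c2 * 2 powr p * e powr p * M" "0 \<le> c2 * 2 powr p * i"
        using c2 K D_pos i(2) M0 by simp_all
      have "ennreal (c2 * (K * D * i)) = ennreal c2 * (ennreal (K * D) * ennreal i)"
        using c2 K D_pos i(2) by (simp only: ennreal_mult less_imp_le mult_nonneg_nonneg)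
      moreover have "ennreal (c2 * 2 powr p * e powr p * M) = ennreal (c2 * 2 powr p * e powr p) * ennreal M"
        by (rule ennreal_mult''[OF M0])
      moreover have "ennreal (c2 * 2 powr p * i) = ennreal (c2 * 2 powr p) * ennreal i"
        by (rule ennreal_mult''[OF i(2)])
      ultimately show ?thesis using n by (simp only: ennreal_plus add_nonneg_nonneg)
    qed
    also have "c2 * (K * D * i) + (c2 * 2 powr p * e powr p * M + c2 * 2 powr p * i) = c4 * i + c2 * 2 powr p * e powr p * M"
      by (simp add: c4_def algebra_simps)
    also have "ennreal (c4 * i + c2 * 2 powr p * e powr p * M) < ennreal \<epsilon>"
      using ci eM \<epsilon> by (intro ennreal_lessI) auto
    finally show ?thesis by (simp add: add_right_mono mult_left_mono)
  qed
  show ?thesis using main d(1) by (intro exI[of _ "min d 1"]) auto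
qed

lemma mollification_converges:
  assumes C: "0 < C" and um: "u \<in> borel_measurable borel" and uB: "\<And>x. \<bar>u x\<bar> \<le> B"
    and us: "\<And>x. \<rho> \<le> norm x \<Longrightarrow> u x = 0" and fin: "En u < \<infinity>" and \<epsilon>: "0 < (\<epsilon>::real)"
  shows "\<exists>r0>0. \<forall>r \<eta>. 0 < r \<longrightarrow> r < r0 \<longrightarrow> mollifier C r \<eta> \<longrightarrow> En (\<lambda>x. convol \<eta> u x - u x) < ennreal \<epsilon>"
proof -
  define CE where "CE = (2 * C\<^sup>2 + C) powr p * K\<^sup>2 * CS"
  define c where "c = 2 powr p * (CE + 1)"
  have CE: "0 \<le> CE" using CS_pos by (simp add: CE_def)
  have c: "0 < c" using CE by (simp add: c_def)
  obtain \<delta>0 where \<delta>0: "0 < \<delta>0" "Enl \<delta>0 u < ennreal (\<epsilon> / (2 * c))"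
    using Enl_vanishes[OF um fin, of "ennreal (\<epsilon> / (2 * c))"] \<epsilon> c by (auto simp: ennreal_less_zero_iff)
  (* for r < \<delta> the widened neighbourhood of width \<delta> + 2 r stays below 3 \<delta> = \<delta>0 *)
  define \<delta> where "\<delta> = \<delta>0 / 3"
  have \<delta>: "0 < \<delta>" using \<delta>0 by (simp add: \<delta>_def)
  define a where "a = 2 powr p * (2 * CK * \<delta> powr (- (s * p)))"
  have a: "0 < a" using CK_pos \<delta> by (simp add: a_def)
  obtain r1 where r1: "r1 > 0" "\<And>r \<eta>. 0 < r \<Longrightarrow> r < r1 \<Longrightarrow> mollifier C r \<eta> \<Longrightarrow>
    (\<integral>\<^sup>+ x. ennreal (\<bar>convol \<eta> u x - u x\<bar> powr p) \<partial>\<mu>) < ennreal (\<epsilon> / (2 * a))"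
    using convol_Lp[OF C um uB us, where \<epsilon>="\<epsilon> / (2 * a)" and \<rho>=\<rho>] \<epsilon> a by auto
  have "En (\<lambda>x. convol \<eta> u x - u x) < ennreal \<epsilon>" if r: "0 < r" "r < min r1 \<delta>" and \<eta>: "mollifier C r \<eta>" for r \<eta>
  proof -
    let ?f = "\<lambda>x. convol \<eta> u x - u x"
    note [measurable] = convol_measurable[OF \<eta> um] um
    obtain i where i: "(\<integral>\<^sup>+ x. ennreal (\<bar>?f x\<bar> powr p) \<partial>\<mu>) = ennreal i" "0 \<le> i" "i < \<epsilon> / (2 * a)"
    proof -
      have I: "(\<integral>\<^sup>+ x. ennreal (\<bar>?f x\<bar> powr p) \<partial>\<mu>) < ennreal (\<epsilon> / (2 * a))" using r1(2)[OF r(1) _ \<eta>] r by simp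
      then obtain i where "(\<integral>\<^sup>+ x. ennreal (\<bar>?f x\<bar> powr p) \<partial>\<mu>) = ennreal i" "0 \<le> i"
        by (cases "\<integral>\<^sup>+ x. ennreal (\<bar>?f x\<bar> powr p) \<partial>\<mu>") auto
      with I that show thesis by (simp add: ennreal_less_iff)
    qed
    obtain l where l: "Enl \<delta>0 u = ennreal l" "0 \<le> l" "l < \<epsilon> / (2 * c)"
    proof -
      from \<delta>0(2) obtain l where "Enl \<delta>0 u = ennreal l" "0 \<le> l" by (cases "Enl \<delta>0 u") auto
      with \<delta>0(2) that show thesis by (simp add: ennreal_less_iff)
    qed
    have "Enl \<delta> ?f \<le> ennreal (2 powr p) * (Enl \<delta> (convol \<eta> u) + Enl \<delta> u)" by (rule Enl_diff) measurable
    also have "\<dots> \<le> ennreal (2 powr p) * (ennreal CE * Enl \<delta>0 u + Enl \<delta>0 u)"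
    proof (intro mult_left_mono add_mono)
      have "Enl \<delta> (convol \<eta> u) \<le> ennreal CE * Enl (\<delta> + 2 * r) u"
        unfolding CE_def by (rule convol_Enl[OF \<eta> C r(1) um uB])
      also have "\<dots> \<le> ennreal CE * Enl \<delta>0 u"
        by (intro mult_left_mono Enl_mono) (use r in \<open>auto simp: \<delta>_def\<close>)
      finally show "Enl \<delta> (convol \<eta> u) \<le> ennreal CE * Enl \<delta>0 u" .
      show "Enl \<delta> u \<le> Enl \<delta>0 u" by (rule Enl_mono) (use \<delta>0 in \<open>simp add: \<delta>_def\<close>)
    qed auto
    also have "\<dots> = ennreal (c * l)"
    proof -
      have "ennreal CE * ennreal l + ennreal l = ennreal (CE * l + l)"
        using CE l(2) by (simp add: ennreal_mult')
      then have "ennreal (2 powr p) * (ennreal CE * ennreal l + ennreal l) = ennreal (2 powr p * (CE * l + l))"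
        by (simp only: ennreal_mult'[OF powr_ge_zero])
      also have "2 powr p * (CE * l + l) = c * l" by (simp add: c_def algebra_simps)
      finally show ?thesis by (simp only: l(1))
    qed
    finally have 1: "Enl \<delta> ?f \<le> ennreal (c * l)" .
    have "En ?f \<le> Enl \<delta> ?f + ennreal a * (\<integral>\<^sup>+ x. ennreal (\<bar>?f x\<bar> powr p) \<partial>\<mu>)"
      unfolding a_def by (rule En_split[OF _ \<delta>]) measurable
    also have "\<dots> \<le> ennreal (c * l) + ennreal a * ennreal i" unfolding i(1) by (rule add_right_mono[OF 1])
    also have "\<dots> = ennreal (c * l + a * i)" using c l(2) a i(2) by (simp add: ennreal_mult')
    also have "\<dots> < ennreal \<epsilon>"
    proof (rule ennreal_lessI)
      have "c * l < \<epsilon> / 2" using l(3) c by (simp add: less_divide_eq mult.commute mult.left_commute)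
      moreover have "a * i < \<epsilon> / 2" using i(3) a by (simp add: less_divide_eq mult.commute mult.left_commute)
      ultimately show "c * l + a * i < \<epsilon>" by linarith
    qed (rule \<epsilon>)
    finally show ?thesis .
  qed
  then show ?thesis using r1(1) \<delta> by (intro exI[of _ "min r1 \<delta>"]) auto
qed

end

section \<open>Truncation and cutoff at the boundary\<close>
lemma infdist_lipschitz: "\<bar>infdist x A - infdist y A\<bar> \<le> dist x y"
  using infdist_triangle[of x A y] infdist_triangle[of y A x] by (simp add: dist_commute abs_le_iff)

definition cutoff :: "'a::euclidean_space set \<Rightarrow> real \<Rightarrow> 'a \<Rightarrow> real" where
  "cutoff A j x = max 0 (min 1 (j * infdist x A - 1))"

lemma cutoff_bounds: "0 \<le> cutoff A j x" "cutoff A j x \<le> 1"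
  by (auto simp: cutoff_def)

text \<open>
  The bound does not depend on \<open>j\<close>, although the cutoff has Lipschitz constant \<open>j\<close>: where \<open>j\<close> is large
  compared with \<open>1 / infdist y A\<close>, the cutoff equals one near \<open>y\<close>.
\<close>
lemma cutoff_diff:
  assumes j: "0 < j" and d: "0 < infdist y A"
  shows "\<bar>cutoff A j x - cutoff A j y\<bar> \<le> min 1 (norm (x - y) / (infdist y A / 4))"
proof -
  let ?n = "norm (x - y)" let ?d = "infdist y A"
  have lip: "\<bar>infdist x A - ?d\<bar> \<le> ?n" using infdist_lipschitz[of x A y] by (simp add: dist_norm)
  have one: "\<bar>cutoff A j x - cutoff A j y\<bar> \<le> 1"
    using cutoff_bounds[where A=A and j=j and x=x] cutoff_bounds[where A=A and j=j and x=y] by linarith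
  have "\<bar>cutoff A j x - cutoff A j y\<bar> \<le> 4 * ?n / ?d"
  proof (cases "j * ?d \<le> 4")
    case True
    have "\<bar>cutoff A j x - cutoff A j y\<bar> \<le> \<bar>j * infdist x A - j * ?d\<bar>"
      unfolding cutoff_def by linarith
    also have "\<dots> = j * \<bar>infdist x A - ?d\<bar>" using j by (simp add: abs_mult flip: right_diff_distrib)
    also have "\<dots> \<le> j * ?n" using j lip by simp
    also have "\<dots> \<le> 4 / ?d * ?n" using True d by (intro mult_right_mono) (auto simp: le_divide_eq)
    finally show ?thesis by simp
  next
    case False
    then have cy: "cutoff A j y = 1" by (simp add: cutoff_def)
    show ?thesis
    proof (cases "cutoff A j x = 1")
      case True
      then show ?thesis using cy d by simp
    next
      case False
      then have "j * infdist x A < 2" by (auto simp: cutoff_def max_def min_def split: if_splits)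
      moreover have "j * (?d - ?n) \<le> j * infdist x A" using lip j by (intro mult_left_mono) auto
      ultimately have "j * ?d - j * ?n < 2" by (simp add: right_diff_distrib)
      then have "j * ?d < 2 * (j * ?n)" using \<open>\<not> j * ?d \<le> 4\<close> by linarith
      then have "?d < 2 * ?n" using j by simp
      then have "1 \<le> 4 * ?n / ?d" using d by (simp add: le_divide_eq)
      then show ?thesis using one by linarith
    qed
  qed
  then show ?thesis using one d by (simp add: mult.commute)
qed

definition fat :: "real \<Rightarrow> 'a::euclidean_space set \<Rightarrow> bool" where
  "fat \<beta> \<Omega> \<longleftrightarrow> (\<forall>x\<in>frontier \<Omega>. \<forall>r>0. \<beta> * measure lebesgue (ball x r) \<le> measure lebesgue (ball x r - \<Omega>))"

context Ap_density
begin

lemma En_integrand_iterated: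
  assumes "u \<in> borel_measurable borel"
  shows "En u = (\<integral>\<^sup>+ q. ennreal (\<bar>u (fst q) - u (snd q)\<bar> powr p * kern (fst q) (snd q)) \<partial>(\<mu> \<Otimes>\<^sub>M \<mu>))"
  unfolding En_def
  by (rule nn_integral_iterated[where h="\<lambda>x y. ennreal (\<bar>u x - u y\<bar> powr p * kern x y)", OF energy_integrand_measurable(1)[OF assms]])

definition CH :: "real \<Rightarrow> real" where
  "CH \<beta> = 2 powr (- (s * p)) * (\<beta> / 2 ^ DIM('a)) powr p / K"

lemma CH_pos: "0 < \<beta> \<Longrightarrow> 0 < CH \<beta>" using K by (simp add: CH_def)

text \<open>
  A nearest point of the complement lies on the frontier, so fatness applies to the ball of radius
  \<open>d\<close> around it, which is contained in the ball of radius \<open>2 d\<close> around \<open>y\<close>. On the latter the kernel is at least of order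
  \<open>d^(-sp)\<close> divided by its mass.
\<close>
lemma complement_kernel_mass:
  assumes \<Omega>: "open \<Omega>" "\<Omega> \<noteq> UNIV" and fat: "fat \<beta> \<Omega>" and \<beta>: "0 < \<beta>" and y: "y \<in> \<Omega>"
  shows "ennreal (CH \<beta> * infdist y (- \<Omega>) powr (- (s * p))) \<le> (\<integral>\<^sup>+ x. ennreal (indicator (- \<Omega>) x * kern x y) \<partial>\<mu>)"
proof -
  define d where "d = infdist y (- \<Omega>)"
  have cl: "closed (- \<Omega>)" "- \<Omega> \<noteq> {}" using \<Omega> by auto
  have d: "0 < d" unfolding d_def using infdist_pos_not_in_closed[OF cl] y by simp
  obtain z where z: "z \<in> - \<Omega>" "d = dist y z"
    using infdist_attains_inf[OF cl, of y] unfolding d_def by metis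
  have "ball y d \<subseteq> \<Omega>"
  proof
    fix x assume "x \<in> ball y d"
    then have "dist y x < infdist y (- \<Omega>)" by (simp add: d_def)
    then show "x \<in> \<Omega>" using infdist_le[of x "- \<Omega>" y] by fastforce
  qed
  then have "closure (ball y d) \<subseteq> closure \<Omega>" by (rule closure_mono)
  then have "z \<in> closure \<Omega>" using z d by (auto simp: closure_ball)
  then have zf: "z \<in> frontier \<Omega>" using z \<Omega>(1) by (simp add: frontier_def interior_open)
  have [measurable]: "\<Omega> \<in> sets borel" using \<Omega>(1) by (rule borel_open)
  let ?E = "ball y (2 * d) - \<Omega>"
  have Eb: "?E \<in> sets borel" by (intro sets.Diff) auto
  have sub: "ball z d \<subseteq> ball y (2 * d)" using z d by (intro ball_subset_mid) (simp add: dist_commute)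
  have "\<beta> / 2 ^ DIM('a) * measure lborel (ball y (2 * d)) = \<beta> * measure lborel (ball z d)"
    using d content_ball_conv_unit_ball[of "2 * d" y] content_ball_conv_unit_ball[of d z]
    by (simp add: power_mult_distrib)
  also have "\<dots> \<le> measure lborel (ball z d - \<Omega>)"
  proof -
    have "measure lebesgue (ball z d) = measure lborel (ball z d)" by (rule measure_completion) simp
    moreover have "measure lebesgue (ball z d - \<Omega>) = measure lborel (ball z d - \<Omega>)"
      by (rule measure_completion) simp
    ultimately show ?thesis using fat zf d unfolding fat_def by metis
  qed
  also have "\<dots> \<le> measure lborel ?E"
  proof (rule measure_mono_fmeasurable)
    show "ball z d - \<Omega> \<subseteq> ?E" using sub by auto
    have "emeasure lborel ?E \<le> emeasure lborel (ball y (2 * d))" by (intro emeasure_mono) auto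
    also have "\<dots> < \<infinity>" using emeasure_lborel_ball_finite by (simp add: less_top)
    finally show "?E \<in> fmeasurable lborel" by (intro fmeasurableI) auto
  qed auto
  finally have \<theta>: "\<beta> / 2 ^ DIM('a) * measure lborel (ball y (2 * d)) \<le> measure lborel ?E" .
  have Ap: "(\<beta> / 2 ^ DIM('a)) powr p * m y (2 * d) \<le> K * measure \<mu> ?E"
    by (rule Ap_subset[OF Eb _ _ _ \<theta>]) (use d \<beta> in auto)
  have mp: "0 < m y (2 * d)" using d by (intro m_pos) simp
  let ?c = "(2 * d) powr (- (s * p)) / m y (2 * d)"
  have kl: "?c \<le> kern x y" if x: "x \<in> ?E" for x
  proof -
    have n: "0 < norm (x - y)" "norm (x - y) \<le> 2 * d" using x y by (auto simp: dist_norm norm_minus_commute)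
    have "(2 * d) powr (- (s * p)) \<le> norm (x - y) powr (- (s * p))"
      using n p s by (intro powr_mono2') auto
    moreover have "measure \<mu> (mid_ball x y) \<le> m y (2 * d)"
      unfolding mid_ball_m
    proof (intro m_mono ball_subset_mid)
      have "dist ((1/2) *\<^sub>R (x + y)) y = norm (x - y) / 2"
        using dist_mid[of y x] by (simp add: dist_commute add.commute norm_minus_commute)
      then show "dist ((1/2) *\<^sub>R (x + y)) y + norm (x - y) / 2 \<le> 2 * d" using n by simp
    qed
    moreover have "0 < measure \<mu> (mid_ball x y)" unfolding mid_ball_m using n by (intro m_pos) simp
    ultimately show ?thesis unfolding kern_def by (intro frac_le) auto
  qed
  have fE: "emeasure \<mu> ?E = ennreal (measure \<mu> ?E)"
  proof (rule emeasure_eq_ennreal_measure)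
    have "emeasure \<mu> ?E \<le> emeasure \<mu> (ball y (2 * d))" by (intro emeasure_mono) auto
    then show "emeasure \<mu> ?E \<noteq> top" unfolding emeasure_ball by (auto simp: top_unique)
  qed
  have "CH \<beta> * d powr (- (s * p)) \<le> ?c * measure \<mu> ?E"
  proof -
    have "CH \<beta> * d powr (- (s * p)) = (2 * d) powr (- (s * p)) / m y (2 * d) * ((\<beta> / 2 ^ DIM('a)) powr p * m y (2 * d) / K)"
      using mp by (simp add: CH_def powr_mult mult_ac)
    also have "\<dots> \<le> ?c * measure \<mu> ?E"
      using Ap K m_nonneg by (intro mult_left_mono) (auto simp: divide_le_eq mult.commute)
    finally show ?thesis .
  qed
  then have "ennreal (CH \<beta> * d powr (- (s * p))) \<le> ennreal (?c * measure \<mu> ?E)" by (rule ennreal_leI)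
  also have "\<dots> = ennreal ?c * emeasure \<mu> ?E" unfolding fE by (rule ennreal_mult'') simp
  also have "\<dots> = (\<integral>\<^sup>+ x. ennreal ?c * indicator ?E x \<partial>\<mu>)"
    by (rule nn_integral_cmult_indicator[symmetric]) (use Eb in simp)
  also have "\<dots> \<le> (\<integral>\<^sup>+ x. ennreal (indicator (- \<Omega>) x * kern x y) \<partial>\<mu>)"
  proof (rule nn_integral_mono)
    fix x
    show "ennreal ?c * indicator ?E x \<le> ennreal (indicator (- \<Omega>) x * kern x y)"
      using ennreal_leI[OF kl[of x]] by (cases "x \<in> ?E") auto
  qed
  finally show ?thesis by (simp add: d_def)
qed

text \<open>
  The energy contains the pairs with one point outside \<open>\<Omega>\<close>, where \<open>v\<close> vanishes; these alone give
  the inequality.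
\<close>
lemma hardy:
  assumes \<Omega>: "open \<Omega>" "\<Omega> \<noteq> UNIV" and fat: "fat \<beta> \<Omega>" and \<beta>: "0 < \<beta>"
    and [measurable]: "v \<in> borel_measurable borel" and v0: "\<And>x. x \<notin> \<Omega> \<Longrightarrow> v x = 0"
  shows "ennreal (CH \<beta>) * (\<integral>\<^sup>+ y. ennreal (indicator \<Omega> y * (\<bar>v y\<bar> powr p * infdist y (- \<Omega>) powr (- (s * p)))) \<partial>\<mu>) \<le> En v"
proof -
  have [measurable]: "\<Omega> \<in> sets borel" using \<Omega>(1) by (rule borel_open)
  have [measurable]: "(\<lambda>y. infdist y (- \<Omega>)) \<in> borel_measurable borel"
    by (intro borel_measurable_continuous_onI continuous_intros)
  have "ennreal (CH \<beta>) * (\<integral>\<^sup>+ y. ennreal (indicator \<Omega> y * (\<bar>v y\<bar> powr p * infdist y (- \<Omega>) powr (- (s * p)))) \<partial>\<mu>)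
    = (\<integral>\<^sup>+ y. ennreal (CH \<beta>) * ennreal (indicator \<Omega> y * (\<bar>v y\<bar> powr p * infdist y (- \<Omega>) powr (- (s * p)))) \<partial>\<mu>)"
    by (rule nn_integral_cmult[symmetric]) measurable
  also have "\<dots> \<le> En v" unfolding En_def
  proof (rule nn_integral_mono)
    fix y
    show "ennreal (CH \<beta>) * ennreal (indicator \<Omega> y * (\<bar>v y\<bar> powr p * infdist y (- \<Omega>) powr (- (s * p))))
      \<le> (\<integral>\<^sup>+ x. ennreal (\<bar>v x - v y\<bar> powr p * kern x y) \<partial>\<mu>)"
    proof (cases "y \<in> \<Omega>")
      case True
      have "ennreal (CH \<beta>) * ennreal (indicator \<Omega> y * (\<bar>v y\<bar> powr p * infdist y (- \<Omega>) powr (- (s * p))))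
        = ennreal (\<bar>v y\<bar> powr p * (CH \<beta> * infdist y (- \<Omega>) powr (- (s * p))))"
        using True CH_pos[OF \<beta>] by (simp add: mult_ac flip: ennreal_mult')
      also have "\<dots> = ennreal (\<bar>v y\<bar> powr p) * ennreal (CH \<beta> * infdist y (- \<Omega>) powr (- (s * p)))"
        by (rule ennreal_mult'[OF powr_ge_zero])
      also have "\<dots> \<le> ennreal (\<bar>v y\<bar> powr p) * (\<integral>\<^sup>+ x. ennreal (indicator (- \<Omega>) x * kern x y) \<partial>\<mu>)"
        by (intro mult_left_mono complement_kernel_mass[OF \<Omega> fat \<beta> True]) simp
      also have "\<dots> = (\<integral>\<^sup>+ x. ennreal (\<bar>v y\<bar> powr p) * ennreal (indicator (- \<Omega>) x * kern x y) \<partial>\<mu>)"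
        by (rule nn_integral_cmult[symmetric]) measurable
      also have "\<dots> \<le> (\<integral>\<^sup>+ x. ennreal (\<bar>v x - v y\<bar> powr p * kern x y) \<partial>\<mu>)"
      proof (rule nn_integral_mono)
        fix x
        show "ennreal (\<bar>v y\<bar> powr p) * ennreal (indicator (- \<Omega>) x * kern x y) \<le> ennreal (\<bar>v x - v y\<bar> powr p * kern x y)"
          using v0[of x] by (cases "x \<in> \<Omega>") (simp_all add: ennreal_mult'[OF powr_ge_zero])
      qed
      finally show ?thesis .
    qed simp
  qed
  finally show ?thesis .
qed

text \<open>
  Truncation does not increase differences of \<open>v\<close>, and the product rule leaves the error term
  \<open>|v y| |\<eta> x - \<eta> y|\<close>. By the preceding bound for cutoffs and the Hardy inequality its contribution has a majorant
  independent of \<open>j\<close>.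
\<close>
lemma cutoff_approx:
  assumes \<Omega>: "open \<Omega>" "\<Omega> \<noteq> UNIV" and fat: "fat \<beta> \<Omega>" and \<beta>: "0 < \<beta>"
    and vm: "v \<in> borel_measurable borel" and v0: "\<And>x. x \<notin> \<Omega> \<Longrightarrow> v x = 0"
    and fin: "En v < \<infinity>" and \<epsilon>: "0 < (\<epsilon>::ennreal)"
  shows "\<exists>u B e. u \<in> borel_measurable borel \<and> (\<forall>x. \<bar>u x\<bar> \<le> B) \<and> 0 < e \<and>
    (\<forall>x. infdist x (- \<Omega>) < e \<longrightarrow> u x = 0) \<and> En (\<lambda>x. u x - v x) < \<epsilon>"
proof -
  note [measurable] = vm
  let ?d = "\<lambda>y. infdist y (- \<Omega>)"
  let ?N = "\<mu> \<Otimes>\<^sub>M \<mu>"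
  have [measurable]: "\<Omega> \<in> sets borel" using \<Omega>(1) by (rule borel_open)
  have dm [measurable]: "?d \<in> borel_measurable borel"
    by (intro borel_measurable_continuous_onI continuous_intros)
  have cl: "closed (- \<Omega>)" "- \<Omega> \<noteq> {}" using \<Omega> by auto
  have dpos: "0 < ?d y" if "y \<in> \<Omega>" for y using infdist_pos_not_in_closed[OF cl] that by simp
  have d0: "?d y = 0" if "y \<notin> \<Omega>" for y using that by simp
  define T where "T j t = max (- j) (min j t)" for j t :: real
  define u where "u i x = cutoff (- \<Omega>) (real (Suc i)) x * T (real (Suc i)) (v x)" for i x
  have T: "\<bar>T j a - T j b\<bar> \<le> \<bar>a - b\<bar>" "\<bar>T j a\<bar> \<le> \<bar>a\<bar>" "\<bar>T j a\<bar> \<le> j" "T j 0 = 0" if "0 < j" for j a b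
    using that by (auto simp: T_def max_def min_def)
  have [measurable]: "u i \<in> borel_measurable borel" for i unfolding u_def cutoff_def T_def by measurable
  have uB: "\<bar>u i x\<bar> \<le> real (Suc i)" for i x
  proof -
    have "\<bar>cutoff (- \<Omega>) (real (Suc i)) x\<bar> * \<bar>T (real (Suc i)) (v x)\<bar> \<le> 1 * real (Suc i)"
      using cutoff_bounds[of "- \<Omega>" "real (Suc i)" x] by (intro mult_mono T(3)) auto
    then show ?thesis by (simp add: u_def abs_mult)
  qed
  have us: "u i x = 0" if "?d x < 1 / real (Suc i)" for i x
  proof -
    have "real (Suc i) * ?d x \<le> 1" using that by (simp add: less_divide_eq mult.commute)
    then have "cutoff (- \<Omega>) (real (Suc i)) x = 0" unfolding cutoff_def by linarith
    then show ?thesis by (simp add: u_def)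
  qed
  let ?mn = "\<lambda>x y. min 1 (norm (x - y) / (?d y / 4))"
  let ?P = "2 powr p"
  define A where "A x y = \<bar>v x - v y\<bar> powr p" for x y
  define Bt where "Bt x y = indicator \<Omega> y * \<bar>v y\<bar> powr p * ?mn x y powr p" for x y
  have AB0: "0 \<le> A x y" "0 \<le> Bt x y" for x y by (simp_all add: A_def Bt_def)
  have ud: "\<bar>u i x - u i y\<bar> powr p \<le> ?P * (A x y + Bt x y)" for i x y
  proof (cases "y \<in> \<Omega>")
    case True
    let ?j = "real (Suc i)"
    let ?\<eta> = "cutoff (- \<Omega>) ?j"
    have "u i x - u i y = ?\<eta> x * (T ?j (v x) - T ?j (v y)) + T ?j (v y) * (?\<eta> x - ?\<eta> y)"
      by (simp add: u_def algebra_simps)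
    then have "\<bar>u i x - u i y\<bar> \<le> \<bar>?\<eta> x\<bar> * \<bar>T ?j (v x) - T ?j (v y)\<bar> + \<bar>T ?j (v y)\<bar> * \<bar>?\<eta> x - ?\<eta> y\<bar>"
      by (metis abs_mult abs_triangle_ineq)
    also have "\<dots> \<le> 1 * \<bar>v x - v y\<bar> + \<bar>v y\<bar> * ?mn x y"
      using cutoff_bounds[of "- \<Omega>" ?j x] by (intro add_mono mult_mono T cutoff_diff dpos True) auto
    finally have "\<bar>u i x - u i y\<bar> powr p \<le> (\<bar>v x - v y\<bar> + \<bar>v y\<bar> * ?mn x y) powr p"
      using p by (intro powr_mono2) auto
    also have "\<dots> \<le> ?P * (\<bar>v x - v y\<bar> powr p + (\<bar>v y\<bar> * ?mn x y) powr p)"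
      using p dpos[OF True] by (intro powr_add_le) auto
    also have "(\<bar>v y\<bar> * ?mn x y) powr p = \<bar>v y\<bar> powr p * ?mn x y powr p" by (rule powr_mult)
    finally show ?thesis using True by (simp add: A_def Bt_def)
  next
    case False
    let ?j = "real (Suc i)"
    have "\<bar>u i x\<bar> \<le> 1 * \<bar>v x\<bar>" unfolding u_def abs_mult
      using cutoff_bounds[of "- \<Omega>" ?j x] by (intro mult_mono T) auto
    then have "\<bar>u i x - u i y\<bar> powr p \<le> \<bar>v x - v y\<bar> powr p"
      using v0[OF False] T(4)[of ?j] p by (intro powr_mono2) (auto simp: u_def)
    also have "\<dots> \<le> ?P * \<bar>v x - v y\<bar> powr p"
      using p ge_one_powr_ge_zero[of 2 p] by (simp add: mult_le_cancel_right1)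
    finally show ?thesis using False by (simp add: A_def Bt_def)
  qed
  let ?F = "\<lambda>i q. ennreal (\<bar>(u i (fst q) - v (fst q)) - (u i (snd q) - v (snd q))\<bar> powr p * kern (fst q) (snd q))"
  let ?w = "\<lambda>q. ennreal (2 * ?P * ?P) * ennreal (A (fst q) (snd q) * kern (fst q) (snd q)) + ennreal (?P * ?P) * ennreal (Bt (fst q) (snd q) * kern (fst q) (snd q))"
  have Am [measurable]: "(\<lambda>q. ennreal (A (fst q) (snd q) * kern (fst q) (snd q))) \<in> borel_measurable ?N"
    unfolding A_def by measurable
  have Bm [measurable]: "(\<lambda>q. ennreal (Bt (fst q) (snd q) * kern (fst q) (snd q))) \<in> borel_measurable ?N"
    unfolding Bt_def by measurable
  have AI: "(\<integral>\<^sup>+ q. ennreal (A (fst q) (snd q) * kern (fst q) (snd q)) \<partial>?N) = En v"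
    unfolding A_def by (rule En_integrand_iterated[OF vm, symmetric])
  let ?H = "\<integral>\<^sup>+ y. ennreal (indicator \<Omega> y * (\<bar>v y\<bar> powr p * ?d y powr (- (s * p)))) \<partial>\<mu>"
  have HI: "?H < \<infinity>"
  proof -
    have "ennreal (CH \<beta>) * ?H < \<infinity>" using hardy[OF \<Omega> fat \<beta> vm v0] fin by (rule le_less_trans)
    then show ?thesis using CH_pos[OF \<beta>] by (auto simp: ennreal_mult_less_top)
  qed
  have "(\<integral>\<^sup>+ q. ennreal (Bt (fst q) (snd q) * kern (fst q) (snd q)) \<partial>?N) = (\<integral>\<^sup>+ y. \<integral>\<^sup>+ x. ennreal (Bt x y * kern x y) \<partial>\<mu> \<partial>\<mu>)"
    by (rule nn_integral_iterated[symmetric, OF Bm])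
  also have "\<dots> \<le> (\<integral>\<^sup>+ y. ennreal (CK * 4 powr (s * p)) * ennreal (indicator \<Omega> y * (\<bar>v y\<bar> powr p * ?d y powr (- (s * p)))) \<partial>\<mu>)"
  proof (rule nn_integral_mono)
    fix y
    show "(\<integral>\<^sup>+ x. ennreal (Bt x y * kern x y) \<partial>\<mu>) \<le> ennreal (CK * 4 powr (s * p)) * ennreal (indicator \<Omega> y * (\<bar>v y\<bar> powr p * ?d y powr (- (s * p))))"
    proof (cases "y \<in> \<Omega>")
      case True
      have t: "0 < ?d y / 4" using dpos[OF True] by simp
      have "(\<integral>\<^sup>+ x. ennreal (Bt x y * kern x y) \<partial>\<mu>) = (\<integral>\<^sup>+ x. ennreal (\<bar>v y\<bar> powr p) * ennreal (min 1 (norm (y - x) / (?d y / 4)) powr p * kern y x) \<partial>\<mu>)"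
      proof (rule nn_integral_cong)
        fix x
        have "Bt x y * kern x y = \<bar>v y\<bar> powr p * (min 1 (norm (y - x) / (?d y / 4)) powr p * kern y x)"
          using True by (simp only: Bt_def kern_commute[of x y] norm_minus_commute[of x y] indicator_simps mult_1_left mult.assoc)
        then show "ennreal (Bt x y * kern x y) = ennreal (\<bar>v y\<bar> powr p) * ennreal (min 1 (norm (y - x) / (?d y / 4)) powr p * kern y x)"
          by (simp only: ennreal_mult'[OF powr_ge_zero])
      qed
      also have "\<dots> = ennreal (\<bar>v y\<bar> powr p) * (\<integral>\<^sup>+ x. ennreal (min 1 (norm (y - x) / (?d y / 4)) powr p * kern y x) \<partial>\<mu>)"
        by (rule nn_integral_cmult) measurable
      also have "\<dots> \<le> ennreal (\<bar>v y\<bar> powr p) * ennreal (CK * (?d y / 4) powr (- (s * p)))"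
        by (intro mult_left_mono min_kern_integral t) simp
      also have "\<dots> = ennreal (\<bar>v y\<bar> powr p * (CK * (?d y / 4) powr (- (s * p))))"
        by (rule ennreal_mult'[OF powr_ge_zero, symmetric])
      also have "\<bar>v y\<bar> powr p * (CK * (?d y / 4) powr (- (s * p))) = (CK * 4 powr (s * p)) * (indicator \<Omega> y * (\<bar>v y\<bar> powr p * ?d y powr (- (s * p))))"
        using True by (simp add: powr_divide powr_minus_divide)
      also have "ennreal \<dots> = ennreal (CK * 4 powr (s * p)) * ennreal (indicator \<Omega> y * (\<bar>v y\<bar> powr p * ?d y powr (- (s * p))))"
        by (rule ennreal_mult') (use CK_pos in simp)
      finally show ?thesis .
    qed (simp add: Bt_def)
  qed
  also have "\<dots> = ennreal (CK * 4 powr (s * p)) * ?H" by (rule nn_integral_cmult) measurable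
  also have "\<dots> < \<infinity>" using HI by (simp add: ennreal_mult_less_top)
  finally have BI: "(\<integral>\<^sup>+ q. ennreal (Bt (fst q) (snd q) * kern (fst q) (snd q)) \<partial>?N) < \<infinity>" .
  have "(\<lambda>i. \<integral>\<^sup>+ q. ?F i q \<partial>?N) \<longlonglongrightarrow> (\<integral>\<^sup>+ q. 0 \<partial>?N)"
  proof (rule nn_integral_dominated_convergence[where w="?w"])
    show "?F i \<in> borel_measurable ?N" for i by measurable
    show "?w \<in> borel_measurable ?N" by measurable
    show "AE q in ?N. ?F i q \<le> ?w q" for i
    proof (rule AE_I2)
      fix q :: "'a \<times> 'a"
      let ?x = "fst q" let ?y = "snd q"
      have P1: "1 \<le> ?P" using p by (intro ge_one_powr_ge_zero) auto
      have "\<bar>(u i ?x - v ?x) - (u i ?y - v ?y)\<bar> powr p \<le> ?P * (\<bar>u i ?x - u i ?y\<bar> powr p + A ?x ?y)"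
        unfolding A_def by (rule diff_powr_le)
      also have "\<dots> \<le> ?P * (?P * (A ?x ?y + Bt ?x ?y) + ?P * A ?x ?y)"
        using ud[of i ?x ?y] AB0[of ?x ?y] P1 by (intro mult_left_mono add_mono) (auto simp: mult_le_cancel_right1)
      finally have "\<bar>(u i ?x - v ?x) - (u i ?y - v ?y)\<bar> powr p \<le> 2 * ?P * ?P * A ?x ?y + ?P * ?P * Bt ?x ?y"
        by (simp add: algebra_simps)
      from mult_right_mono[OF this kern_nonneg[of ?x ?y]]
      have "?F i q \<le> ennreal (2 * ?P * ?P * (A ?x ?y * kern ?x ?y) + ?P * ?P * (Bt ?x ?y * kern ?x ?y))"
        by (intro ennreal_leI) (simp only: distrib_right mult.assoc)
      also have "\<dots> = ennreal (2 * ?P * ?P * (A ?x ?y * kern ?x ?y)) + ennreal (?P * ?P * (Bt ?x ?y * kern ?x ?y))"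
        using AB0[of ?x ?y] kern_nonneg[of ?x ?y] by (intro ennreal_plus) auto
      also have "ennreal (2 * ?P * ?P * (A ?x ?y * kern ?x ?y)) = ennreal (2 * ?P * ?P) * ennreal (A ?x ?y * kern ?x ?y)"
        by (rule ennreal_mult') simp
      also have "ennreal (?P * ?P * (Bt ?x ?y * kern ?x ?y)) = ennreal (?P * ?P) * ennreal (Bt ?x ?y * kern ?x ?y)"
        by (rule ennreal_mult') simp
      finally show "?F i q \<le> ?w q" .
    qed
    have "(\<integral>\<^sup>+ q. ?w q \<partial>?N) = (\<integral>\<^sup>+ q. ennreal (2 * ?P * ?P) * ennreal (A (fst q) (snd q) * kern (fst q) (snd q)) \<partial>?N)
       + (\<integral>\<^sup>+ q. ennreal (?P * ?P) * ennreal (Bt (fst q) (snd q) * kern (fst q) (snd q)) \<partial>?N)"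
      by (rule nn_integral_add) measurable
    also have "(\<integral>\<^sup>+ q. ennreal (2 * ?P * ?P) * ennreal (A (fst q) (snd q) * kern (fst q) (snd q)) \<partial>?N) = ennreal (2 * ?P * ?P) * En v"
      unfolding AI[symmetric] by (rule nn_integral_cmult) measurable
    also have "(\<integral>\<^sup>+ q. ennreal (?P * ?P) * ennreal (Bt (fst q) (snd q) * kern (fst q) (snd q)) \<partial>?N) =
      ennreal (?P * ?P) * (\<integral>\<^sup>+ q. ennreal (Bt (fst q) (snd q) * kern (fst q) (snd q)) \<partial>?N)"
      by (rule nn_integral_cmult) measurable
    also have "ennreal (2 * ?P * ?P) * En v + \<dots> < \<infinity>" using fin BI by (simp add: ennreal_mult_less_top)
    finally show "(\<integral>\<^sup>+ q. ?w q \<partial>?N) < \<infinity>" .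
    have lim: "(\<lambda>i. u i x) \<longlonglongrightarrow> v x" for x
    proof (cases "x \<in> \<Omega>")
      case True
      (* from this index on, truncation leaves v x unchanged and the cutoff equals one at x *)
      obtain i0 where i0: "\<bar>v x\<bar> + 2 / ?d x \<le> real i0" using real_arch_simple by blast
      have "u i x = v x" if i: "i0 \<le> i" for i
      proof -
        have n: "0 \<le> 2 / ?d x" using dpos[OF True] by simp
        have big: "\<bar>v x\<bar> \<le> real (Suc i)" "2 / ?d x \<le> real (Suc i)" using i0 i n by linarith+
        then have "2 \<le> real (Suc i) * ?d x" using dpos[OF True] by (simp add: divide_le_eq)
        then have "cutoff (- \<Omega>) (real (Suc i)) x = 1" unfolding cutoff_def by linarith
        moreover have "T (real (Suc i)) (v x) = v x" using big(1) by (simp add: T_def)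
        ultimately show ?thesis by (simp add: u_def)
      qed
      then have "\<forall>\<^sub>F i in sequentially. u i x = v x" unfolding eventually_sequentially by blast
      then show ?thesis by (rule tendsto_eventually)
    next
      case False
      then show ?thesis using us d0[OF False] v0[OF False] by simp
    qed
    show "AE q in ?N. (\<lambda>i. ?F i q) \<longlonglongrightarrow> 0"
    proof (rule AE_I2)
      fix q
      have "(\<lambda>i. \<bar>(u i (fst q) - v (fst q)) - (u i (snd q) - v (snd q))\<bar>) \<longlonglongrightarrow> \<bar>(v (fst q) - v (fst q)) - (v (snd q) - v (snd q))\<bar>"
        by (intro tendsto_intros lim)
      then have "(\<lambda>i. \<bar>(u i (fst q) - v (fst q)) - (u i (snd q) - v (snd q))\<bar> powr p) \<longlonglongrightarrow> 0 powr p"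
        using p by (intro tendsto_powr2) (auto intro!: always_eventually)
      then have "(\<lambda>i. \<bar>(u i (fst q) - v (fst q)) - (u i (snd q) - v (snd q))\<bar> powr p * kern (fst q) (snd q)) \<longlonglongrightarrow> 0 powr p * kern (fst q) (snd q)"
        by (rule tendsto_mult_right)
      then have "(\<lambda>i. ?F i q) \<longlonglongrightarrow> ennreal (0 powr p * kern (fst q) (snd q))" by (rule tendsto_ennrealI)
      then show "(\<lambda>i. ?F i q) \<longlonglongrightarrow> 0" by simp
    qed
  qed simp
  then have "\<forall>\<^sub>F i in sequentially. (\<integral>\<^sup>+ q. ?F i q \<partial>?N) < \<epsilon>"
    using \<epsilon> by (intro order_tendstoD(2)) simp_all
  then obtain i where "(\<integral>\<^sup>+ q. ?F i q \<partial>?N) < \<epsilon>"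
    using eventually_happens'[OF sequentially_bot] by blast
  moreover have "En (\<lambda>x. u i x - v x) = (\<integral>\<^sup>+ q. ?F i q \<partial>?N)"
    by (rule En_integrand_iterated) measurable
  ultimately have "En (\<lambda>x. u i x - v x) < \<epsilon>" by simp
  moreover have "u i \<in> borel_measurable borel" by measurable
  ultimately show ?thesis using uB us
    by (intro exI[of _ "u i"] exI[of _ "real (Suc i)"] exI[of _ "1 / real (Suc i)"]) auto
qed

text \<open>
  Such a function satisfies \<open>|f x - f y| \<le> c min 1 |x - y|\<close>, and the difference vanishes unless one of the points lies in
  the support.
\<close>
lemma En_finite_of_lipschitz:
  assumes [measurable]: "f \<in> borel_measurable borel"
    and L: "\<And>x y. \<bar>f x - f y\<bar> \<le> L * norm (x - y)" and B: "\<And>x. \<bar>f x\<bar> \<le> B" and f0: "\<And>x. \<rho> \<le> norm x \<Longrightarrow> f x = 0"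
  shows "En f < \<infinity>"
proof -
  define c where "c = max L (2 * B)"
  let ?k = "\<lambda>x y. min 1 (norm (x - y) / 1) powr p * kern x y"
  let ?\<theta> = "indicator (ball (0::'a) \<rho>) :: 'a \<Rightarrow> ennreal"
  let ?Q = "\<lambda>x y. (?\<theta> x + ?\<theta> y) * ennreal (?k x y)"
  have [measurable]: "?\<theta> \<in> borel_measurable borel" by (rule borel_measurable_indicator) simp
  have le: "ennreal (\<bar>f x - f y\<bar> powr p * kern x y) \<le> ennreal (c powr p) * ?Q x y" for x y
  proof (cases "norm x < \<rho> \<or> norm y < \<rho>")
    case True
    have "\<bar>f x - f y\<bar> \<le> c * min 1 (norm (x - y) / 1)"
    proof (cases "norm (x - y) \<le> 1")
      case True
      have "L * norm (x - y) \<le> c * norm (x - y)" by (intro mult_right_mono) (auto simp: c_def)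
      then show ?thesis using L[of x y] True by simp
    next
      case False
      have "\<bar>f x - f y\<bar> \<le> c" using B[of x] B[of y] by (simp add: c_def)
      then show ?thesis using False by simp
    qed
    then have "\<bar>f x - f y\<bar> powr p \<le> (c * min 1 (norm (x - y) / 1)) powr p" using p by (intro powr_mono2) auto
    also have "\<dots> = c powr p * min 1 (norm (x - y) / 1) powr p" by (rule powr_mult)
    finally have "\<bar>f x - f y\<bar> powr p * kern x y \<le> c powr p * min 1 (norm (x - y) / 1) powr p * kern x y"
      by (rule mult_right_mono) (rule kern_nonneg)
    then have "ennreal (\<bar>f x - f y\<bar> powr p * kern x y) \<le> ennreal (c powr p * ?k x y)"
      by (intro ennreal_leI) (simp only: mult.assoc)
    also have "\<dots> = ennreal (c powr p) * (1 * ennreal (?k x y))" by (simp only: ennreal_mult'[OF powr_ge_zero] mult_1_left)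
    also have "1 \<le> ?\<theta> x + ?\<theta> y" using True by (auto simp: add_increasing add_increasing2)
    finally show ?thesis by (simp only: mult_left_mono mult_right_mono zero_le)
  next
    case False
    then show ?thesis using f0[of x] f0[of y] by simp
  qed
  have [measurable]: "(\<lambda>y. \<integral>\<^sup>+ x. ?Q x y \<partial>\<mu>) \<in> borel_measurable borel" by measurable
  have "En f \<le> ennreal (c powr p) * (\<integral>\<^sup>+ y. \<integral>\<^sup>+ x. ?Q x y \<partial>\<mu> \<partial>\<mu>)"
    unfolding En_def by (intro nn_integral_le_cmult le) measurable
  also have "\<dots> \<le> ennreal (c powr p) * (ennreal (2 * CK * 1 powr (- (s * p))) * (\<integral>\<^sup>+ x. ?\<theta> x \<partial>\<mu>))"
    by (intro mult_left_mono kernel_mass) auto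
  also have "\<dots> < \<infinity>" by (simp add: emeasure_ball ennreal_mult_less_top)
  finally show ?thesis .
qed

text \<open>
  The truncated and cut-off function \<open>u\<close> stays away from the complement, so its mollification at a sufficiently
  small scale has compact support in \<open>\<Omega>\<close>.
\<close>
lemma smooth_approx:
  assumes \<Omega>: "open \<Omega>" "bounded \<Omega>" and fat: "fat \<beta> \<Omega>" and \<beta>: "0 < \<beta>"
    and vm: "v \<in> borel_measurable borel" and v0: "\<And>x. x \<notin> \<Omega> \<Longrightarrow> v x = 0"
    and fin: "En v < \<infinity>" and \<epsilon>: "0 < (\<epsilon>::real)"
  shows "\<exists>\<phi>\<in>Cc_infty \<Omega>. En (\<lambda>x. v x - \<phi> x) < ennreal \<epsilon>"
proof -
  have nU: "\<Omega> \<noteq> UNIV" using \<Omega>(2) not_bounded_UNIV by blast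
  let ?e = "\<epsilon> / (2 * 2 powr p)"
  have e0: "0 < ?e" using \<epsilon> by simp
  obtain u B e where um: "u \<in> borel_measurable borel" and uB: "\<And>x. \<bar>u x\<bar> \<le> B" and e: "0 < e"
    and us: "\<And>x. infdist x (- \<Omega>) < e \<Longrightarrow> u x = 0" and uv: "En (\<lambda>x. u x - v x) < ennreal ?e"
    using cutoff_approx[OF \<Omega>(1) nU fat \<beta> vm v0 fin, of "ennreal ?e"] e0 by (auto simp: ennreal_less_zero_iff)
  note [measurable] = um vm
  have u\<Omega>: "x \<in> \<Omega>" if "u x \<noteq> 0" for x
  proof (rule ccontr)
    assume "x \<notin> \<Omega>"
    then have "infdist x (- \<Omega>) = 0" by simp
    then show False using us[of x] e that by simp
  qed
  obtain \<rho> where \<rho>: "\<Omega> \<subseteq> ball 0 \<rho>" using \<Omega>(2) bounded_subset_ballD by blast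
  have u\<rho>: "u x = 0" if "\<rho> \<le> norm x" for x using u\<Omega>[of x] \<rho> that by force
  have ufin: "En u < \<infinity>"
  proof -
    have "En (\<lambda>x. (u x - v x) - (- v x)) \<le> ennreal (2 powr p) * (En (\<lambda>x. u x - v x) + En (\<lambda>x. - v x))"
      by (rule En_diff) measurable
    also have "En (\<lambda>x. - v x) = En v" unfolding En_def by (simp add: abs_minus_commute)
    also have "ennreal (2 powr p) * (En (\<lambda>x. u x - v x) + En v) < \<infinity>"
      using uv fin by (auto simp: ennreal_mult_less_top intro: less_trans)
    finally show ?thesis by simp
  qed
  obtain C where C: "0 < C" "\<And>r. 0 < r \<Longrightarrow> \<exists>\<eta>::'a \<Rightarrow> real. mollifier C r \<eta>"
    using mollifier_exists by blast
  obtain r0 where r0: "0 < r0" "\<And>r \<eta>. 0 < r \<Longrightarrow> r < r0 \<Longrightarrow> mollifier C r \<eta> \<Longrightarrow> En (\<lambda>x. convol \<eta> u x - u x) < ennreal ?e"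
    using mollification_converges[OF C(1) um uB u\<rho> ufin e0, where \<rho>=\<rho>] by auto
  (* r < e keeps the support of the mollified function at distance at least e / 2 from the complement *)
  define r where "r = min r0 e / 2"
  have r: "0 < r" "r < r0" "r < e" using r0 e by (auto simp: r_def)
  obtain \<eta> :: "'a \<Rightarrow> real" where \<eta>: "mollifier C r \<eta>" using C(2)[OF r(1)] by blast
  let ?\<phi> = "convol \<eta> u"
  have supp: "e / 2 \<le> infdist x (- \<Omega>)" if "?\<phi> x \<noteq> 0" for x
  proof (rule ccontr)
    assume far: "\<not> e / 2 \<le> infdist x (- \<Omega>)"
    have H: "\<eta> (x - z) * u z = 0" for z
    proof (cases "r / 2 \<le> norm (x - z)")
      case True
      then have "\<eta> (x - z) = 0" using \<eta> unfolding mollifier_def by blast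
      then show ?thesis by simp
    next
      case False
      have "infdist z (- \<Omega>) \<le> infdist x (- \<Omega>) + norm (x - z)"
        using infdist_lipschitz[of x "- \<Omega>" z] by (simp add: dist_norm)
      then have "infdist z (- \<Omega>) < e" using False far r by linarith
      then show ?thesis using us by simp
    qed
    have "?\<phi> x = 0" unfolding convol_def H by simp
    then show False using that by blast
  qed
  let ?S = "{x. e / 2 \<le> infdist x (- \<Omega>)}"
  have Scl: "closed ?S" by (intro closed_Collect_le continuous_intros)
  have S\<Omega>: "?S \<subseteq> \<Omega>"
  proof
    fix x assume "x \<in> ?S"
    then show "x \<in> \<Omega>" using e by (cases "x \<in> \<Omega>") auto
  qed
  have sub: "closure {x. ?\<phi> x \<noteq> 0} \<subseteq> ?S" using supp Scl by (intro closure_minimal) auto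
  have "\<forall>k. Ck k ?\<phi>"
  proof
    fix k
    have "integrable lborel u"
      by (rule bounded_support_integrable[OF um uB _ \<Omega>(2)]) (use u\<Omega> in blast)
    moreover have "\<And>k. Ck k \<eta>" using \<eta> unfolding mollifier_def by blast
    moreover have "\<And>x. r / 2 < norm x \<Longrightarrow> \<eta> x = 0" using \<eta> unfolding mollifier_def by (meson less_imp_le)
    ultimately show "Ck k ?\<phi>" by (intro convol_Ck[where R="r / 2"])
  qed
  moreover have "compact (closure {x. ?\<phi> x \<noteq> 0})"
    using sub S\<Omega> \<Omega>(2) by (intro compact_eq_bounded_closed[THEN iffD2] conjI closed_closure) (meson bounded_subset order_trans)
  ultimately have \<phi>: "?\<phi> \<in> Cc_infty \<Omega>" unfolding Cc_infty_def using sub S\<Omega> by blast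
  note [measurable] = convol_measurable[OF \<eta> um]
  have "En (\<lambda>x. v x - ?\<phi> x) = En (\<lambda>x. (?\<phi> x - u x) - (v x - u x))"
    unfolding En_def by (intro nn_integral_cong arg_cong[where f=ennreal] arg_cong2[where f="(*)"] arg_cong2[where f="(powr)"]) linarith+
  also have "\<dots> \<le> ennreal (2 powr p) * (En (\<lambda>x. ?\<phi> x - u x) + En (\<lambda>x. v x - u x))"
    by (rule En_diff) measurable
  also have "En (\<lambda>x. v x - u x) = En (\<lambda>x. u x - v x)"
    unfolding En_def by (intro nn_integral_cong arg_cong[where f=ennreal] arg_cong2[where f="(*)"] arg_cong2[where f="(powr)"]) linarith+
  also have "ennreal (2 powr p) * (En (\<lambda>x. ?\<phi> x - u x) + En (\<lambda>x. u x - v x)) < ennreal (2 powr p) * (ennreal ?e + ennreal ?e)"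
    by (intro ennreal_mult_strict_left_mono add_strict_mono r0(2)[OF r(1,2) \<eta>] uv) auto
  also have "\<dots> = ennreal \<epsilon>"
    using e0 by (simp add: ennreal_mult'[symmetric] ennreal_plus[symmetric] del: ennreal_plus)
  finally show ?thesis using \<phi> by blast
qed

end

section \<open>From the \<open>A_p\<close> condition to the averaging inequality\<close>

text \<open>
  Young's inequality for \<open>f x / A\<close> and \<open>g x / B\<close>, where \<open>A\<close> and \<open>B\<close> are the norms of \<open>f\<close> and \<open>g\<close>.
\<close>
lemma holder_nn_integral:
  fixes f g :: "'a \<Rightarrow> real"
  assumes [measurable]: "f \<in> borel_measurable M" "g \<in> borel_measurable M"
    and f0: "\<And>x. 0 \<le> f x" and g0: "\<And>x. 0 \<le> g x" and p: "1 < p" and q: "q = p / (p - 1)"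
    and a: "(\<integral>\<^sup>+ x. ennreal (f x powr p) \<partial>M) = ennreal a" "0 \<le> a"
    and b: "(\<integral>\<^sup>+ x. ennreal (g x powr q) \<partial>M) = ennreal b" "0 < b"
  shows "(\<integral>\<^sup>+ x. ennreal (f x * g x) \<partial>M) \<le> ennreal (a powr (1 / p) * b powr (1 / q))"
proof (cases "a = 0")
  case True
  then have "(\<integral>\<^sup>+ x. ennreal (f x powr p) \<partial>M) = 0" using a by simp
  then have "AE x in M. ennreal (f x powr p) = 0" by (subst (asm) nn_integral_0_iff_AE) auto
  then have "AE x in M. ennreal (f x * g x) = 0"
  proof eventually_elim
    case (elim x)
    then have "\<not> 0 < f x powr p" by (simp add: ennreal_eq_0_iff)
    then have "f x = 0" by (simp only: powr_gt_zero simp_thms)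
    then show ?case by simp
  qed
  then have "(\<integral>\<^sup>+ x. ennreal (f x * g x) \<partial>M) = 0" by (subst nn_integral_0_iff_AE) auto
  then show ?thesis by simp
next
  case False
  then have a0: "0 < a" using a by simp
  have q1: "1 < q" "1 / p + 1 / q = 1" using p unfolding q by (simp_all add: less_divide_eq diff_divide_distrib)
  define A where "A = a powr (1 / p)"
  define B where "B = b powr (1 / q)"
  have AB: "0 < A" "0 < B" using a0 b by (simp_all add: A_def B_def)
  have Ap: "A powr p = a" "B powr q = b" using a0 b p q1 by (simp_all add: A_def B_def powr_powr)
  have pt: "f x * g x \<le> A * B / (p * a) * f x powr p + A * B / (q * b) * g x powr q" for x
  proof -
    have "(f x / A) * (g x / B) \<le> (f x / A) powr p / p + (g x / B) powr q / q"
      by (rule Youngs_inequality[OF p q1]) (use f0 g0 AB in auto)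
    also have "(f x / A) powr p = f x powr p / a" using AB f0 by (simp add: powr_divide Ap)
    also have "(g x / B) powr q = g x powr q / b" using AB g0 by (simp add: powr_divide Ap)
    finally have "A * B * ((f x / A) * (g x / B)) \<le> A * B * (f x powr p / a / p + g x powr q / b / q)"
      using AB by (intro mult_left_mono) auto
    moreover have "A * B * ((f x / A) * (g x / B)) = f x * g x" using AB by simp
    ultimately show ?thesis by (simp add: distrib_left mult_ac)
  qed
  have n: "0 \<le> A * B / (p * a)" "0 \<le> A * B / (q * b)" using AB a0 b p q1 by simp_all
  have "(\<integral>\<^sup>+ x. ennreal (f x * g x) \<partial>M) \<le> (\<integral>\<^sup>+ x. ennreal (A * B / (p * a)) * ennreal (f x powr p) + ennreal (A * B / (q * b)) * ennreal (g x powr q) \<partial>M)"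
  proof (rule nn_integral_mono)
    fix x
    have "ennreal (f x * g x) \<le> ennreal (A * B / (p * a) * f x powr p + A * B / (q * b) * g x powr q)"
      by (rule ennreal_leI[OF pt])
    also have "\<dots> = ennreal (A * B / (p * a) * f x powr p) + ennreal (A * B / (q * b) * g x powr q)"
      by (rule ennreal_plus[OF mult_nonneg_nonneg[OF n(1) powr_ge_zero] mult_nonneg_nonneg[OF n(2) powr_ge_zero]])
    finally show "ennreal (f x * g x) \<le> ennreal (A * B / (p * a)) * ennreal (f x powr p) + ennreal (A * B / (q * b)) * ennreal (g x powr q)"
      by (simp only: ennreal_mult'[OF n(1)] ennreal_mult'[OF n(2)])
  qed
  also have "\<dots> = (\<integral>\<^sup>+ x. ennreal (A * B / (p * a)) * ennreal (f x powr p) \<partial>M) + (\<integral>\<^sup>+ x. ennreal (A * B / (q * b)) * ennreal (g x powr q) \<partial>M)"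
    by (rule nn_integral_add) measurable
  also have "(\<integral>\<^sup>+ x. ennreal (A * B / (p * a)) * ennreal (f x powr p) \<partial>M) = ennreal (A * B / (p * a)) * ennreal a"
    unfolding a(1)[symmetric] by (rule nn_integral_cmult) measurable
  also have "(\<integral>\<^sup>+ x. ennreal (A * B / (q * b)) * ennreal (g x powr q) \<partial>M) = ennreal (A * B / (q * b)) * ennreal b"
    unfolding b(1)[symmetric] by (rule nn_integral_cmult) measurable
  also have "ennreal (A * B / (p * a)) * ennreal a + ennreal (A * B / (q * b)) * ennreal b = ennreal (A * B)"
  proof -
    have "ennreal (A * B / (p * a)) * ennreal a + ennreal (A * B / (q * b)) * ennreal b
      = ennreal (A * B / (p * a) * a + A * B / (q * b) * b)"
      using n a0 b by (simp only: ennreal_mult[symmetric] ennreal_plus[symmetric] mult_nonneg_nonneg less_imp_le)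
    also have "A * B / (p * a) * a + A * B / (q * b) * b = A * B * (1 / p + 1 / q)"
      using a0 b by (simp add: distrib_left)
    finally show ?thesis using q1 by simp
  qed
  finally show ?thesis by (simp add: A_def B_def)
qed

lemma L1_loc_measurable:
  fixes f :: "'a::euclidean_space \<Rightarrow> real"
  assumes "f \<in> L1_loc" shows "f \<in> borel_measurable lebesgue"
proof (rule borel_measurable_LIMSEQ_real)
  fix n
  have "f absolutely_integrable_on (cball 0 (real n))" using assms by (simp add: L1_loc_def)
  then show "(\<lambda>x. indicator (cball 0 (real n)) x *\<^sub>R f x) \<in> borel_measurable lebesgue"
    unfolding set_integrable_def by (rule borel_measurable_integrable)
next
  fix x :: 'a
  obtain n0 where n0: "norm x \<le> real n0" using real_arch_simple by blast
  have "\<forall>\<^sub>F n in sequentially. indicator (cball 0 (real n)) x *\<^sub>R f x = f x"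
    unfolding eventually_sequentially using n0 by (intro exI[of _ n0]) auto
  then show "(\<lambda>n. indicator (cball 0 (real n)) x *\<^sub>R f x) \<longlonglongrightarrow> f x" by (rule tendsto_eventually)
qed

lemma L1_loc_borel_version:
  fixes f :: "'a::euclidean_space \<Rightarrow> real"
  assumes "f \<in> L1_loc"
  obtains g where "g \<in> borel_measurable borel" "AE x in lborel. f x = g x"
  using completion_ex_borel_measurable_real[OF L1_loc_measurable[OF assms]] by auto

lemma AE_ball_nonneg_integral_pos:
  fixes f :: "'a::euclidean_space \<Rightarrow> real"
  assumes [measurable]: "f \<in> borel_measurable borel" and "AE x in lborel. 0 < f x" and r: "0 < r"
  shows "0 < (\<integral>\<^sup>+ y. ennreal (indicator (ball x r) y * f y) \<partial>lborel)"
proof (rule ccontr)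
  assume "\<not> ?thesis"
  then have "(\<integral>\<^sup>+ y. ennreal (indicator (ball x r) y * f y) \<partial>lborel) = 0" by (simp add: not_less)
  then have "AE y in lborel. ennreal (indicator (ball x r) y * f y) = 0"
    by (subst (asm) nn_integral_0_iff_AE) measurable
  with assms(2) have "AE y in lborel. y \<notin> ball x r"
    by eventually_elim (auto simp: ennreal_eq_0_iff split: split_indicator)
  then have "emeasure lborel (ball x r) = 0"
    by (subst (asm) AE_iff_measurable[of "ball x r"]) auto
  then have "measure lborel (ball x r) = 0" by (simp add: measure_def)
  then show False using content_ball_pos[OF r, of x] by simp
qed

text \<open>
  Replace \<open>w\<close> by a nonnegative Borel function equal to it almost everywhere. The averaging inequality is
  Hoelder's inequality for \<open>f = (f w^(1/p)) w^(-1/p)\<close> over a ball, where the second factor, raised to the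
  conjugate exponent, is the function \<open>w^(1/(1-p))\<close> of the \<open>A_p\<close> condition.
\<close>
lemma Ap_class_imp_Ap_density:
  fixes w :: "'a::euclidean_space \<Rightarrow> real"
  assumes w: "w \<in> Ap_class p" and p: "1 < p" and s: "0 < s" "s < 1"
  obtains w' K where "Ap_density w' p K s" "AE x in lborel. w x = w' x"
    "\<And>x r. weight_meas w (ball x r) = Ap_density.m w' x r"
proof -
  have wt: "w \<in> L1_loc" "AE x in lebesgue. 0 < w x" and Apc: "Ap_const p w < \<infinity>"
    using w by (auto simp: Ap_class_def weight_def)
  obtain g where gm [measurable]: "g \<in> borel_measurable borel" and wg: "AE x in lborel. w x = g x"
    using L1_loc_borel_version[OF wt(1)] .
  have wpos: "AE x in lborel. 0 < w x" using wt(2) by (simp add: AE_completion_iff)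
  define w' where "w' x = max 0 (g x)" for x
  have w'm [measurable]: "w' \<in> borel_measurable borel" unfolding w'_def by measurable
  have w'0: "0 \<le> w' x" for x by (simp add: w'_def)
  have ww': "AE x in lborel. w x = w' x" using wg wpos by eventually_elim (simp add: w'_def)
  have w'pos: "AE x in lborel. 0 < w' x" using ww' wpos by eventually_elim simp
  let ?\<mu> = "density lborel (\<lambda>x. ennreal (w' x))"
  have em: "emeasure ?\<mu> (ball x r) = (\<integral>\<^sup>+ y. ennreal (indicator (ball x r) y * w' y) \<partial>lborel)" for x r
  proof -
    have "emeasure ?\<mu> (ball x r) = (\<integral>\<^sup>+ y. ennreal (w' y) * indicator (ball x r) y \<partial>lborel)"
      by (rule emeasure_density) auto
    also have "\<dots> = (\<integral>\<^sup>+ y. ennreal (indicator (ball x r) y * w' y) \<partial>lborel)"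
      by (intro nn_integral_cong) (auto split: split_indicator)
    finally show ?thesis .
  qed
  have [measurable]: "(indicator (cball x r) :: 'a \<Rightarrow> real) \<in> borel_measurable borel" for x r
    by (rule borel_measurable_indicator) simp
  have lm: "w \<in> borel_measurable lebesgue" "w' \<in> borel_measurable lebesgue"
    using L1_loc_measurable[OF wt(1)] by (simp_all add: measurable_completion)
  have cut: "(\<lambda>y. indicator A y * w y :: real) \<in> borel_measurable lebesgue"
    "(\<lambda>y. indicator A y * w' y :: real) \<in> borel_measurable lebesgue"
    "AE y in lebesgue. indicator A y * w y = indicator A y * w' y" if "A \<in> sets lebesgue" for A
  proof -
    show "(\<lambda>y. indicator A y * w y :: real) \<in> borel_measurable lebesgue"
      by (rule borel_measurable_times[OF borel_measurable_indicator[OF that] lm(1)])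
    show "(\<lambda>y. indicator A y * w' y :: real) \<in> borel_measurable lebesgue"
      by (rule borel_measurable_times[OF borel_measurable_indicator[OF that] lm(2)])
    have "AE y in lborel. indicator A y * w y = indicator A y * w' y" using ww' by eventually_elim simp
    then show "AE y in lebesgue. indicator A y * w y = indicator A y * w' y" by (rule AE_completion)
  qed
  have iw: "integrable lborel (\<lambda>y. indicator (ball x r) y * w' y)" for x r
  proof -
    have "w absolutely_integrable_on cball x r" using wt(1) by (simp add: L1_loc_def)
    then have "integrable lebesgue (\<lambda>y. indicator (cball x r) y * w y)" by (simp add: set_integrable_def)
    moreover have "integrable lebesgue (\<lambda>y. indicator (cball x r) y * w y) = integrable lebesgue (\<lambda>y. indicator (cball x r) y * w' y)"
    by (intro integrable_cong_AE cut) auto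
    ultimately have "integrable lebesgue (\<lambda>y. indicator (cball x r) y * w' y)" by simp
    then have c: "integrable lborel (\<lambda>y. indicator (cball x r) y * w' y)"
      by (subst (asm) integrable_completion) auto
    show ?thesis
    proof (rule Bochner_Integration.integrable_bound[OF c])
      show "AE y in lborel. norm (indicator (ball x r) y * w' y) \<le> norm (indicator (cball x r) y * w' y)"
        using w'0 by (intro AE_I2) (auto split: split_indicator)
    qed measurable
  qed
  have fin: "emeasure ?\<mu> (ball x r) < \<infinity>" for x r
  proof -
    have "(\<integral>\<^sup>+ y. ennreal (norm (indicator (ball x r) y * w' y)) \<partial>lborel) < \<infinity>"
      using iw[of x r] unfolding integrable_iff_bounded by blast
    then show ?thesis unfolding em using w'0 by simp
  qed
  have pos: "0 < emeasure ?\<mu> (ball x r)" if "0 < r" for x r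
    unfolding em by (rule AE_ball_nonneg_integral_pos[OF w'm w'pos that])
  have wm: "weight_meas w (ball x r) = measure ?\<mu> (ball x r)" for x r
  proof -
    have "weight_meas w (ball x r) = integral\<^sup>L lebesgue (\<lambda>y. indicator (ball x r) y * w y)"
      by (simp add: weight_meas_def set_lebesgue_integral_def)
    also have "\<dots> = integral\<^sup>L lebesgue (\<lambda>y. indicator (ball x r) y * w' y)"
    by (intro integral_cong_AE cut) auto
    also have "\<dots> = integral\<^sup>L lborel (\<lambda>y. indicator (ball x r) y * w' y)"
      by (rule integral_completion) measurable
    also have "\<dots> = enn2real (\<integral>\<^sup>+ y. ennreal (indicator (ball x r) y * w' y) \<partial>lborel)"
      by (rule integral_eq_nn_integral) (use w'0 in auto)
    finally show ?thesis by (simp only: measure_def em)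
  qed
  obtain A where A: "Ap_const p w = ennreal A" "0 \<le> A" using Apc by (cases "Ap_const p w") auto
  define K where "K = A + 1"
  have Ap: "ennreal (measure ?\<mu> (ball x r) * avg x r f powr p)
      \<le> ennreal K * (\<integral>\<^sup>+ z. ennreal (indicator (ball x r) z * f z powr p) \<partial>?\<mu>)"
    if fm [measurable]: "f \<in> borel_measurable borel" and f0: "\<And>x. 0 \<le> f x" and fB: "\<And>x. f x \<le> B" and r: "0 < r" for f B x r
  proof -
    let ?B = "ball x r"
    let ?\<sigma> = "\<lambda>y. w' y powr (1 / (1 - p))"
    define V where "V = measure lborel ?B"
    define M where "M = measure ?\<mu> ?B"
    have V: "0 < V" unfolding V_def using r by (rule content_ball_pos)
    have Ve: "emeasure lebesgue ?B = ennreal V"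
      unfolding V_def using emeasure_lborel_ball_finite[of x r] by (simp add: emeasure_eq_ennreal_measure less_top)
    have Me: "emeasure ?\<mu> ?B = ennreal M" unfolding M_def using fin[of x r] by (simp add: emeasure_eq_ennreal_measure less_top)
    have M: "0 < M" using pos[OF r, of x] Me by simp
    have aw: "average w ?B = ennreal (M / V)"
    proof -
      have "(\<integral>\<^sup>+ y. ennreal (w y) * indicator ?B y \<partial>lborel) = (\<integral>\<^sup>+ y. ennreal (w' y) * indicator ?B y \<partial>lborel)"
        by (rule nn_integral_cong_AE) (use ww' in \<open>eventually_elim, simp\<close>)
      also have "\<dots> = ennreal M" unfolding Me[symmetric] by (rule emeasure_density[symmetric]) auto
      finally show ?thesis unfolding average_def Ve nn_integral_completion using V M by (simp add: divide_ennreal)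
    qed
    define S where "S = (\<integral>\<^sup>+ y. ennreal (indicator ?B y * ?\<sigma> y) \<partial>lborel)"
    have as: "average (\<lambda>x. w x powr (1 / (1 - p))) ?B = S / ennreal V"
    proof -
      have "(\<integral>\<^sup>+ y. ennreal (w y powr (1 / (1 - p))) * indicator ?B y \<partial>lborel) = S"
        unfolding S_def by (rule nn_integral_cong_AE) (use ww' in \<open>eventually_elim, auto split: split_indicator\<close>)
      then show ?thesis unfolding average_def Ve nn_integral_completion by simp
    qed
    have le: "ennreal (M / V) * ennreal_rpow (S / ennreal V) (p - 1) \<le> ennreal A"
    proof -
      have "average w ?B * ennreal_rpow (average (\<lambda>x. w x powr (1 / (1 - p))) ?B) (p - 1) \<le> Ap_const p w"
        unfolding Ap_const_def by (rule SUP_upper2[of "(x, r)"]) (use r in auto)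
      then show ?thesis unfolding aw as A(1) .
    qed
    (* an infinite dual average would make the A_p product infinite, since the average of w is positive *)
    have "S \<noteq> \<infinity>"
    proof
      assume "S = \<infinity>"
      then have "S / ennreal V = \<infinity>" using V by (simp add: ennreal_top_divide)
      then have "ennreal (M / V) * ennreal_rpow (S / ennreal V) (p - 1) = \<infinity>"
        using M V by (simp add: ennreal_rpow_def ennreal_mult_top)
      then show False using le by (simp add: top_unique)
    qed
    then obtain b where b: "S = ennreal b" "0 \<le> b" by (cases S) auto
    have "AE y in lborel. 0 < ?\<sigma> y" using w'pos by eventually_elim simp
    then have "0 < S" unfolding S_def by (intro AE_ball_nonneg_integral_pos r) measurable
    then have b0: "0 < b" using b by simp
    have leA: "M / V * (b / V) powr (p - 1) \<le> A"
    proof -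
      have "S / ennreal V = ennreal (b / V)" using b V by (simp add: divide_ennreal)
      then have "ennreal (M / V) * ennreal ((b / V) powr (p - 1)) \<le> ennreal A"
        using le b0 V by (simp add: ennreal_rpow_def)
      then have "ennreal (M / V * (b / V) powr (p - 1)) \<le> ennreal A"
        using M V by (subst ennreal_mult') auto
      then show ?thesis using A(2) by simp
    qed
    let ?I = "\<integral>\<^sup>+ z. ennreal (indicator ?B z * f z powr p) \<partial>?\<mu>"
    have Ifin: "?I < \<infinity>"
    proof -
      have "?I \<le> (\<integral>\<^sup>+ z. ennreal (B powr p) * indicator ?B z \<partial>?\<mu>)"
      proof (rule nn_integral_mono)
        fix z
        have "f z powr p \<le> B powr p" using f0 fB p by (intro powr_mono2) auto
        then show "ennreal (indicator ?B z * f z powr p) \<le> ennreal (B powr p) * indicator ?B z"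
          by (auto split: split_indicator intro: ennreal_leI)
      qed
      also have "\<dots> = ennreal (B powr p) * emeasure ?\<mu> ?B" by (rule nn_integral_cmult_indicator) simp
      also have "\<dots> < \<infinity>" using fin[of x r] by (simp add: ennreal_mult_less_top)
      finally show ?thesis .
    qed
    then obtain a where a: "?I = ennreal a" "0 \<le> a" by (cases ?I) auto
    define F where "F = integral\<^sup>L lborel (\<lambda>z. indicator ?B z * f z)"
    have Fi: "integrable lborel (\<lambda>z. indicator ?B z * f z)"
      by (rule avg_integrable[where B=B]) (use f0 fB in \<open>auto simp: abs_of_nonneg\<close>)
    have F0: "0 \<le> F" unfolding F_def by (rule Bochner_Integration.integral_nonneg) (use f0 in simp)
    define q where "q = p / (p - 1)"
    let ?f = "\<lambda>y. indicator ?B y * (f y * w' y powr (1 / p))"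
    let ?g = "\<lambda>y. indicator ?B y * w' y powr (- (1 / p))"
    have "ennreal F = (\<integral>\<^sup>+ z. ennreal (indicator ?B z * f z) \<partial>lborel)"
      unfolding F_def by (rule nn_integral_eq_integral[symmetric, OF Fi]) (use f0 in simp)
    also have "\<dots> = (\<integral>\<^sup>+ z. ennreal (?f z * ?g z) \<partial>lborel)"
    proof (rule nn_integral_cong_AE)
      show "AE z in lborel. ennreal (indicator ?B z * f z) = ennreal (?f z * ?g z)"
        using w'pos
      proof eventually_elim
        case (elim z)
        have "w' z powr (1 / p) * w' z powr (- (1 / p)) = 1"
          unfolding powr_add[symmetric] using elim by simp
        then have "f z * w' z powr (1 / p) * w' z powr (- (1 / p)) = f z" by (simp only: mult.assoc mult_1_right)
        moreover have "?f z * ?g z = indicator ?B z * (f z * w' z powr (1 / p) * w' z powr (- (1 / p)))"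
          by (cases "z \<in> ?B") simp_all
        ultimately show ?case by (simp only:)
      qed
    qed
    also have "\<dots> \<le> ennreal (a powr (1 / p) * b powr (1 / q))"
    proof (rule holder_nn_integral[OF _ _ _ _ p q_def])
      have "(\<integral>\<^sup>+ y. ennreal (?f y powr p) \<partial>lborel) = (\<integral>\<^sup>+ y. ennreal (w' y) * ennreal (indicator ?B y * f y powr p) \<partial>lborel)"
      proof (rule nn_integral_cong)
        fix y
        have "?f y powr p = w' y * (indicator ?B y * f y powr p)"
          using p w'0[of y] by (cases "y \<in> ?B") (simp_all add: powr_mult powr_powr)
        then show "ennreal (?f y powr p) = ennreal (w' y) * ennreal (indicator ?B y * f y powr p)"
          by (simp only: ennreal_mult'[OF w'0])
      qed
      also have "\<dots> = ?I" by (rule nn_integral_density[symmetric]) measurable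
      finally show "(\<integral>\<^sup>+ y. ennreal (?f y powr p) \<partial>lborel) = ennreal a" using a by simp
      have "?g y powr q = indicator ?B y * ?\<sigma> y" for y
      proof -
        have "- (1 / p) * q = 1 / (1 - p)" unfolding q_def using p by (simp add: divide_simps)
        then show ?thesis by (cases "y \<in> ?B") (simp_all add: powr_powr)
      qed
      then show "(\<integral>\<^sup>+ y. ennreal (?g y powr q) \<partial>lborel) = ennreal b" using b(1) unfolding S_def by simp
    qed (use f0 a b0 in auto)
    finally have "F \<le> a powr (1 / p) * b powr (1 / q)" by (simp add: ennreal_le_iff)
    then have "F powr p \<le> (a powr (1 / p) * b powr (1 / q)) powr p" using F0 p by (intro powr_mono2) auto
    also have "\<dots> = a * b powr (p - 1)"
    proof -
      have "1 / q * p = p - 1" unfolding q_def using p by simp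
      then show ?thesis using a(2) p by (simp add: powr_mult powr_powr)
    qed
    finally have Fp: "F powr p \<le> a * b powr (p - 1)" .
    have "avg x r f = F / V" unfolding avg_def F_def V_def using measure_lborel_ball[OF r, of x] by simp
    then have "M * avg x r f powr p = M * (F powr p / V powr p)" using F0 V by (simp add: powr_divide)
    also have "\<dots> \<le> M * (a * b powr (p - 1) / V powr p)"
      using M Fp by (intro mult_left_mono divide_right_mono) auto
    also have "\<dots> = a * (M / V * (b / V) powr (p - 1))"
    proof -
      have "V powr p = V * V powr (p - 1)" using V by (simp add: powr_diff)
      then show ?thesis using b0 V by (simp add: powr_divide)
    qed
    also have "\<dots> \<le> a * A" using leA a(2) by (rule mult_left_mono)
    also have "\<dots> \<le> K * a" using a(2) by (simp add: K_def algebra_simps)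
    finally have "ennreal (M * avg x r f powr p) \<le> ennreal (K * a)" by (rule ennreal_leI)
    also have "\<dots> = ennreal K * ?I" unfolding a(1) by (rule ennreal_mult''[OF a(2)])
    finally show ?thesis unfolding M_def .
  qed
  have loc: "Ap_density w' p K s"
  proof
    show "0 < K" using A(2) by (simp add: K_def)
  qed (fact w'm w'0 p s fin pos Ap)+
  show thesis
  proof (rule that[OF loc ww'])
    show "weight_meas w (ball x r) = Ap_density.m w' x r" for x r
      unfolding Ap_density.m_def[OF loc] Ap_density.\<mu>_def[OF loc] by (rule wm)
  qed
qed

text \<open>
  A Lebesgue null set of the product is contained in a Borel null set, to which Tonelli's theorem applies.
\<close>
lemma AE_lebesgue_pair_sections:
  fixes P :: "'a::euclidean_space \<Rightarrow> 'a \<Rightarrow> bool"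
  assumes "AE (x, y) in lebesgue. P x y"
  shows "AE y in lborel. AE x in lborel. P x y"
proof -
  let ?L = "lborel :: 'a measure"
  have "AE z in (lborel :: ('a \<times> 'a) measure). P (fst z) (snd z)"
    using assms by (simp add: AE_completion_iff case_prod_unfold)
  then have "AE z in ?L \<Otimes>\<^sub>M ?L. P (fst z) (snd z)"
    by (simp only: lborel_prod)
  then obtain N where N: "{z \<in> space (?L \<Otimes>\<^sub>M ?L). \<not> P (fst z) (snd z)} \<subseteq> N" "N \<in> null_sets (?L \<Otimes>\<^sub>M ?L)"
    by (auto simp: eventually_ae_filter)
  then have "AE z in ?L \<Otimes>\<^sub>M ?L. z \<notin> N" by (intro AE_not_in)
  from lborel_pair.AE_pair[OF this] have "AE x in ?L. AE y in ?L. (x, y) \<notin> N" .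
  moreover have "{z \<in> space (?L \<Otimes>\<^sub>M ?L). (case z of (x, y) \<Rightarrow> (x, y) \<notin> N)} \<in> sets (?L \<Otimes>\<^sub>M ?L)"
  proof -
    have "{z \<in> space (?L \<Otimes>\<^sub>M ?L). (case z of (x, y) \<Rightarrow> (x, y) \<notin> N)} = space (?L \<Otimes>\<^sub>M ?L) - N" by auto
    then show ?thesis by (simp only:) (intro sets.Diff sets.top null_setsD2 N(2))
  qed
  ultimately have "AE y in ?L. AE x in ?L. (x, y) \<notin> N"
    using lborel_pair.AE_commute[of "\<lambda>x y. (x, y) \<notin> N"] by (simp add: case_prod_unfold)
  moreover have "P x y" if "(x, y) \<notin> N" for x y
  proof (rule ccontr)
    assume "\<not> P x y"
    then have "(x, y) \<in> N" by (intro subsetD[OF N(1)]) (simp add: space_pair_measure)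
    with that show False by blast
  qed
  ultimately show ?thesis by (auto elim!: eventually_mono)
qed

section \<open>Density of smooth functions\<close>
lemma ennreal_rpow_less:
  assumes "e < ennreal (\<epsilon> powr p)" "0 < \<epsilon>" "0 < p"
  shows "ennreal_rpow e (1 / p) < ennreal \<epsilon>"
proof -
  obtain t where t: "e = ennreal t" "0 \<le> t" using assms(1) by (cases e) auto
  then have "t < \<epsilon> powr p" using assms(1) by (simp add: ennreal_less_iff)
  then have "t powr (1 / p) < (\<epsilon> powr p) powr (1 / p)" using t assms by (intro powr_less_mono2) auto
  also have "\<dots> = \<epsilon>" using assms by (simp add: powr_powr)
  finally show ?thesis using t assms by (simp add: ennreal_rpow_def ennreal_lessI)
qed

context Ap_density
begin

text \<open>
  The density of \<open>En\<close> with respect to Lebesgue measure in both variables, in which form it is compared with the given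
  kernel.
\<close>
definition J :: "('a \<Rightarrow> real) \<Rightarrow> 'a \<Rightarrow> 'a \<Rightarrow> real" where
  "J u x y = \<bar>u x - u y\<bar> powr p * norm (x - y) powr (- (s * p)) * (w x * w y / measure \<mu> (mid_ball x y))"

lemma J_measurable [measurable (raw)]:
  assumes [measurable]: "u \<in> borel_measurable borel" "f \<in> N \<rightarrow>\<^sub>M borel" "g \<in> N \<rightarrow>\<^sub>M borel"
  shows "(\<lambda>x. J u (f x) (g x)) \<in> borel_measurable N"
  unfolding J_def by measurable

lemma En_eq_J:
  assumes [measurable]: "u \<in> borel_measurable borel"
  shows "En u = (\<integral>\<^sup>+ y. \<integral>\<^sup>+ x. ennreal (J u x y) \<partial>lborel \<partial>lborel)"
proof -
  let ?e = "\<lambda>x y. ennreal (\<bar>u x - u y\<bar> powr p * kern x y)"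
  have inner: "(\<integral>\<^sup>+ x. ?e x y \<partial>\<mu>) = (\<integral>\<^sup>+ x. ennreal (w x) * ?e x y \<partial>lborel)" for y
    unfolding \<mu>_def by (rule nn_integral_density) measurable
  have "En u = (\<integral>\<^sup>+ y. ennreal (w y) * (\<integral>\<^sup>+ x. ?e x y \<partial>\<mu>) \<partial>lborel)"
  proof -
    have [measurable]: "(\<lambda>y. \<integral>\<^sup>+ x. ?e x y \<partial>\<mu>) \<in> borel_measurable borel" by measurable
    have "(\<integral>\<^sup>+ y. (\<integral>\<^sup>+ x. ?e x y \<partial>\<mu>) \<partial>density lborel (\<lambda>x. ennreal (w x))) = (\<integral>\<^sup>+ y. ennreal (w y) * (\<integral>\<^sup>+ x. ?e x y \<partial>\<mu>) \<partial>lborel)"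
      by (rule nn_integral_density) measurable
    then show ?thesis unfolding En_def by (simp only: \<mu>_def)
  qed
  also have "\<dots> = (\<integral>\<^sup>+ y. \<integral>\<^sup>+ x. ennreal (J u x y) \<partial>lborel \<partial>lborel)"
  proof (rule nn_integral_cong)
    fix y
    have "ennreal (w y) * (\<integral>\<^sup>+ x. ?e x y \<partial>\<mu>) = (\<integral>\<^sup>+ x. ennreal (w y) * (ennreal (w x) * ?e x y) \<partial>lborel)"
      unfolding inner by (rule nn_integral_cmult[symmetric]) measurable
    also have "\<dots> = (\<integral>\<^sup>+ x. ennreal (J u x y) \<partial>lborel)"
    proof (rule nn_integral_cong)
      fix x
      have "ennreal (w y) * (ennreal (w x) * ?e x y) = ennreal (w y * (w x * (\<bar>u x - u y\<bar> powr p * kern x y)))"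
        by (simp only: ennreal_mult'[OF w_nonneg])
      also have "w y * (w x * (\<bar>u x - u y\<bar> powr p * kern x y)) = J u x y"
        by (simp add: J_def kern_def)
      finally show "ennreal (w y) * (ennreal (w x) * ?e x y) = ennreal (J u x y)" .
    qed
    finally show "ennreal (w y) * (\<integral>\<^sup>+ x. ?e x y \<partial>\<mu>) = (\<integral>\<^sup>+ x. ennreal (J u x y) \<partial>lborel)" .
  qed
  finally show ?thesis .
qed

lemma cmult_En:
  assumes [measurable]: "u \<in> borel_measurable borel" and c: "0 \<le> c"
  shows "(\<integral>\<^sup>+ y. \<integral>\<^sup>+ x. ennreal (c * J u x y) \<partial>lborel \<partial>lborel) = ennreal c * En u"
proof -
  have "(\<integral>\<^sup>+ y. \<integral>\<^sup>+ x. ennreal (c * J u x y) \<partial>lborel \<partial>lborel) = (\<integral>\<^sup>+ y. \<integral>\<^sup>+ x. ennreal c * ennreal (J u x y) \<partial>lborel \<partial>lborel)"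
    by (simp only: ennreal_mult'[OF c])
  also have "\<dots> = (\<integral>\<^sup>+ y. ennreal c * (\<integral>\<^sup>+ x. ennreal (J u x y) \<partial>lborel) \<partial>lborel)"
    by (intro nn_integral_cong nn_integral_cmult) measurable
  also have "\<dots> = ennreal c * (\<integral>\<^sup>+ y. (\<integral>\<^sup>+ x. ennreal (J u x y) \<partial>lborel) \<partial>lborel)"
    by (intro nn_integral_cmult) measurable
  finally show ?thesis by (simp only: En_eq_J[OF assms(1)])
qed

text \<open>
  The kernel bounds hold for almost every \<open>x\<close>, for almost every \<open>y\<close>, which suffices for the iterated
  integral. Both sides depend on \<open>v\<close> and on the weight only up to null sets.
\<close>
lemma energy_comparable:
  assumes um: "u \<in> borel_measurable borel" and vu: "AE x in lborel. v x = u x"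
    and wae: "AE x in lborel. w0 x = w x" and wm: "\<And>x r. weight_meas w0 (ball x r) = m x r"
    and lam: "0 < lam" "lam \<le> Lam" and k: "admissible_kernel w0 lam Lam k"
  shows "energy s p k v \<le> ennreal (s * (1 - s)) * (ennreal Lam * En u)"
    and "ennreal (s * (1 - s)) * (ennreal lam * En u) \<le> energy s p k v"
proof -
  let ?i = "\<lambda>x y. (\<bar>v x - v y\<bar> / norm (x - y) powr s) powr p * k x y"
  let ?W = "\<lambda>x y. w0 x * w0 y / weight_meas w0 (mid_ball x y)"
  have "AE (x, y) in lebesgue. lam * ?W x y \<le> k x y \<and> k x y \<le> Lam * ?W x y"
    using k unfolding admissible_kernel_def by blast
  from AE_lebesgue_pair_sections[OF this]
  have kb: "AE y in lborel. AE x in lborel. lam * ?W x y \<le> k x y \<and> k x y \<le> Lam * ?W x y" .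
  have both: "AE y in lborel. AE x in lborel. lam * J u x y \<le> ?i x y \<and> ?i x y \<le> Lam * J u x y"
    using kb vu wae
  proof eventually_elim
    case (elim y)
    from elim(1) vu wae show ?case
    proof eventually_elim
      case E: (elim x)
      have W: "?W x y = w x * w y / measure \<mu> (mid_ball x y)"
        using E(3) elim(3) by (simp add: mid_ball_def wm m_def)
      let ?q = "\<bar>u x - u y\<bar> powr p * norm (x - y) powr (- (s * p))"
      have q: "(\<bar>v x - v y\<bar> / norm (x - y) powr s) powr p = ?q"
        using E(2) elim(2) by (simp add: powr_divide powr_powr powr_minus_divide)
      have q0: "0 \<le> ?q" by simp
      have Jq: "J u x y = ?q * ?W x y" unfolding J_def W ..
      have "?q * (lam * ?W x y) \<le> ?q * k x y" "?q * k x y \<le> ?q * (Lam * ?W x y)"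
        using E(1) by (intro mult_left_mono[OF _ q0]; simp)+
      then show ?case unfolding q Jq by (simp only: mult.left_commute)
    qed
  qed
  have en: "energy s p k v = ennreal (s * (1 - s)) * (\<integral>\<^sup>+ y. \<integral>\<^sup>+ x. ennreal (?i x y) \<partial>lborel \<partial>lborel)"
    unfolding energy_def nn_integral_completion ..
  have "(\<integral>\<^sup>+ y. \<integral>\<^sup>+ x. ennreal (?i x y) \<partial>lborel \<partial>lborel) \<le> (\<integral>\<^sup>+ y. \<integral>\<^sup>+ x. ennreal (Lam * J u x y) \<partial>lborel \<partial>lborel)"
  proof (rule nn_integral_mono_AE)
    show "AE y in lborel. (\<integral>\<^sup>+ x. ennreal (?i x y) \<partial>lborel) \<le> (\<integral>\<^sup>+ x. ennreal (Lam * J u x y) \<partial>lborel)"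
      using both
    proof eventually_elim
      case (elim y)
      show ?case by (rule nn_integral_mono_AE, rule eventually_mono[OF elim]) (auto intro: ennreal_leI)
    qed
  qed
  also have "\<dots> = ennreal Lam * En u" using lam by (intro cmult_En[OF um]) simp
  finally show "energy s p k v \<le> ennreal (s * (1 - s)) * (ennreal Lam * En u)"
    unfolding en by (rule mult_left_mono) simp
  have "ennreal lam * En u = (\<integral>\<^sup>+ y. \<integral>\<^sup>+ x. ennreal (lam * J u x y) \<partial>lborel \<partial>lborel)"
    using lam by (intro cmult_En[OF um, symmetric]) simp
  also have "\<dots> \<le> (\<integral>\<^sup>+ y. \<integral>\<^sup>+ x. ennreal (?i x y) \<partial>lborel \<partial>lborel)"
  proof (rule nn_integral_mono_AE)
    show "AE y in lborel. (\<integral>\<^sup>+ x. ennreal (lam * J u x y) \<partial>lborel) \<le> (\<integral>\<^sup>+ x. ennreal (?i x y) \<partial>lborel)"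
      using both
    proof eventually_elim
      case (elim y)
      show ?case by (rule nn_integral_mono_AE, rule eventually_mono[OF elim]) (auto intro: ennreal_leI)
    qed
  qed
  finally show "ennreal (s * (1 - s)) * (ennreal lam * En u) \<le> energy s p k v"
    unfolding en by (rule mult_left_mono) simp
qed

lemma En_Cc_infty_finite:
  assumes "\<phi> \<in> Cc_infty \<Omega>"
  shows "En \<phi> < \<infinity>"
proof -
  have Ck: "\<And>k. Ck k \<phi>" and cpt: "compact (closure {x. \<phi> x \<noteq> 0})" using assms by (auto simp: Cc_infty_def)
  have cont: "continuous_on UNIV \<phi>" using Ck[of 0] by simp
  have "bounded {x. \<phi> x \<noteq> 0}" using compact_imp_bounded[OF cpt] closure_subset by (rule bounded_subset)
  then obtain R where R: "{x. \<phi> x \<noteq> 0} \<subseteq> ball 0 R" using bounded_subset_ballD by blast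
  have z: "\<phi> x = 0" if "R \<le> norm x" for x using R that by force
  obtain L where L: "\<And>x h. \<bar>frechet_derivative \<phi> (at x) h\<bar> \<le> L * norm h"
    using Ck_derivative_bound[OF Ck, of R] z by (meson less_imp_le)
  obtain B where B: "\<And>x. \<bar>\<phi> x\<bar> \<le> B"
    using continuous_compact_support_bounded[OF cont, of R] z by (meson less_imp_le)
  show ?thesis
    by (rule En_finite_of_lipschitz[OF borel_measurable_continuous_onI[OF cont] Ck_lipschitz[OF Ck L] B z])
qed

end

lemma Cc_infty_borel: "\<phi> \<in> Cc_infty \<Omega> \<Longrightarrow> \<phi> \<in> borel_measurable borel"
proof -
  assume "\<phi> \<in> Cc_infty \<Omega>"
  then have "Ck 0 \<phi>" by (simp add: Cc_infty_def del: Ck.simps)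
  then show ?thesis by (intro borel_measurable_continuous_onI) simp
qed

lemma Cc_infty_zero_outside: "\<phi> \<in> Cc_infty \<Omega> \<Longrightarrow> x \<notin> \<Omega> \<Longrightarrow> \<phi> x = 0"
  using closure_subset[of "{x. \<phi> x \<noteq> 0}"] by (auto simp: Cc_infty_def)

lemma continuous_L1_loc:
  fixes f :: "'a::euclidean_space \<Rightarrow> real"
  assumes "continuous_on UNIV f"
  shows "f \<in> L1_loc"
  unfolding L1_loc_def
proof (intro CollectI allI impI)
  fix A :: "'a set" assume A: "compact A"
  have "continuous_on A f" using assms continuous_on_subset by blast
  then have "integrable lborel (\<lambda>x. indicator A x *\<^sub>R f x)" by (rule borel_integrable_compact[OF A])
  then show "f absolutely_integrable_on A"
    unfolding set_integrable_def by (subst integrable_completion) auto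
qed

theorem theorem2p17:
  fixes w :: "real ^ 'n \<Rightarrow> real"
    and k :: "real ^ 'n \<Rightarrow> real ^ 'n \<Rightarrow> real"
    and \<Omega> :: "(real ^ 'n) set"
    and s p lam Lam :: real
  assumes "CARD('n) \<ge> 2"
    and "0 < s" "s < 1" and "1 < p"
    and "w \<in> Ap_class p"
    and "0 < lam" "lam \<le> Lam"
    and "admissible_kernel w lam Lam k"
    and "open \<Omega>" "bounded \<Omega>" "fat_complement \<Omega>"
  shows "dense_wrt (sobolev_norm s p k) (Cc_infty \<Omega>) (sobolev0 s p k \<Omega>)"
proof -
  note s = assms(2,3) and p = assms(4) and lam = assms(6,7) and k = assms(8) and \<Omega> = assms(9,10)
  obtain w' K where loc: "Ap_density w' p K s" and wae: "AE x in lborel. w x = w' x"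
    and wm: "\<And>x r. weight_meas w (ball x r) = Ap_density.m w' x r"
    using Ap_class_imp_Ap_density[OF assms(5) p s] by blast
  interpret Ap_density w' p K s by (rule loc)
  obtain \<beta> where \<beta>: "0 < \<beta>" and "fat \<beta> \<Omega>"
    using assms(11) unfolding fat_complement_def fat_def by blast
  note compare = energy_comparable[OF _ _ wae wm lam k]
  have ss: "0 < s * (1 - s)" using s by simp
  show ?thesis unfolding dense_wrt_def
  proof (intro conjI subsetI ballI allI impI)
    fix \<phi> assume \<phi>: "\<phi> \<in> Cc_infty \<Omega>"
    have "Ck 0 \<phi>" using \<phi> by (simp add: Cc_infty_def del: Ck.simps)
    then have L: "\<phi> \<in> L1_loc" by (intro continuous_L1_loc) simp
    have "energy s p k \<phi> \<le> ennreal (s * (1 - s)) * (ennreal Lam * En \<phi>)"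
      by (rule compare(1)[OF Cc_infty_borel[OF \<phi>]]) simp
    also have "\<dots> < \<infinity>" using En_Cc_infty_finite[OF \<phi>] by (simp add: ennreal_mult_less_top)
    finally show "\<phi> \<in> sobolev0 s p k \<Omega>"
      using L Cc_infty_zero_outside[OF \<phi>] by (auto simp: sobolev0_def sobolev_def)
  next
    fix v and \<epsilon> :: real
    assume v: "v \<in> sobolev0 s p k \<Omega>" and \<epsilon>: "0 < \<epsilon>"
    have v1: "v \<in> L1_loc" and v2: "energy s p k v < \<infinity>" and "AE x in lebesgue. x \<notin> \<Omega> \<longrightarrow> v x = 0"
      using v by (auto simp: sobolev0_def sobolev_def)
    then have v0: "AE x in lborel. x \<notin> \<Omega> \<longrightarrow> v x = 0" by (simp add: AE_completion_iff)
    obtain g where g [measurable]: "g \<in> borel_measurable borel" and vg: "AE x in lborel. v x = g x"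
      using L1_loc_borel_version[OF v1] .
    (* the Borel representative that vanishes everywhere outside \<Omega>, not only almost everywhere *)
    define u where "u x = indicator \<Omega> x * g x" for x
    have [measurable]: "\<Omega> \<in> sets borel" using \<Omega>(1) by (rule borel_open)
    have um: "u \<in> borel_measurable borel" unfolding u_def by measurable
    have vu: "AE x in lborel. v x = u x"
      using vg v0 by eventually_elim (auto simp: u_def split: split_indicator)
    have u0: "u x = 0" if "x \<notin> \<Omega>" for x using that by (simp add: u_def)
    have fin: "En u < \<infinity>"
    proof -
      have "ennreal (s * (1 - s)) * (ennreal lam * En u) < \<infinity>"
        using compare(2)[OF um vu] v2 by (rule le_less_trans)
      then show ?thesis using ss lam by (auto simp: ennreal_mult_less_top)
    qed
    define c where "c = s * (1 - s) * Lam"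
    have c: "0 < c" using ss lam by (simp add: c_def)
    obtain \<phi> where \<phi>: "\<phi> \<in> Cc_infty \<Omega>" and En: "En (\<lambda>x. u x - \<phi> x) < ennreal (\<epsilon> powr p / c)"
      using smooth_approx[OF \<Omega> \<open>fat \<beta> \<Omega>\<close> \<beta> um u0 fin, where \<epsilon>="\<epsilon> powr p / c"] \<epsilon> c by auto
    note [measurable] = um Cc_infty_borel[OF \<phi>]
    have "energy s p k (\<lambda>x. v x - \<phi> x) \<le> ennreal (s * (1 - s)) * (ennreal Lam * En (\<lambda>x. u x - \<phi> x))"
    proof (rule compare(1))
      show "AE x in lborel. v x - \<phi> x = u x - \<phi> x" using vu by eventually_elim simp
    qed measurable
    also have "\<dots> = ennreal c * En (\<lambda>x. u x - \<phi> x)"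
      unfolding c_def by (subst ennreal_mult'[OF less_imp_le[OF ss]]) (rule mult.assoc[symmetric])
    also have "\<dots> < ennreal c * ennreal (\<epsilon> powr p / c)"
      using c by (intro ennreal_mult_strict_left_mono En) auto
    also have "\<dots> = ennreal (\<epsilon> powr p)" using c by (simp flip: ennreal_mult')
    finally have "sobolev_norm s p k (\<lambda>x. v x - \<phi> x) < ennreal \<epsilon>"
      unfolding sobolev_norm_def using \<epsilon> p by (intro ennreal_rpow_less) auto
    then show "\<exists>\<phi>\<in>Cc_infty \<Omega>. sobolev_norm s p k (\<lambda>x. v x - \<phi> x) < ennreal \<epsilon>"
      using \<phi> by blast
  qed
qed

end
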